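(* Let $\mathfrak{A}$ be a cofibrant $\mathbf{Gray}$-category, let $\mathfrak{B}$ be a $\mathbf{Gray}$-category and let $F,G:\mathfrak{A}\to\mathfrak{B}$ be $\mathbf{Gray}$-functors. (1) Suppose given $1$-cells $p_X:FX\to GX$ for all objects $X$ of $\mathfrak{A}$; adjoint equivalences $p_f\dashv p_f^*$ with $p_f:p_Y.Ff\Rightarrow Gf.p_X$ for all generating morphisms $f:X\to Y$; and invertible $3$-cells $p_\phi:p_g\circ(p_Y.F\phi)\Rrightarrow(G\phi.p_X)\circ p_f$ for all generating $2$-cells $\phi:f\Rightarrow g:X\to Y$, where $p_f$ for composite $f$ is determined by $p_{1_X}=1_{p_X}$ and $p_{hg}=(Gh.p_g)\circ(p_h.Fg)$. Extend $\phi\mapsto p_\phi$ to all $2$-cells of $\mathfrak{A}$ by the composition and whiskering laws for semi-strict trinatural transformations. If the resulting components satisfy local pseudonaturality with respect to all $3$-cells $\Omega:\phi\Rrightarrow\phi'$ of $\mathfrak{A}$ (that is, $((G\Omega.p_X)\circ p_f)\cdot p_\phi=p_{\phi'}\cdot(p_g\circ(p_Y.F\Omega))$), then there is a unique semi-strict trinatural transformation $p:F\to G$ with the given components. (2) Let $p,q:F\to G$ be semi-strict trinatural transformations. Suppose given $2$-cells $\sigma_X:p_X\Rightarrow q_X$ for all objects $X$, and invertible $3$-cells $\sigma_f:(Gf.\sigma_X)\circ p_f\Rrightarrow q_f\circ(\sigma_Y.Ff)$ for all generating morphisms $f$; extend $\sigma$ to all morphisms by the unit and composition laws. If these data satisfy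 the local modification condition for all generating $2$-cells of $\mathfrak{A}$, then there is a unique trimodification $\sigma:p\Rightarrow q$ with the given components. (3) Let $p,q:F\to G$ be semi-strict trinatural transformations and let $\sigma,\tau:p\Rightarrow q$ be trimodifications. If $3$-cells $\Omega_X:\sigma_X\Rrightarrow\tau_X$, for all objects $X$, satisfy the perturbation axiom for all generating morphisms of $\mathfrak{A}$, then they are the components of a (unique) perturbation $\Omega:\sigma\Rrightarrow\tau$.
   Context: CONVENTIONS. A $\mathbf{Gray}$-category is a category enriched in $2$-categories with the (pseudo) Gray tensor product. It is cofibrant if its underlying sesquicategory (objects, $1$-cells, $2$-cells with vertical composition and whiskering) is free on a $2$-computad; the edges and $2$-cells of that computad are the generating morphisms and generating $2$-cells (the source and target of a generating $2$-cell are arbitrary paths of generating morphisms). We write $.$ (or juxtaposition) for composition and whiskering along objects, $\circ$ for composition of $2$-cells in hom-$2$-categories, $\cdot$ for vertical composition of $3$-cells; whiskering of a $3$-cell $\Gamma$ with a $2$-cell $\phi$ is written $\Gamma\circ\phi$ or $\phi\circ\Gamma$, and the name of a cell also denotes its identity. For $\alpha:f\Rightarrow f':X\to Y$ and $\beta:g\Rightarrow g':Y\to Z$ the interchanger is the invertible $3$-cell $\beta_\alpha:(g'.\alpha)\circ(\beta.f)\Rrightarrow(\beta.f')\circ(g.\alpha)$. TRINATURAL TRANSFORMATIONS. A trinatural transformation $p:F\to G$ between $\mathbf{Gray}$-functors consists of: $1$-cells $p_X:FX\to GX$; for each $f:X\to Y$ an adjoint equivalence $p_f\dashv p_f^*$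 in $\mathfrak{B}(FX,GY)$ with $p_f:p_Y.Ff\Rightarrow Gf.p_X$; for each $\phi:f\Rightarrow g$ an invertible $3$-cell $p_\phi:p_g\circ(p_Y.F\phi)\Rrightarrow(G\phi.p_X)\circ p_f$; unitors: invertible $3$-cells $p^X:1_{p_X}\Rrightarrow p_{1_X}$; compositors: for $X\xrightarrow{f}Y\xrightarrow{g}Z$ invertible $3$-cells $p_{g,f}:(Gg.p_f)\circ(p_g.Ff)\Rrightarrow p_{gf}$. Axioms: local pseudonaturality: $p_{1_f}=1_{p_f}$; $p_{\psi\phi}=((G\psi.p_X)\circ p_\phi)\cdot(p_\psi\circ(p_Y.F\phi))$; $((G\Omega.p_X)\circ p_f)\cdot p_\phi=p_{\phi'}\cdot(p_g\circ(p_Y.F\Omega))$ for $\Omega:\phi\Rrightarrow\phi'$; right whiskering law for $\phi:f\Rightarrow f'$: $p_{g\phi}\cdot(p_{g,f'}\circ(p_Z.Fg.F\phi))=((Gg.G\phi.p_X)\circ p_{g,f})\cdot((Gg.p_\phi)\circ(p_g.Ff))\cdot((Gg.p_{f'})\circ(p_g)_{F\phi}^{-1})$; left whiskering law for $\psi:g\Rightarrow g'$: $p_{\psi f}\cdot(p_{g',f}\circ(p_Z.F\psi.Ff))=((G\psi.Gf.p_X)\circ p_{g,f})\cdot((G\psi)_{p_f}\circ(p_g.Ff))\cdot((Gg'.p_f)\circ(p_\psi.Ff))$; associativity: $p_{g,fe}\cdot((Gg.p_{f,e})\circ(p_g.Ff.Fe))=p_{gf,e}\cdot((Gg.Gf.p_e)\circ(p_{g,f}.Fe))$;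 unit laws: $p_{f,1_X}\cdot((Gf.p^X)\circ p_f)=1_{p_f}=p_{1_Y,f}\cdot(p_f\circ(p^Y.Ff))$. $p$ is semi-strict if all unitors and compositors are identities; this is understood to mean that the adjoint equivalence at $1_X$ is the identity and the one at $gf$ is the composite of those at $g$ and $f$ (including right adjoints, units and counits). TRIMODIFICATIONS. A trimodification $\sigma:p\Rightarrow q$ consists of $2$-cells $\sigma_X:p_X\Rightarrow q_X$ and invertible $3$-cells $\sigma_f:(Gf.\sigma_X)\circ p_f\Rrightarrow q_f\circ(\sigma_Y.Ff)$ such that: (local modification condition, for $\phi:f\Rightarrow g$) $(q_\phi\circ(\sigma_Y.Ff))\cdot(q_g\circ(\sigma_Y)_{F\phi}^{-1})\cdot(\sigma_g\circ(p_Y.F\phi))=((G\phi.q_X)\circ\sigma_f)\cdot((G\phi)_{\sigma_X}\circ p_f)\cdot((Gg.\sigma_X)\circ p_\phi)$; (unit law) $\sigma_{1_X}\cdot(\sigma_X\circ p^X)=q^X\circ\sigma_X$; (composition law) $\sigma_{gf}\cdot((Gg.Gf.\sigma_X)\circ p_{g,f})=(q_{g,f}\circ(\sigma_Z.Fg.Ff))\cdot((Gg.q_f)\circ(\sigma_g.Ff))\cdot((Gg.\sigma_f)\circ(p_g.Ff))$. PERTURBATIONS. A perturbation $\Omega:\sigma\Rrightarrow\tau$ consists of $3$-cells $\Omega_X:\sigma_X\Rrightarrow\tau_X$ satisfying the perturbation axiom $\tau_f\cdot((Gf.\Omega_X)\circ p_f)=(q_f\circ(\Omega_Y.Ff))\cdot\sigma_f$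 for every morphism $f:X\to Y$. *)

theory Defs
  imports Main "HOL-Library.FuncSet"
begin

section \<open>Strict 2-categories\<close>

record ('a, 'b, 'c) twocat =
  tObj :: "'a set"
  tArr :: "'b set"
  tCell :: "'c set"
  tdom :: "'b \<Rightarrow> 'a"
  tcod :: "'b \<Rightarrow> 'a"
  tsrc :: "'c \<Rightarrow> 'b"
  ttgt :: "'c \<Rightarrow> 'b"
  tid :: "'a \<Rightarrow> 'b"
  tcomp :: "'b \<Rightarrow> 'b \<Rightarrow> 'b" (infixl \<open>\<circledcirc>\<index>\<close> 70)
  tidc :: "'b \<Rightarrow> 'c"
  tvcomp :: "'c \<Rightarrow> 'c \<Rightarrow> 'c" (infixl \<open>\<boxdot>\<index>\<close> 65)
  thcomp :: "'c \<Rightarrow> 'c \<Rightarrow> 'c" (infixl \<open>\<circledast>\<index>\<close> 70)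

definition tin1 :: "('a, 'b, 'c, 'm) twocat_scheme \<Rightarrow> 'b \<Rightarrow> 'a \<Rightarrow> 'a \<Rightarrow> bool" where
  "tin1 C u x y \<longleftrightarrow> u \<in> tArr C \<and> tdom C u = x \<and> tcod C u = y"

definition tin2 :: "('a, 'b, 'c, 'm) twocat_scheme \<Rightarrow> 'c \<Rightarrow> 'b \<Rightarrow> 'b \<Rightarrow> bool" where
  "tin2 C s u v \<longleftrightarrow> s \<in> tCell C \<and> tsrc C s = u \<and> ttgt C s = v"

definition tinverse :: "('a, 'b, 'c, 'm) twocat_scheme \<Rightarrow> 'c \<Rightarrow> 'c \<Rightarrow> bool" where
  "tinverse C s t \<longleftrightarrow> s \<in> tCell C \<and> tin2 C t (ttgt C s) (tsrc C s)
     \<and> tvcomp C t s = tidc C (tsrc C s) \<and> tvcomp C s t = tidc C (ttgt C s)"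

definition tiso2 :: "('a, 'b, 'c, 'm) twocat_scheme \<Rightarrow> 'c \<Rightarrow> 'b \<Rightarrow> 'b \<Rightarrow> bool" where
  "tiso2 C s u v \<longleftrightarrow> tin2 C s u v \<and> (\<exists>t. tinverse C s t)"

locale two_category =
  fixes C :: "('a, 'b, 'c, 'm) twocat_scheme" (structure)
  assumes dom_cod: "u \<in> tArr C \<Longrightarrow> tdom C u \<in> tObj C \<and> tcod C u \<in> tObj C"
    and src_tgt: "s \<in> tCell C \<Longrightarrow> tsrc C s \<in> tArr C \<and> ttgt C s \<in> tArr C
      \<and> tdom C (tsrc C s) = tdom C (ttgt C s) \<and> tcod C (tsrc C s) = tcod C (ttgt C s)"
    and tid_in: "x \<in> tObj C \<Longrightarrow> tin1 C (tid C x) x x"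
    and tcomp_in: "\<lbrakk>tin1 C u x y; tin1 C v y z\<rbrakk> \<Longrightarrow> tin1 C (v \<circledcirc> u) x z"
    and tcomp_id_left: "tin1 C u x y \<Longrightarrow> tid C y \<circledcirc> u = u"
    and tcomp_id_right: "tin1 C u x y \<Longrightarrow> u \<circledcirc> tid C x = u"
    and tcomp_assoc: "\<lbrakk>tin1 C u x y; tin1 C v y z; tin1 C w z z'\<rbrakk>
      \<Longrightarrow> (w \<circledcirc> v) \<circledcirc> u = w \<circledcirc> (v \<circledcirc> u)"
    and tidc_in: "u \<in> tArr C \<Longrightarrow> tin2 C (tidc C u) u u"
    and tvcomp_in: "\<lbrakk>tin2 C s u v; tin2 C t v w\<rbrakk> \<Longrightarrow> tin2 C (t \<boxdot> s) u w"
    and tvcomp_id_left: "tin2 C s u v \<Longrightarrow> tidc C v \<boxdot> s = s"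
    and tvcomp_id_right: "tin2 C s u v \<Longrightarrow> s \<boxdot> tidc C u = s"
    and tvcomp_assoc: "\<lbrakk>tin2 C r u v; tin2 C s v w; tin2 C t w w'\<rbrakk>
      \<Longrightarrow> (t \<boxdot> s) \<boxdot> r = t \<boxdot> (s \<boxdot> r)"
    and thcomp_in: "\<lbrakk>tin2 C s u u'; tin2 C t v v'; tcod C u = tdom C v\<rbrakk>
      \<Longrightarrow> tin2 C (t \<circledast> s) (v \<circledcirc> u) (v' \<circledcirc> u')"
    and thcomp_id_left: "\<lbrakk>tin2 C s u u'; tin1 C u x y\<rbrakk> \<Longrightarrow> tidc C (tid C y) \<circledast> s = s"
    and thcomp_id_right: "\<lbrakk>tin2 C s u u'; tin1 C u x y\<rbrakk> \<Longrightarrow> s \<circledast> tidc C (tid C x) = s"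
    and thcomp_assoc: "\<lbrakk>tin2 C r u u'; tin2 C s v v'; tin2 C t w w';
        tcod C u = tdom C v; tcod C v = tdom C w\<rbrakk>
      \<Longrightarrow> (t \<circledast> s) \<circledast> r = t \<circledast> (s \<circledast> r)"
    and thcomp_tidc: "\<lbrakk>tin1 C u x y; tin1 C v y z\<rbrakk>
      \<Longrightarrow> tidc C v \<circledast> tidc C u = tidc C (v \<circledcirc> u)"
    and interchange: "\<lbrakk>tin2 C s u u'; tin2 C s' u' u''; tin2 C t v v'; tin2 C t' v' v'';
        tcod C u = tdom C v\<rbrakk>
      \<Longrightarrow> (t' \<boxdot> t) \<circledast> (s' \<boxdot> s) = (t' \<circledast> s') \<boxdot> (t \<circledast> s)"

locale two_functor =
  fixes C :: "('a, 'b, 'c, 'm) twocat_scheme" and D :: "('a1, 'b1, 'c1, 'm1) twocat_scheme"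
    and T0 :: "'a \<Rightarrow> 'a1" and T1 :: "'b \<Rightarrow> 'b1" and T2 :: "'c \<Rightarrow> 'c1"
  assumes obj: "x \<in> tObj C \<Longrightarrow> T0 x \<in> tObj D"
    and arr: "tin1 C u x y \<Longrightarrow> tin1 D (T1 u) (T0 x) (T0 y)"
    and cell: "tin2 C s u v \<Longrightarrow> tin2 D (T2 s) (T1 u) (T1 v)"
    and tid: "x \<in> tObj C \<Longrightarrow> T1 (tid C x) = tid D (T0 x)"
    and tcomp: "\<lbrakk>tin1 C u x y; tin1 C v y z\<rbrakk> \<Longrightarrow> T1 (v \<circledcirc>\<^bsub>C\<^esub> u) = T1 v \<circledcirc>\<^bsub>D\<^esub> T1 u"
    and tidc: "u \<in> tArr C \<Longrightarrow> T2 (tidc C u) = tidc D (T1 u)"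
    and tvcomp: "\<lbrakk>tin2 C s u v; tin2 C t v w\<rbrakk> \<Longrightarrow> T2 (t \<boxdot>\<^bsub>C\<^esub> s) = T2 t \<boxdot>\<^bsub>D\<^esub> T2 s"
    and thcomp: "\<lbrakk>tin2 C s u u'; tin2 C t v v'; tcod C u = tdom C v\<rbrakk>
      \<Longrightarrow> T2 (t \<circledast>\<^bsub>C\<^esub> s) = T2 t \<circledast>\<^bsub>D\<^esub> T2 s"

text \<open>
  A quasi-functor of two variables \<open>(P, Q) \<rightarrow> R\<close> with invertible interchanger. The pseudo Gray
  tensor product is the 2-category representing these, so this is precisely a 2-functor
  \<open>P \<otimes> Q \<rightarrow> R\<close>, given by its values on the generating cells of \<open>P \<otimes> Q\<close>: \<open>mij\<close> is the value on a
  pair consisting of an \<open>i\<close>-cell of \<open>P\<close> and a \<open>j\<close>-cell of \<open>Q\<close>, and \<open>m11 v u\<close> is the interchanger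
  \<open>(b'.u) \<circ> (v.a) \<Rrightarrow> (v.a') \<circ> (b.u)\<close>.
\<close>

locale gray_quasifunctor =
  fixes P :: "('a1, 'b1, 'c1) twocat" and Q :: "('a2, 'b2, 'c2) twocat"
    and R :: "('a, 'b, 'c) twocat" (structure)
    and m00 :: "'a1 \<Rightarrow> 'a2 \<Rightarrow> 'a"
    and m10 :: "'b1 \<Rightarrow> 'a2 \<Rightarrow> 'b" and m01 :: "'a1 \<Rightarrow> 'b2 \<Rightarrow> 'b"
    and m20 :: "'c1 \<Rightarrow> 'a2 \<Rightarrow> 'c" and m02 :: "'a1 \<Rightarrow> 'c2 \<Rightarrow> 'c"
    and m11 :: "'b1 \<Rightarrow> 'b2 \<Rightarrow> 'c"
  assumes functor_right: "b \<in> tObj P \<Longrightarrow> two_functor Q R (m00 b) (m01 b) (m02 b)"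
    and functor_left: "a \<in> tObj Q \<Longrightarrow> two_functor P R (\<lambda>b. m00 b a) (\<lambda>v. m10 v a) (\<lambda>t. m20 t a)"
    and interchanger: "\<lbrakk>tin1 P v b b'; tin1 Q u a a'\<rbrakk>
      \<Longrightarrow> tiso2 R (m11 v u) (m01 b' u \<circledcirc> m10 v a) (m10 v a' \<circledcirc> m01 b u)"
    and interchanger_id_left: "\<lbrakk>b \<in> tObj P; tin1 Q u a a'\<rbrakk>
      \<Longrightarrow> m11 (tid P b) u = tidc R (m01 b u)"
    and interchanger_id_right: "\<lbrakk>tin1 P v b b'; a \<in> tObj Q\<rbrakk>
      \<Longrightarrow> m11 v (tid Q a) = tidc R (m10 v a)"
    and interchanger_comp_left: "\<lbrakk>tin1 P v b b'; tin1 P v' b' b''; tin1 Q u a a'\<rbrakk>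
      \<Longrightarrow> m11 (v' \<circledcirc>\<^bsub>P\<^esub> v) u
          = (tidc R (m10 v' a') \<circledast> m11 v u) \<boxdot> (m11 v' u \<circledast> tidc R (m10 v a))"
    and interchanger_comp_right: "\<lbrakk>tin1 P v b b'; tin1 Q u a a'; tin1 Q u' a' a''\<rbrakk>
      \<Longrightarrow> m11 v (u' \<circledcirc>\<^bsub>Q\<^esub> u)
          = (m11 v u' \<circledast> tidc R (m01 b u)) \<boxdot> (tidc R (m01 b' u') \<circledast> m11 v u)"
    and interchanger_natural_left: "\<lbrakk>tin2 P t v v'; tin1 P v b b'; tin1 Q u a a'\<rbrakk>
      \<Longrightarrow> m11 v' u \<boxdot> (tidc R (m01 b' u) \<circledast> m20 t a)
          = (m20 t a' \<circledast> tidc R (m01 b u)) \<boxdot> m11 v u"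
    and interchanger_natural_right: "\<lbrakk>tin1 P v b b'; tin2 Q s u u'; tin1 Q u a a'\<rbrakk>
      \<Longrightarrow> m11 v u' \<boxdot> (m02 b' s \<circledast> tidc R (m10 v a))
          = (tidc R (m10 v a') \<circledast> m02 b s) \<boxdot> m11 v u"


section \<open>Adjoint equivalences in a 2-category\<close>

record ('b, 'c) adjeq =
  ladj :: 'b
  radj :: 'b
  adjunit :: 'c
  adjcounit :: 'c

definition adjoint_equivalence ::
    "('a, 'b, 'c, 'm) twocat_scheme \<Rightarrow> 'a \<Rightarrow> 'a \<Rightarrow> ('b, 'c) adjeq \<Rightarrow> bool" where
  "adjoint_equivalence C x y e \<longleftrightarrow>
     tin1 C (ladj e) x y \<and> tin1 C (radj e) y x
   \<and> tiso2 C (adjunit e) (tid C x) (radj e \<circledcirc>\<^bsub>C\<^esub> ladj e)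
   \<and> tiso2 C (adjcounit e) (ladj e \<circledcirc>\<^bsub>C\<^esub> radj e) (tid C y)
   \<and> (adjcounit e \<circledast>\<^bsub>C\<^esub> tidc C (ladj e)) \<boxdot>\<^bsub>C\<^esub> (tidc C (ladj e) \<circledast>\<^bsub>C\<^esub> adjunit e) = tidc C (ladj e)
   \<and> (tidc C (radj e) \<circledast>\<^bsub>C\<^esub> adjcounit e) \<boxdot>\<^bsub>C\<^esub> (adjunit e \<circledast>\<^bsub>C\<^esub> tidc C (radj e)) = tidc C (radj e)"

definition adjeq_id :: "('a, 'b, 'c, 'm) twocat_scheme \<Rightarrow> 'a \<Rightarrow> ('b, 'c) adjeq" where
  "adjeq_id C x = \<lparr>ladj = tid C x, radj = tid C x,
     adjunit = tidc C (tid C x), adjcounit = tidc C (tid C x)\<rparr>"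

definition adjeq_comp ::
    "('a, 'b, 'c, 'm) twocat_scheme \<Rightarrow> ('b, 'c) adjeq \<Rightarrow> ('b, 'c) adjeq \<Rightarrow> ('b, 'c) adjeq" where
  "adjeq_comp C d e = \<lparr>ladj = ladj d \<circledcirc>\<^bsub>C\<^esub> ladj e, radj = radj e \<circledcirc>\<^bsub>C\<^esub> radj d,
     adjunit = (tidc C (radj e) \<circledast>\<^bsub>C\<^esub> adjunit d \<circledast>\<^bsub>C\<^esub> tidc C (ladj e)) \<boxdot>\<^bsub>C\<^esub> adjunit e,
     adjcounit = adjcounit d \<boxdot>\<^bsub>C\<^esub> (tidc C (ladj d) \<circledast>\<^bsub>C\<^esub> adjcounit e \<circledast>\<^bsub>C\<^esub> tidc C (radj d))\<rparr>"

definition adjeq_image ::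
    "('b \<Rightarrow> 'b1) \<Rightarrow> ('c \<Rightarrow> 'c1) \<Rightarrow> ('b, 'c) adjeq \<Rightarrow> ('b1, 'c1) adjeq" where
  "adjeq_image T1 T2 e = \<lparr>ladj = T1 (ladj e), radj = T1 (radj e),
     adjunit = T2 (adjunit e), adjcounit = T2 (adjcounit e)\<rparr>"


section \<open>Sesquicategories\<close>

text \<open>
  Composition \<open>g \<bullet> f\<close> and the whiskerings \<open>g \<rhd> \<alpha>\<close>, \<open>\<alpha> \<lhd> f\<close> are along objects, in the usual
  (right to left) order; \<open>\<beta> \<odot> \<alpha>\<close> is composition along 1-cells.
\<close>

record ('o, 'a, 'b) sesqui =
  Ob :: "'o set"
  Mor :: "'a set"
  Cell2 :: "'b set"
  src0 :: "'a \<Rightarrow> 'o"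
  tgt0 :: "'a \<Rightarrow> 'o"
  src1 :: "'b \<Rightarrow> 'a"
  tgt1 :: "'b \<Rightarrow> 'a"
  id1 :: "'o \<Rightarrow> 'a"
  id2 :: "'a \<Rightarrow> 'b"
  comp1 :: "'a \<Rightarrow> 'a \<Rightarrow> 'a" (infixl \<open>\<bullet>\<index>\<close> 80)
  whl2 :: "'a \<Rightarrow> 'b \<Rightarrow> 'b" (infixr \<open>\<rhd>\<index>\<close> 75)
  whr2 :: "'b \<Rightarrow> 'a \<Rightarrow> 'b" (infixl \<open>\<lhd>\<index>\<close> 75)
  vcomp2 :: "'b \<Rightarrow> 'b \<Rightarrow> 'b" (infixl \<open>\<odot>\<index>\<close> 70)

definition in1 :: "('o, 'a, 'b, 'm) sesqui_scheme \<Rightarrow> 'a \<Rightarrow> 'o \<Rightarrow> 'o \<Rightarrow> bool"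
    (\<open>\<guillemotleft>_ : _ \<rightarrow>\<index> _\<guillemotright>\<close>) where
  "\<guillemotleft>f : X \<rightarrow>\<^bsub>S\<^esub> Y\<guillemotright> \<longleftrightarrow> f \<in> Mor S \<and> src0 S f = X \<and> tgt0 S f = Y"

definition in2 :: "('o, 'a, 'b, 'm) sesqui_scheme \<Rightarrow> 'b \<Rightarrow> 'a \<Rightarrow> 'a \<Rightarrow> bool"
    (\<open>\<guillemotleft>_ : _ \<Rightarrow>\<index> _\<guillemotright>\<close>) where
  "\<guillemotleft>\<alpha> : f \<Rightarrow>\<^bsub>S\<^esub> g\<guillemotright> \<longleftrightarrow> \<alpha> \<in> Cell2 S \<and> src1 S \<alpha> = f \<and> tgt1 S \<alpha> = g"

locale sesquicategory =
  fixes S :: "('o, 'a, 'b, 'm) sesqui_scheme" (structure)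
  assumes mor_ends: "f \<in> Mor S \<Longrightarrow> src0 S f \<in> Ob S \<and> tgt0 S f \<in> Ob S"
    and cell2_ends: "\<alpha> \<in> Cell2 S \<Longrightarrow> src1 S \<alpha> \<in> Mor S \<and> tgt1 S \<alpha> \<in> Mor S
      \<and> src0 S (src1 S \<alpha>) = src0 S (tgt1 S \<alpha>) \<and> tgt0 S (src1 S \<alpha>) = tgt0 S (tgt1 S \<alpha>)"
    and id1_in: "X \<in> Ob S \<Longrightarrow> \<guillemotleft>id1 S X : X \<rightarrow> X\<guillemotright>"
    and comp1_in: "\<lbrakk>\<guillemotleft>f : X \<rightarrow> Y\<guillemotright>; \<guillemotleft>g : Y \<rightarrow> Z\<guillemotright>\<rbrakk> \<Longrightarrow> \<guillemotleft>g \<bullet> f : X \<rightarrow> Z\<guillemotright>"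
    and comp1_id_left: "\<guillemotleft>f : X \<rightarrow> Y\<guillemotright> \<Longrightarrow> id1 S Y \<bullet> f = f"
    and comp1_id_right: "\<guillemotleft>f : X \<rightarrow> Y\<guillemotright> \<Longrightarrow> f \<bullet> id1 S X = f"
    and comp1_assoc: "\<lbrakk>\<guillemotleft>f : W \<rightarrow> X\<guillemotright>; \<guillemotleft>g : X \<rightarrow> Y\<guillemotright>; \<guillemotleft>h : Y \<rightarrow> Z\<guillemotright>\<rbrakk>
      \<Longrightarrow> (h \<bullet> g) \<bullet> f = h \<bullet> (g \<bullet> f)"
    and id2_in: "f \<in> Mor S \<Longrightarrow> \<guillemotleft>id2 S f : f \<Rightarrow> f\<guillemotright>"
    and vcomp2_in: "\<lbrakk>\<guillemotleft>\<alpha> : f \<Rightarrow> g\<guillemotright>; \<guillemotleft>\<beta> : g \<Rightarrow> h\<guillemotright>\<rbrakk> \<Longrightarrow> \<guillemotleft>\<beta> \<odot> \<alpha> : f \<Rightarrow> h\<guillemotright>"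
    and vcomp2_id_left: "\<guillemotleft>\<alpha> : f \<Rightarrow> g\<guillemotright> \<Longrightarrow> id2 S g \<odot> \<alpha> = \<alpha>"
    and vcomp2_id_right: "\<guillemotleft>\<alpha> : f \<Rightarrow> g\<guillemotright> \<Longrightarrow> \<alpha> \<odot> id2 S f = \<alpha>"
    and vcomp2_assoc: "\<lbrakk>\<guillemotleft>\<alpha> : f \<Rightarrow> g\<guillemotright>; \<guillemotleft>\<beta> : g \<Rightarrow> h\<guillemotright>; \<guillemotleft>\<gamma> : h \<Rightarrow> k\<guillemotright>\<rbrakk>
      \<Longrightarrow> (\<gamma> \<odot> \<beta>) \<odot> \<alpha> = \<gamma> \<odot> (\<beta> \<odot> \<alpha>)"
    and whl2_in: "\<lbrakk>\<guillemotleft>\<alpha> : f \<Rightarrow> f'\<guillemotright>; \<guillemotleft>f : X \<rightarrow> Y\<guillemotright>; \<guillemotleft>g : Y \<rightarrow> Z\<guillemotright>\<rbrakk>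
      \<Longrightarrow> \<guillemotleft>g \<rhd> \<alpha> : g \<bullet> f \<Rightarrow> g \<bullet> f'\<guillemotright>"
    and whr2_in: "\<lbrakk>\<guillemotleft>f : X \<rightarrow> Y\<guillemotright>; \<guillemotleft>\<beta> : g \<Rightarrow> g'\<guillemotright>; \<guillemotleft>g : Y \<rightarrow> Z\<guillemotright>\<rbrakk>
      \<Longrightarrow> \<guillemotleft>\<beta> \<lhd> f : g \<bullet> f \<Rightarrow> g' \<bullet> f\<guillemotright>"
    and whl2_id2: "\<lbrakk>\<guillemotleft>f : X \<rightarrow> Y\<guillemotright>; \<guillemotleft>g : Y \<rightarrow> Z\<guillemotright>\<rbrakk> \<Longrightarrow> g \<rhd> id2 S f = id2 S (g \<bullet> f)"
    and whr2_id2: "\<lbrakk>\<guillemotleft>f : X \<rightarrow> Y\<guillemotright>; \<guillemotleft>g : Y \<rightarrow> Z\<guillemotright>\<rbrakk> \<Longrightarrow> id2 S g \<lhd> f = id2 S (g \<bullet> f)"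
    and whl2_vcomp2: "\<lbrakk>\<guillemotleft>\<alpha> : f \<Rightarrow> f'\<guillemotright>; \<guillemotleft>\<alpha>' : f' \<Rightarrow> f''\<guillemotright>; \<guillemotleft>f : X \<rightarrow> Y\<guillemotright>; \<guillemotleft>g : Y \<rightarrow> Z\<guillemotright>\<rbrakk>
      \<Longrightarrow> g \<rhd> (\<alpha>' \<odot> \<alpha>) = (g \<rhd> \<alpha>') \<odot> (g \<rhd> \<alpha>)"
    and whr2_vcomp2: "\<lbrakk>\<guillemotleft>\<beta> : g \<Rightarrow> g'\<guillemotright>; \<guillemotleft>\<beta>' : g' \<Rightarrow> g''\<guillemotright>; \<guillemotleft>f : X \<rightarrow> Y\<guillemotright>; \<guillemotleft>g : Y \<rightarrow> Z\<guillemotright>\<rbrakk>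
      \<Longrightarrow> (\<beta>' \<odot> \<beta>) \<lhd> f = (\<beta>' \<lhd> f) \<odot> (\<beta> \<lhd> f)"
    and whl2_id1: "\<lbrakk>\<guillemotleft>\<alpha> : f \<Rightarrow> f'\<guillemotright>; \<guillemotleft>f : X \<rightarrow> Y\<guillemotright>\<rbrakk> \<Longrightarrow> id1 S Y \<rhd> \<alpha> = \<alpha>"
    and whr2_id1: "\<lbrakk>\<guillemotleft>\<alpha> : f \<Rightarrow> f'\<guillemotright>; \<guillemotleft>f : X \<rightarrow> Y\<guillemotright>\<rbrakk> \<Longrightarrow> \<alpha> \<lhd> id1 S X = \<alpha>"
    and whl2_comp1: "\<lbrakk>\<guillemotleft>\<alpha> : f \<Rightarrow> f'\<guillemotright>; \<guillemotleft>f : W \<rightarrow> X\<guillemotright>; \<guillemotleft>g : X \<rightarrow> Y\<guillemotright>; \<guillemotleft>h : Y \<rightarrow> Z\<guillemotright>\<rbrakk>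
      \<Longrightarrow> (h \<bullet> g) \<rhd> \<alpha> = h \<rhd> (g \<rhd> \<alpha>)"
    and whl2_whr2: "\<lbrakk>\<guillemotleft>f : W \<rightarrow> X\<guillemotright>; \<guillemotleft>\<beta> : g \<Rightarrow> g'\<guillemotright>; \<guillemotleft>g : X \<rightarrow> Y\<guillemotright>; \<guillemotleft>h : Y \<rightarrow> Z\<guillemotright>\<rbrakk>
      \<Longrightarrow> (h \<rhd> \<beta>) \<lhd> f = h \<rhd> (\<beta> \<lhd> f)"
    and whr2_comp1: "\<lbrakk>\<guillemotleft>f : W \<rightarrow> X\<guillemotright>; \<guillemotleft>g : X \<rightarrow> Y\<guillemotright>; \<guillemotleft>\<gamma> : h \<Rightarrow> h'\<guillemotright>; \<guillemotleft>h : Y \<rightarrow> Z\<guillemotright>\<rbrakk>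
      \<Longrightarrow> (\<gamma> \<lhd> g) \<lhd> f = \<gamma> \<lhd> (g \<bullet> f)"

record ('o, 'a, 'b, 'o1, 'a1, 'b1) smap =
  on0 :: "'o \<Rightarrow> 'o1"
  on1 :: "'a \<Rightarrow> 'a1"
  on2 :: "'b \<Rightarrow> 'b1"

locale sesquifunctor =
  fixes S :: "('o, 'a, 'b, 'm) sesqui_scheme" and T :: "('o1, 'a1, 'b1, 'm1) sesqui_scheme"
    and H :: "('o, 'a, 'b, 'o1, 'a1, 'b1, 'n) smap_scheme"
  assumes on0_in: "X \<in> Ob S \<Longrightarrow> on0 H X \<in> Ob T"
    and on1_in: "\<guillemotleft>f : X \<rightarrow>\<^bsub>S\<^esub> Y\<guillemotright> \<Longrightarrow> \<guillemotleft>on1 H f : on0 H X \<rightarrow>\<^bsub>T\<^esub> on0 H Y\<guillemotright>"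
    and on2_in: "\<guillemotleft>\<alpha> : f \<Rightarrow>\<^bsub>S\<^esub> g\<guillemotright> \<Longrightarrow> \<guillemotleft>on2 H \<alpha> : on1 H f \<Rightarrow>\<^bsub>T\<^esub> on1 H g\<guillemotright>"
    and on1_id1: "X \<in> Ob S \<Longrightarrow> on1 H (id1 S X) = id1 T (on0 H X)"
    and on1_comp1: "\<lbrakk>\<guillemotleft>f : X \<rightarrow>\<^bsub>S\<^esub> Y\<guillemotright>; \<guillemotleft>g : Y \<rightarrow>\<^bsub>S\<^esub> Z\<guillemotright>\<rbrakk>
      \<Longrightarrow> on1 H (g \<bullet>\<^bsub>S\<^esub> f) = on1 H g \<bullet>\<^bsub>T\<^esub> on1 H f"
    and on2_id2: "f \<in> Mor S \<Longrightarrow> on2 H (id2 S f) = id2 T (on1 H f)"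
    and on2_vcomp2: "\<lbrakk>\<guillemotleft>\<alpha> : f \<Rightarrow>\<^bsub>S\<^esub> g\<guillemotright>; \<guillemotleft>\<beta> : g \<Rightarrow>\<^bsub>S\<^esub> h\<guillemotright>\<rbrakk>
      \<Longrightarrow> on2 H (\<beta> \<odot>\<^bsub>S\<^esub> \<alpha>) = on2 H \<beta> \<odot>\<^bsub>T\<^esub> on2 H \<alpha>"
    and on2_whl2: "\<lbrakk>\<guillemotleft>\<alpha> : f \<Rightarrow>\<^bsub>S\<^esub> f'\<guillemotright>; \<guillemotleft>f : X \<rightarrow>\<^bsub>S\<^esub> Y\<guillemotright>; \<guillemotleft>g : Y \<rightarrow>\<^bsub>S\<^esub> Z\<guillemotright>\<rbrakk>
      \<Longrightarrow> on2 H (g \<rhd>\<^bsub>S\<^esub> \<alpha>) = on1 H g \<rhd>\<^bsub>T\<^esub> on2 H \<alpha>"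
    and on2_whr2: "\<lbrakk>\<guillemotleft>f : X \<rightarrow>\<^bsub>S\<^esub> Y\<guillemotright>; \<guillemotleft>\<beta> : g \<Rightarrow>\<^bsub>S\<^esub> g'\<guillemotright>; \<guillemotleft>g : Y \<rightarrow>\<^bsub>S\<^esub> Z\<guillemotright>\<rbrakk>
      \<Longrightarrow> on2 H (\<beta> \<lhd>\<^bsub>S\<^esub> f) = on2 H \<beta> \<lhd>\<^bsub>T\<^esub> on1 H f"

locale sesqui_iso = sesquifunctor S T H
  for S :: "('o, 'a, 'b, 'm) sesqui_scheme" and T :: "('o1, 'a1, 'b1, 'm1) sesqui_scheme"
    and H :: "('o, 'a, 'b, 'o1, 'a1, 'b1, 'n) smap_scheme" +
  assumes bij0: "bij_betw (on0 H) (Ob S) (Ob T)"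
    and bij1: "bij_betw (on1 H) (Mor S) (Mor T)"
    and bij2: "bij_betw (on2 H) (Cell2 S) (Cell2 T)"


section \<open>2-computads and free sesquicategories\<close>

text \<open>A path lists its edges starting with the one applied first.\<close>

datatype ('v, 'e) path = Path (psrc: 'v) (pedges: "'e list") (ptgt: 'v)

definition path_comp :: "('v, 'e) path \<Rightarrow> ('v, 'e) path \<Rightarrow> ('v, 'e) path" where
  "path_comp q p = Path (psrc p) (pedges p @ pedges q) (ptgt q)"

record ('v, 'e, 'g) computad =
  vertices :: "'v set"
  edges :: "'e set"
  esrc :: "'e \<Rightarrow> 'v"
  etgt :: "'e \<Rightarrow> 'v"
  generators :: "'g set"
  gsrc :: "'g \<Rightarrow> ('v, 'e) path"
  gtgt :: "'g \<Rightarrow> ('v, 'e) path"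

fun walk :: "('v, 'e, 'g) computad \<Rightarrow> 'v \<Rightarrow> 'e list \<Rightarrow> 'v \<Rightarrow> bool" where
  "walk K x [] y \<longleftrightarrow> x \<in> vertices K \<and> x = y"
| "walk K x (e # es) y \<longleftrightarrow> e \<in> edges K \<and> esrc K e = x \<and> walk K (etgt K e) es y"

definition paths :: "('v, 'e, 'g) computad \<Rightarrow> ('v, 'e) path set" where
  "paths K = {p. walk K (psrc p) (pedges p) (ptgt p)}"

locale two_computad =
  fixes K :: "('v, 'e, 'g) computad"
  assumes edge_ends: "e \<in> edges K \<Longrightarrow> esrc K e \<in> vertices K \<and> etgt K e \<in> vertices K"
    and generator_ends: "c \<in> generators K \<Longrightarrow> gsrc K c \<in> paths K \<and> gtgt K c \<in> paths K
      \<and> psrc (gsrc K c) = psrc (gtgt K c) \<and> ptgt (gsrc K c) = ptgt (gtgt K c)"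

text \<open>
  In a sesquicategory there is no interchange law, so the 2-cells of the free one are sequences
  of whiskered generators: \<open>Step u c v\<close> stands for \<open>v \<rhd> c \<lhd> u\<close>, and a 2-cell lists its steps
  starting with the one applied first.
\<close>

datatype ('v, 'e, 'g) step = Step (pre: "('v, 'e) path") (gen: 'g) (post: "('v, 'e) path")

datatype ('v, 'e, 'g) fcell =
  FCell (fsrc: "('v, 'e) path") (fsteps: "('v, 'e, 'g) step list") (ftgt: "('v, 'e) path")

definition step_src :: "('v, 'e, 'g) computad \<Rightarrow> ('v, 'e, 'g) step \<Rightarrow> ('v, 'e) path" where
  "step_src K w = path_comp (post w) (path_comp (gsrc K (gen w)) (pre w))"

definition step_tgt :: "('v, 'e, 'g) computad \<Rightarrow> ('v, 'e, 'g) step \<Rightarrow> ('v, 'e) path" where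
  "step_tgt K w = path_comp (post w) (path_comp (gtgt K (gen w)) (pre w))"

definition steps :: "('v, 'e, 'g) computad \<Rightarrow> ('v, 'e, 'g) step set" where
  "steps K = {w. pre w \<in> paths K \<and> gen w \<in> generators K \<and> post w \<in> paths K
     \<and> ptgt (pre w) = psrc (gsrc K (gen w)) \<and> ptgt (gsrc K (gen w)) = psrc (post w)}"

fun step_walk ::
    "('v, 'e, 'g) computad \<Rightarrow> ('v, 'e) path \<Rightarrow> ('v, 'e, 'g) step list \<Rightarrow> ('v, 'e) path \<Rightarrow> bool" where
  "step_walk K p [] q \<longleftrightarrow> p \<in> paths K \<and> p = q"
| "step_walk K p (w # ws) q \<longleftrightarrow> w \<in> steps K \<and> step_src K w = p \<and> step_walk K (step_tgt K w) ws q"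

definition fcells :: "('v, 'e, 'g) computad \<Rightarrow> ('v, 'e, 'g) fcell set" where
  "fcells K = {c. step_walk K (fsrc c) (fsteps c) (ftgt c)}"

definition free_sesqui ::
    "('v, 'e, 'g) computad \<Rightarrow> ('v, ('v, 'e) path, ('v, 'e, 'g) fcell) sesqui" where
  "free_sesqui K = \<lparr>
     Ob = vertices K, Mor = paths K, Cell2 = fcells K,
     src0 = psrc, tgt0 = ptgt, src1 = fsrc, tgt1 = ftgt,
     id1 = (\<lambda>x. Path x [] x), id2 = (\<lambda>p. FCell p [] p),
     comp1 = path_comp,
     whl2 = (\<lambda>q c. FCell (path_comp q (fsrc c))
               (map (\<lambda>w. Step (pre w) (gen w) (path_comp q (post w))) (fsteps c))
               (path_comp q (ftgt c))),
     whr2 = (\<lambda>c p. FCell (path_comp (fsrc c) p)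
               (map (\<lambda>w. Step (path_comp (pre w) p) (gen w) (post w)) (fsteps c))
               (path_comp (ftgt c) p)),
     vcomp2 = (\<lambda>d c. FCell (fsrc c) (fsteps c @ fsteps d) (ftgt d))\<rparr>"

definition edge_path :: "('v, 'e, 'g) computad \<Rightarrow> 'e \<Rightarrow> ('v, 'e) path" where
  "edge_path K e = Path (esrc K e) [e] (etgt K e)"

definition generator_cell :: "('v, 'e, 'g) computad \<Rightarrow> 'g \<Rightarrow> ('v, 'e, 'g) fcell" where
  "generator_cell K c = FCell (gsrc K c)
     [Step (Path (psrc (gsrc K c)) [] (psrc (gsrc K c))) c
           (Path (ptgt (gsrc K c)) [] (ptgt (gsrc K c)))] (gtgt K c)"

context two_computad
begin

lemma walk_ends: "walk K x es y \<Longrightarrow> x \<in> vertices K \<and> y \<in> vertices K"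
  by (induction es arbitrary: x) (auto simp: edge_ends)

lemma walk_append: "walk K x es y \<Longrightarrow> walk K y fs z \<Longrightarrow> walk K x (es @ fs) z"
  by (induction es arbitrary: x) auto

lemma path_ends: "p \<in> paths K \<Longrightarrow> psrc p \<in> vertices K \<and> ptgt p \<in> vertices K"
  using walk_ends by (auto simp: paths_def)

lemma path_id: "x \<in> vertices K \<Longrightarrow> Path x [] x \<in> paths K"
  by (simp add: paths_def)

lemma path_comp_in: "p \<in> paths K \<Longrightarrow> q \<in> paths K \<Longrightarrow> ptgt p = psrc q \<Longrightarrow> path_comp q p \<in> paths K"
  using walk_append by (auto simp: paths_def path_comp_def)

lemma path_comp_ends [simp]: "psrc (path_comp q p) = psrc p" "ptgt (path_comp q p) = ptgt q"
  by (auto simp: path_comp_def)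

lemma path_comp_assoc [simp]: "path_comp (path_comp r q) p = path_comp r (path_comp q p)"
  by (auto simp: path_comp_def)

lemma step_ends: "w \<in> steps K \<Longrightarrow> step_src K w \<in> paths K \<and> step_tgt K w \<in> paths K
   \<and> psrc (step_src K w) = psrc (step_tgt K w) \<and> ptgt (step_src K w) = ptgt (step_tgt K w)"
  using generator_ends[of "gen w"]
  by (auto simp: steps_def step_src_def step_tgt_def intro!: path_comp_in)

lemma step_walk_ends: "step_walk K p ws q \<Longrightarrow> p \<in> paths K \<and> q \<in> paths K
   \<and> psrc p = psrc q \<and> ptgt p = ptgt q"
  by (induction ws arbitrary: p) (auto simp: step_ends)

lemma step_walk_append: "step_walk K p ws q \<Longrightarrow> step_walk K q ws' r \<Longrightarrow> step_walk K p (ws @ ws') r"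
  by (induction ws arbitrary: p) auto

lemma step_walk_whl: "step_walk K p ws p' \<Longrightarrow> q \<in> paths K \<Longrightarrow> ptgt p = psrc q \<Longrightarrow>
  step_walk K (path_comp q p) (map (\<lambda>w. Step (pre w) (gen w) (path_comp q (post w))) ws) (path_comp q p')"
proof (induction ws arbitrary: p)
  case Nil then show ?case by (auto intro: path_comp_in)
next
  case (Cons w ws)
  then have w: "w \<in> steps K" "step_src K w = p" "step_walk K (step_tgt K w) ws p'" by auto
  let ?w = "Step (pre w) (gen w) (path_comp q (post w))"
  have "step_src K ?w = path_comp q p" "step_tgt K ?w = path_comp q (step_tgt K w)"
    using w by (auto simp: step_src_def step_tgt_def)
  moreover have "?w \<in> steps K" using w Cons.prems(2,3)
    by (auto simp: steps_def step_src_def intro!: path_comp_in)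
  moreover have "ptgt (step_tgt K w) = psrc q" using step_ends[OF w(1)] w(2) Cons.prems(3) by simp
  ultimately show ?case using Cons.IH[OF w(3) Cons.prems(2)] by simp
qed

lemma step_walk_whr: "step_walk K q ws q' \<Longrightarrow> p \<in> paths K \<Longrightarrow> ptgt p = psrc q \<Longrightarrow>
  step_walk K (path_comp q p) (map (\<lambda>w. Step (path_comp (pre w) p) (gen w) (post w)) ws) (path_comp q' p)"
proof (induction ws arbitrary: q)
  case Nil then show ?case by (auto intro: path_comp_in)
next
  case (Cons w ws)
  then have w: "w \<in> steps K" "step_src K w = q" "step_walk K (step_tgt K w) ws q'" by auto
  let ?w = "Step (path_comp (pre w) p) (gen w) (post w)"
  have "step_src K ?w = path_comp q p" "step_tgt K ?w = path_comp (step_tgt K w) p"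
    using w by (auto simp: step_src_def step_tgt_def)
  moreover have "?w \<in> steps K" using w Cons.prems(2,3)
    by (auto simp: steps_def step_src_def intro!: path_comp_in)
  moreover have "ptgt p = psrc (step_tgt K w)" using step_ends[OF w(1)] w(2) Cons.prems(3) by simp
  ultimately show ?case using Cons.IH[OF w(3) Cons.prems(2)] by simp
qed

lemma whl_id_steps: "step_walk K p ws q \<Longrightarrow> ptgt p = y \<Longrightarrow>
  map (\<lambda>w. Step (pre w) (gen w) (path_comp (Path y [] y) (post w))) ws = ws"
proof (induction ws arbitrary: p)
  case (Cons w ws)
  then have w: "w \<in> steps K" "step_src K w = p" "step_walk K (step_tgt K w) ws q" by auto
  have "ptgt (step_tgt K w) = y" using step_ends[OF w(1)] w(2) Cons.prems(2) by simp
  moreover have "ptgt (post w) = y" using w(2) Cons.prems(2) by (auto simp: step_src_def)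
  ultimately show ?case using Cons.IH[OF w(3)]
    by (cases w) (auto simp: path_comp_def path.expand)
qed simp

lemma whr_id_steps: "step_walk K p ws q \<Longrightarrow> psrc p = x \<Longrightarrow>
  map (\<lambda>w. Step (path_comp (pre w) (Path x [] x)) (gen w) (post w)) ws = ws"
proof (induction ws arbitrary: p)
  case (Cons w ws)
  then have w: "w \<in> steps K" "step_src K w = p" "step_walk K (step_tgt K w) ws q" by auto
  have "psrc (step_tgt K w) = x" using step_ends[OF w(1)] w(2) Cons.prems(2) by simp
  moreover have "psrc (pre w) = x" using w(2) Cons.prems(2) by (auto simp: step_src_def)
  ultimately show ?case using Cons.IH[OF w(3)]
    by (cases w) (auto simp: path_comp_def path.expand)
qed simp

lemma path_unit_left: "ptgt p = y \<Longrightarrow> path_comp (Path y [] y) p = p"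
  by (auto simp: path_comp_def)

lemma path_unit_right: "psrc p = x \<Longrightarrow> path_comp p (Path x [] x) = p"
  by (auto simp: path_comp_def)

lemma path_comp_Nil: "path_comp (Path y [] z) p = Path (psrc p) (pedges p) z"
  by (auto simp: path_comp_def)

lemmas free_simps = free_sesqui_def in1_def in2_def

lemma sesquicategory_free_sesqui: "sesquicategory (free_sesqui K)"
proof
  fix f assume "f \<in> Mor (free_sesqui K)"
  then show "src0 (free_sesqui K) f \<in> Ob (free_sesqui K) \<and> tgt0 (free_sesqui K) f \<in> Ob (free_sesqui K)"
    using path_ends by (simp add: free_simps)
qed (auto simp: free_simps fcells_def path_id path_comp_in path_unit_left path_unit_right
  whl_id_steps whr_id_steps comp_def path.expand fcell.expand step.expand dest: step_walk_ends
  intro: step_walk_append step_walk_whl step_walk_whr)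

end

context
  fixes K :: "('v, 'e, 'g) computad" and S :: "('o, 'a, 'b, 'm) sesqui_scheme"
    and m0 :: "'v \<Rightarrow> 'o" and m1 :: "'e \<Rightarrow> 'a" and m2 :: "'g \<Rightarrow> 'b"
begin

fun eval_walk :: "'v \<Rightarrow> 'e list \<Rightarrow> 'a" where
  "eval_walk x [] = id1 S (m0 x)"
| "eval_walk x (e # es) = eval_walk (etgt K e) es \<bullet>\<^bsub>S\<^esub> m1 e"

definition eval_path :: "('v, 'e) path \<Rightarrow> 'a" where
  "eval_path p = eval_walk (psrc p) (pedges p)"

definition eval_step :: "('v, 'e, 'g) step \<Rightarrow> 'b" where
  "eval_step w = eval_path (post w) \<rhd>\<^bsub>S\<^esub> (m2 (gen w) \<lhd>\<^bsub>S\<^esub> eval_path (pre w))"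

fun eval_steps :: "('v, 'e) path \<Rightarrow> ('v, 'e, 'g) step list \<Rightarrow> 'b" where
  "eval_steps p [] = id2 S (eval_path p)"
| "eval_steps p (w # ws) = eval_steps (step_tgt K w) ws \<odot>\<^bsub>S\<^esub> eval_step w"

end

text \<open>The universal property of the free sesquicategory.\<close>

lemma (in two_computad) free_sesqui_universal:
  assumes "sesquicategory S"
    and m0: "\<And>x. x \<in> vertices K \<Longrightarrow> m0 x \<in> Ob S"
    and m1: "\<And>e. e \<in> edges K \<Longrightarrow> \<guillemotleft>m1 e : m0 (esrc K e) \<rightarrow>\<^bsub>S\<^esub> m0 (etgt K e)\<guillemotright>"
    and m2: "\<And>c. c \<in> generators K \<Longrightarrow>
      \<guillemotleft>m2 c : eval_path K S m0 m1 (gsrc K c) \<Rightarrow>\<^bsub>S\<^esub> eval_path K S m0 m1 (gtgt K c)\<guillemotright>"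
  shows "sesquifunctor (free_sesqui K) S \<lparr>on0 = m0, on1 = eval_path K S m0 m1,
     on2 = (\<lambda>c. eval_steps K S m0 m1 m2 (fsrc c) (fsteps c))\<rparr>"  (is "sesquifunctor _ _ ?H")
    and "e \<in> edges K \<Longrightarrow> eval_path K S m0 m1 (edge_path K e) = m1 e"
    and "c \<in> generators K \<Longrightarrow> eval_steps K S m0 m1 m2 (gsrc K c) (fsteps (generator_cell K c)) = m2 c"
    and "sesquifunctor (free_sesqui K) S H \<Longrightarrow>
      (\<And>x. x \<in> vertices K \<Longrightarrow> on0 H x = m0 x) \<Longrightarrow>
      (\<And>e. e \<in> edges K \<Longrightarrow> on1 H (edge_path K e) = m1 e) \<Longrightarrow>
      (\<And>c. c \<in> generators K \<Longrightarrow> on2 H (generator_cell K c) = m2 c) \<Longrightarrow>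
      (\<forall>p \<in> paths K. on1 H p = eval_path K S m0 m1 p) \<and>
      (\<forall>c \<in> fcells K. on2 H c = eval_steps K S m0 m1 m2 (fsrc c) (fsteps c))"
proof -
  interpret S: sesquicategory S by fact
  let ?w = "eval_walk K S m0 m1" and ?p = "eval_path K S m0 m1"
    and ?s = "eval_step K S m0 m1 m2" and ?c = "eval_steps K S m0 m1 m2"
  have w_in: "walk K x es y \<Longrightarrow> \<guillemotleft>?w x es : m0 x \<rightarrow>\<^bsub>S\<^esub> m0 y\<guillemotright>" for x es y
  proof (induction es arbitrary: x)
    case Nil then show ?case using S.id1_in m0 by auto
  next
    case (Cons e es) then show ?case using S.comp1_in[OF m1] by fastforce
  qed
  have w_app: "walk K x es y \<Longrightarrow> walk K y fs z \<Longrightarrow> ?w x (es @ fs) = ?w y fs \<bullet>\<^bsub>S\<^esub> ?w x es" for x es y fs z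
  proof (induction es arbitrary: x)
    case Nil then show ?case using S.comp1_id_right[OF w_in] by auto
  next
    case (Cons e es)
    then have "walk K (etgt K e) es y" "e \<in> edges K" "esrc K e = x" by auto
    then show ?case using Cons.IH Cons.prems(2) S.comp1_assoc[OF m1 w_in w_in] by simp
  qed
  have p_in: "p \<in> paths K \<Longrightarrow> \<guillemotleft>?p p : m0 (psrc p) \<rightarrow>\<^bsub>S\<^esub> m0 (ptgt p)\<guillemotright>" for p
    using w_in by (simp add: paths_def eval_path_def)
  have p_comp: "p \<in> paths K \<Longrightarrow> q \<in> paths K \<Longrightarrow> ptgt p = psrc q \<Longrightarrow>
      ?p (path_comp q p) = ?p q \<bullet>\<^bsub>S\<^esub> ?p p" for p q
    using w_app by (simp add: paths_def eval_path_def path_comp_def)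
  have s_parts: "pre w \<in> paths K" "post w \<in> paths K" "gsrc K (gen w) \<in> paths K" "gtgt K (gen w) \<in> paths K"
      "ptgt (pre w) = psrc (gsrc K (gen w))" "ptgt (gsrc K (gen w)) = psrc (post w)"
      "ptgt (pre w) = psrc (gtgt K (gen w))" "ptgt (gtgt K (gen w)) = psrc (post w)"
      "\<guillemotleft>m2 (gen w) : ?p (gsrc K (gen w)) \<Rightarrow>\<^bsub>S\<^esub> ?p (gtgt K (gen w))\<guillemotright>"
    if "w \<in> steps K" for w
    using that generator_ends m2 by (auto simp: steps_def)
  have mid: "\<guillemotleft>m2 (gen w) \<lhd>\<^bsub>S\<^esub> ?p (pre w) : ?p (gsrc K (gen w)) \<bullet>\<^bsub>S\<^esub> ?p (pre w) \<Rightarrow>\<^bsub>S\<^esub> ?p (gtgt K (gen w)) \<bullet>\<^bsub>S\<^esub> ?p (pre w)\<guillemotright>"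
    if "w \<in> steps K" for w
    using S.whr2_in p_in s_parts[OF that] by metis
  have s_in: "\<guillemotleft>?s w : ?p (step_src K w) \<Rightarrow>\<^bsub>S\<^esub> ?p (step_tgt K w)\<guillemotright>" if "w \<in> steps K" for w
  proof -
    note s = s_parts[OF that]
    have "\<guillemotleft>?p (gsrc K (gen w)) \<bullet>\<^bsub>S\<^esub> ?p (pre w) : m0 (psrc (pre w)) \<rightarrow>\<^bsub>S\<^esub> m0 (psrc (post w))\<guillemotright>"
      using S.comp1_in p_in s by metis
    from S.whl2_in[OF mid[OF that] this p_in[OF s(2)]] show ?thesis
      using s p_comp path_comp_in by (simp add: eval_step_def step_src_def step_tgt_def)
  qed
  have c_in: "step_walk K p ws q \<Longrightarrow> \<guillemotleft>?c p ws : ?p p \<Rightarrow>\<^bsub>S\<^esub> ?p q\<guillemotright>" for p ws q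
  proof (induction ws arbitrary: p)
    case Nil then show ?case using S.id2_in p_in by (auto simp: in1_def)
  next
    case (Cons w ws) then show ?case using S.vcomp2_in[OF s_in] by fastforce
  qed
  have c_app: "step_walk K p ws q \<Longrightarrow> step_walk K q ws' r \<Longrightarrow> ?c p (ws @ ws') = ?c q ws' \<odot>\<^bsub>S\<^esub> ?c p ws"
    for p ws q ws' r
  proof (induction ws arbitrary: p)
    case Nil then show ?case using S.vcomp2_id_right[OF c_in] by auto
  next
    case (Cons w ws)
    then have "step_walk K (step_tgt K w) ws q" "w \<in> steps K" by auto
    then show ?case using Cons.IH Cons.prems(2) S.vcomp2_assoc[OF s_in c_in c_in] by simp
  qed
  have c_whl: "step_walk K p ws p' \<Longrightarrow> q \<in> paths K \<Longrightarrow> ptgt p = psrc q \<Longrightarrow>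
     ?c (path_comp q p) (map (\<lambda>w. Step (pre w) (gen w) (path_comp q (post w))) ws) = ?p q \<rhd>\<^bsub>S\<^esub> ?c p ws" for p p' q ws
  proof (induction ws arbitrary: p)
    case Nil
    then have "\<guillemotleft>?p p : m0 (psrc p) \<rightarrow>\<^bsub>S\<^esub> m0 (psrc q)\<guillemotright>" using p_in by fastforce
    from S.whl2_id2[OF this p_in[OF Nil(2)]] show ?case using Nil p_comp by auto
  next
    case (Cons w ws)
    let ?w = "Step (pre w) (gen w) (path_comp q (post w))"
    from Cons.prems have w: "w \<in> steps K" "step_src K w = p" "step_walk K (step_tgt K w) ws p'" by auto
    note s = s_parts[OF w(1)]
    have e: "ptgt (step_tgt K w) = psrc q" "ptgt (post w) = psrc q"
      using step_ends[OF w(1)] w(2) Cons.prems(3) by (auto simp: step_src_def)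
    have "\<guillemotleft>?p (gsrc K (gen w)) \<bullet>\<^bsub>S\<^esub> ?p (pre w) : m0 (psrc (pre w)) \<rightarrow>\<^bsub>S\<^esub> m0 (psrc (post w))\<guillemotright>"
      using S.comp1_in p_in s by metis
    then have 1: "?s ?w = ?p q \<rhd>\<^bsub>S\<^esub> ?s w"
      using S.whl2_comp1[OF mid[OF w(1)] _ p_in[OF s(2)]] p_in[OF Cons.prems(2)] p_comp[OF s(2) Cons.prems(2)] e
      by (simp add: eval_step_def)
    have pp: "\<guillemotleft>?p (step_src K w) : m0 (psrc p) \<rightarrow>\<^bsub>S\<^esub> m0 (psrc q)\<guillemotright>"
      using p_in step_ends[OF w(1)] w(2) Cons.prems(3) by metis
    have t: "step_tgt K ?w = path_comp q (step_tgt K w)" by (simp add: step_tgt_def)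
    show ?case
      using Cons.IH[OF w(3) Cons.prems(2) e(1)] 1 t
        S.whl2_vcomp2[OF s_in[OF w(1)] c_in[OF w(3)] pp p_in[OF Cons.prems(2)]] by simp
  qed
  have c_whr: "step_walk K q ws q' \<Longrightarrow> p \<in> paths K \<Longrightarrow> ptgt p = psrc q \<Longrightarrow>
     ?c (path_comp q p) (map (\<lambda>w. Step (path_comp (pre w) p) (gen w) (post w)) ws) = ?c q ws \<lhd>\<^bsub>S\<^esub> ?p p" for p q' q ws
  proof (induction ws arbitrary: q)
    case Nil
    then have "\<guillemotleft>?p p : m0 (psrc p) \<rightarrow>\<^bsub>S\<^esub> m0 (psrc q)\<guillemotright>" using p_in by fastforce
    from S.whr2_id2[OF this p_in[of q]] show ?case using Nil p_comp by auto
  next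
    case (Cons w ws)
    let ?w = "Step (path_comp (pre w) p) (gen w) (post w)"
    from Cons.prems have w: "w \<in> steps K" "step_src K w = q" "step_walk K (step_tgt K w) ws q'" by auto
    note s = s_parts[OF w(1)]
    have e: "ptgt p = psrc (step_tgt K w)" "ptgt p = psrc (pre w)"
      using step_ends[OF w(1)] w(2) Cons.prems(3) by (auto simp: step_src_def)
    have P: "\<guillemotleft>?p p : m0 (psrc p) \<rightarrow>\<^bsub>S\<^esub> m0 (psrc (pre w))\<guillemotright>" using p_in Cons.prems(2) e by metis
    have PR: "\<guillemotleft>?p (pre w) : m0 (psrc (pre w)) \<rightarrow>\<^bsub>S\<^esub> m0 (psrc (gsrc K (gen w)))\<guillemotright>" using p_in s by metis
    have GS: "\<guillemotleft>?p (gsrc K (gen w)) : m0 (psrc (gsrc K (gen w))) \<rightarrow>\<^bsub>S\<^esub> m0 (psrc (post w))\<guillemotright>" using p_in s by metis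
    have 1: "?s ?w = ?s w \<lhd>\<^bsub>S\<^esub> ?p p"
      using S.whr2_comp1[OF P PR s(9) GS] S.whl2_whr2[OF P mid[OF w(1)] S.comp1_in[OF PR GS] p_in[OF s(2)]]
        p_comp[OF Cons.prems(2) s(1)] e
      by (simp add: eval_step_def)
    have pp: "\<guillemotleft>?p (step_src K w) : m0 (psrc q) \<rightarrow>\<^bsub>S\<^esub> m0 (ptgt q)\<guillemotright>"
      using p_in step_ends[OF w(1)] w(2) by metis
    have P': "\<guillemotleft>?p p : m0 (psrc p) \<rightarrow>\<^bsub>S\<^esub> m0 (psrc q)\<guillemotright>" using p_in Cons.prems(2,3) by metis
    have t: "step_tgt K ?w = path_comp (step_tgt K w) p" by (simp add: step_tgt_def)
    show ?case
      using Cons.IH[OF w(3) Cons.prems(2) e(1)] 1 t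
        S.whr2_vcomp2[OF s_in[OF w(1)] c_in[OF w(3)] P' pp] by simp
  qed
  show "sesquifunctor (free_sesqui K) S ?H"
  proof
    fix f g X Y Z assume "\<guillemotleft>f : X \<rightarrow>\<^bsub>free_sesqui K\<^esub> Y\<guillemotright>" "\<guillemotleft>g : Y \<rightarrow>\<^bsub>free_sesqui K\<^esub> Z\<guillemotright>"
    then show "on1 ?H (g \<bullet>\<^bsub>free_sesqui K\<^esub> f) = on1 ?H g \<bullet>\<^bsub>S\<^esub> on1 ?H f"
      using p_comp by (auto simp: free_sesqui_def in1_def)
  next
    fix X Y f assume "\<guillemotleft>f : X \<rightarrow>\<^bsub>free_sesqui K\<^esub> Y\<guillemotright>"
    then show "\<guillemotleft>on1 ?H f : on0 ?H X \<rightarrow>\<^bsub>S\<^esub> on0 ?H Y\<guillemotright>"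
      using p_in by (auto simp: free_sesqui_def in1_def)
  next
    fix \<alpha> f g assume "\<guillemotleft>\<alpha> : f \<Rightarrow>\<^bsub>free_sesqui K\<^esub> g\<guillemotright>"
    then show "\<guillemotleft>on2 ?H \<alpha> : on1 ?H f \<Rightarrow>\<^bsub>S\<^esub> on1 ?H g\<guillemotright>"
      using c_in by (auto simp: free_sesqui_def in2_def fcells_def)
  next
    fix \<alpha> \<beta> f g h assume "\<guillemotleft>\<alpha> : f \<Rightarrow>\<^bsub>free_sesqui K\<^esub> g\<guillemotright>" "\<guillemotleft>\<beta> : g \<Rightarrow>\<^bsub>free_sesqui K\<^esub> h\<guillemotright>"
    then show "on2 ?H (\<beta> \<odot>\<^bsub>free_sesqui K\<^esub> \<alpha>) = on2 ?H \<beta> \<odot>\<^bsub>S\<^esub> on2 ?H \<alpha>"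
      using c_app by (auto simp: free_sesqui_def in2_def fcells_def)
  next
    fix \<alpha> f f' g X Y Z
    assume "\<guillemotleft>\<alpha> : f \<Rightarrow>\<^bsub>free_sesqui K\<^esub> f'\<guillemotright>" "\<guillemotleft>f : X \<rightarrow>\<^bsub>free_sesqui K\<^esub> Y\<guillemotright>" "\<guillemotleft>g : Y \<rightarrow>\<^bsub>free_sesqui K\<^esub> Z\<guillemotright>"
    then show "on2 ?H (g \<rhd>\<^bsub>free_sesqui K\<^esub> \<alpha>) = on1 ?H g \<rhd>\<^bsub>S\<^esub> on2 ?H \<alpha>"
      using c_whl by (auto simp: free_sesqui_def in1_def in2_def fcells_def)
  next
    fix \<beta> f g' g X Y Z
    assume "\<guillemotleft>f : X \<rightarrow>\<^bsub>free_sesqui K\<^esub> Y\<guillemotright>" "\<guillemotleft>\<beta> : g \<Rightarrow>\<^bsub>free_sesqui K\<^esub> g'\<guillemotright>" "\<guillemotleft>g : Y \<rightarrow>\<^bsub>free_sesqui K\<^esub> Z\<guillemotright>"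
    then show "on2 ?H (\<beta> \<lhd>\<^bsub>free_sesqui K\<^esub> f) = on2 ?H \<beta> \<lhd>\<^bsub>S\<^esub> on1 ?H f"
      using c_whr by (auto simp: free_sesqui_def in1_def in2_def fcells_def)
  qed (auto simp: free_sesqui_def eval_path_def m0)
  show e1: "e \<in> edges K \<Longrightarrow> ?p (edge_path K e) = m1 e" for e
    using S.comp1_id_left[OF m1] by (simp add: eval_path_def edge_path_def)
  show "c \<in> generators K \<Longrightarrow> ?c (gsrc K c) (fsteps (generator_cell K c)) = m2 c"
  proof -
    assume c: "c \<in> generators K"
    then have g: "gsrc K c \<in> paths K" "gtgt K c \<in> paths K" "ptgt (gtgt K c) = ptgt (gsrc K c)"
        "psrc (gtgt K c) = psrc (gsrc K c)"
      using generator_ends by auto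
    have "step_tgt K (Step (Path (psrc (gsrc K c)) [] (psrc (gsrc K c))) c
           (Path (ptgt (gsrc K c)) [] (ptgt (gsrc K c)))) = gtgt K c"
      using g by (simp add: step_tgt_def path_unit_left path_unit_right)
    then show ?thesis
      using S.whr2_id1[OF m2[OF c] p_in[OF g(1)]] S.whl2_id1[OF m2[OF c] p_in[OF g(1)]]
        S.vcomp2_id_left[OF m2[OF c]]
      by (simp add: generator_cell_def eval_step_def eval_path_def)
  qed
  assume "sesquifunctor (free_sesqui K) S H"
    and h0: "\<And>x. x \<in> vertices K \<Longrightarrow> on0 H x = m0 x"
    and h1: "\<And>e. e \<in> edges K \<Longrightarrow> on1 H (edge_path K e) = m1 e"
    and h2: "\<And>c. c \<in> generators K \<Longrightarrow> on2 H (generator_cell K c) = m2 c"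
  then interpret H: sesquifunctor "free_sesqui K" S H by simp
  have w: "walk K x es y \<Longrightarrow> on1 H (Path x es y) = ?w x es" for x es y
  proof (induction es arbitrary: x)
    case Nil then show ?case using H.on1_id1 h0 by (auto simp: free_sesqui_def)
  next
    case (Cons e es)
    then have e: "e \<in> edges K" "esrc K e = x" "walk K (etgt K e) es y" by auto
    have "edge_path K e \<in> paths K" "Path (etgt K e) es y \<in> paths K"
      using e edge_ends by (auto simp: paths_def edge_path_def)
    then have "on1 H (path_comp (Path (etgt K e) es y) (edge_path K e))
        = on1 H (Path (etgt K e) es y) \<bullet>\<^bsub>S\<^esub> on1 H (edge_path K e)"
      using H.on1_comp1 by (auto simp: free_sesqui_def in1_def edge_path_def)
    then show ?case using Cons.IH[OF e(3)] h1[OF e(1)] e by (simp add: path_comp_def edge_path_def)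
  qed
  then have p: "q \<in> paths K \<Longrightarrow> on1 H q = ?p q" for q
    by (cases q) (auto simp: paths_def eval_path_def)
  have one: "on2 H (FCell (step_src K w) [w] (step_tgt K w)) = ?s w" if "w \<in> steps K" for w
  proof -
    note s = s_parts[OF that]
    have c: "gen w \<in> generators K" using that by (simp add: steps_def)
    let ?g = "generator_cell K (gen w)"
    let ?gr = "?g \<lhd>\<^bsub>free_sesqui K\<^esub> pre w"
    interpret FS: sesquicategory "free_sesqui K" by (rule sesquicategory_free_sesqui)
    have gs: "Step (Path (psrc (gsrc K (gen w))) [] (psrc (gsrc K (gen w)))) (gen w)
           (Path (ptgt (gsrc K (gen w))) [] (ptgt (gsrc K (gen w)))) \<in> steps K"
      using s c path_ends by (auto simp: steps_def path_id)
    then have G: "\<guillemotleft>?g : gsrc K (gen w) \<Rightarrow>\<^bsub>free_sesqui K\<^esub> gtgt K (gen w)\<guillemotright>"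
      using s by (auto simp: free_sesqui_def in2_def fcells_def generator_cell_def
          step_src_def step_tgt_def path_unit_left path_unit_right)
    have PR: "\<guillemotleft>pre w : psrc (pre w) \<rightarrow>\<^bsub>free_sesqui K\<^esub> psrc (gsrc K (gen w))\<guillemotright>"
      and GS: "\<guillemotleft>gsrc K (gen w) : psrc (gsrc K (gen w)) \<rightarrow>\<^bsub>free_sesqui K\<^esub> psrc (post w)\<guillemotright>"
      and PO: "\<guillemotleft>post w : psrc (post w) \<rightarrow>\<^bsub>free_sesqui K\<^esub> ptgt (post w)\<guillemotright>"
      using s by (auto simp: free_sesqui_def in1_def)
    have "FCell (step_src K w) [w] (step_tgt K w) = post w \<rhd>\<^bsub>free_sesqui K\<^esub> ?gr"
      using s by (cases w) (auto simp: free_sesqui_def generator_cell_def step_src_def step_tgt_def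
          path_comp_def path.expand)
    also have "on2 H \<dots> = on1 H (post w) \<rhd>\<^bsub>S\<^esub> (on2 H ?g \<lhd>\<^bsub>S\<^esub> on1 H (pre w))"
      using H.on2_whl2[OF FS.whr2_in[OF PR G GS] FS.comp1_in[OF PR GS] PO] H.on2_whr2[OF PR G GS] by simp
    finally show ?thesis using p s h2[OF c] by (simp add: eval_step_def)
  qed
  have "step_walk K q ws r \<Longrightarrow> on2 H (FCell q ws r) = ?c q ws" for q ws r
  proof (induction ws arbitrary: q)
    case Nil then show ?case using H.on2_id2 p by (auto simp: free_sesqui_def)
  next
    case (Cons w ws)
    then have w: "w \<in> steps K" "step_src K w = q" "step_walk K (step_tgt K w) ws r" by auto
    have "FCell q [w] (step_tgt K w) \<in> fcells K" "FCell (step_tgt K w) ws r \<in> fcells K"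
      using w step_ends by (auto simp: fcells_def)
    then have "on2 H (FCell q (w # ws) r) = on2 H (FCell (step_tgt K w) ws r) \<odot>\<^bsub>S\<^esub> on2 H (FCell q [w] (step_tgt K w))"
      using H.on2_vcomp2[of "FCell q [w] (step_tgt K w)" q "step_tgt K w" "FCell (step_tgt K w) ws r" r]
      by (auto simp: free_sesqui_def in2_def)
    then show ?case using Cons.IH[OF w(3)] one[OF w(1)] w(2) by simp
  qed
  then show "(\<forall>p \<in> paths K. on1 H p = ?p p) \<and> (\<forall>c \<in> fcells K. on2 H c = ?c (fsrc c) (fsteps c))"
    using p by (auto simp: fcells_def) (metis fcell.collapse)
qed

text \<open>
  \<open>S\<close> is free on the 2-computad \<open>K\<close>, as exhibited by the isomorphism \<open>H\<close>. The generating cells of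
  \<open>S\<close> are the images of the edges and generators of \<open>K\<close>.
\<close>

locale free_on_computad = two_computad K + sesqui_iso "free_sesqui K" S H
  for S :: "('o, 'a, 'b, 'm) sesqui_scheme" and K :: "('v, 'e, 'g) computad"
    and H :: "('v, ('v, 'e) path, ('v, 'e, 'g) fcell, 'o, 'a, 'b) smap"

definition generating_mors ::
    "('v, 'e, 'g) computad \<Rightarrow> ('v, ('v, 'e) path, ('v, 'e, 'g) fcell, 'o, 'a, 'b) smap \<Rightarrow> 'a set" where
  "generating_mors K H = (\<lambda>e. on1 H (edge_path K e)) ` edges K"

definition generating_cells ::
    "('v, 'e, 'g) computad \<Rightarrow> ('v, ('v, 'e) path, ('v, 'e, 'g) fcell, 'o, 'a, 'b) smap \<Rightarrow> 'b set" where
  "generating_cells K H = (\<lambda>c. on2 H (generator_cell K c)) ` generators K"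


section \<open>Gray-categories\<close>

text \<open>
  The record extends the underlying sesquicategory. \<open>\<Delta> \<cdot> \<Gamma>\<close> and \<open>\<Delta> \<star> \<Gamma>\<close> are vertical and horizontal
  composition in the hom-2-categories, \<open>\<langle>\<phi>\<rangle>\<close> is the identity 3-cell of \<open>\<phi>\<close> (so \<open>\<langle>\<phi>\<rangle> \<star> \<Gamma>\<close> and
  \<open>\<Gamma> \<star> \<langle>\<phi>\<rangle>\<close> are the whiskerings with \<open>\<phi>\<close>), and \<open>interch \<beta> \<alpha>\<close> is the interchanger
  \<open>\<beta>\<^sub>\<alpha> : (g' \<rhd> \<alpha>) \<odot> (\<beta> \<lhd> f) \<Rrightarrow> (\<beta> \<lhd> f') \<odot> (g \<rhd> \<alpha>)\<close>.
\<close>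

record ('o, 'a, 'b, 'c) gray = "('o, 'a, 'b) sesqui" +
  Cell3 :: "'c set"
  src2 :: "'c \<Rightarrow> 'b"
  tgt2 :: "'c \<Rightarrow> 'b"
  id3 :: "'b \<Rightarrow> 'c" (\<open>\<langle>_\<rangle>\<index>\<close>)
  vcomp3 :: "'c \<Rightarrow> 'c \<Rightarrow> 'c" (infixl \<open>\<cdot>\<index>\<close> 65)
  hcomp3 :: "'c \<Rightarrow> 'c \<Rightarrow> 'c" (infixl \<open>\<star>\<index>\<close> 70)
  whl3 :: "'a \<Rightarrow> 'c \<Rightarrow> 'c" (infixr \<open>\<rhd>\<rhd>\<index>\<close> 75)
  whr3 :: "'c \<Rightarrow> 'a \<Rightarrow> 'c" (infixl \<open>\<lhd>\<lhd>\<index>\<close> 75)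
  interch :: "'b \<Rightarrow> 'b \<Rightarrow> 'c"

definition hom :: "('o, 'a, 'b, 'c) gray \<Rightarrow> 'o \<Rightarrow> 'o \<Rightarrow> ('a, 'b, 'c) twocat" where
  "hom A X Y = \<lparr>
     tObj = {f. \<guillemotleft>f : X \<rightarrow>\<^bsub>A\<^esub> Y\<guillemotright>},
     tArr = {\<alpha> \<in> Cell2 A. \<guillemotleft>src1 A \<alpha> : X \<rightarrow>\<^bsub>A\<^esub> Y\<guillemotright>},
     tCell = {\<Gamma> \<in> Cell3 A. \<guillemotleft>src1 A (src2 A \<Gamma>) : X \<rightarrow>\<^bsub>A\<^esub> Y\<guillemotright>},
     tdom = src1 A, tcod = tgt1 A, tsrc = src2 A, ttgt = tgt2 A,
     tid = id2 A, tcomp = vcomp2 A, tidc = id3 A, tvcomp = vcomp3 A, thcomp = hcomp3 A\<rparr>"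

definition in3 :: "('o, 'a, 'b, 'c) gray \<Rightarrow> 'c \<Rightarrow> 'b \<Rightarrow> 'b \<Rightarrow> bool"
    (\<open>\<guillemotleft>_ : _ \<Rrightarrow>\<index> _\<guillemotright>\<close>) where
  "\<guillemotleft>\<Gamma> : \<phi> \<Rrightarrow>\<^bsub>A\<^esub> \<psi>\<guillemotright> \<longleftrightarrow> \<Gamma> \<in> Cell3 A \<and> src2 A \<Gamma> = \<phi> \<and> tgt2 A \<Gamma> = \<psi>"

definition inverse3 :: "('o, 'a, 'b, 'c) gray \<Rightarrow> 'c \<Rightarrow> 'c \<Rightarrow> bool" where
  "inverse3 A \<Gamma> \<Delta> \<longleftrightarrow> \<Gamma> \<in> Cell3 A \<and> \<guillemotleft>\<Delta> : tgt2 A \<Gamma> \<Rrightarrow>\<^bsub>A\<^esub> src2 A \<Gamma>\<guillemotright>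
     \<and> \<Delta> \<cdot>\<^bsub>A\<^esub> \<Gamma> = \<langle>src2 A \<Gamma>\<rangle>\<^bsub>A\<^esub> \<and> \<Gamma> \<cdot>\<^bsub>A\<^esub> \<Delta> = \<langle>tgt2 A \<Gamma>\<rangle>\<^bsub>A\<^esub>"

definition inv3 :: "('o, 'a, 'b, 'c) gray \<Rightarrow> 'c \<Rightarrow> 'c" where
  "inv3 A \<Gamma> = (THE \<Delta>. inverse3 A \<Gamma> \<Delta>)"

definition iso3 :: "('o, 'a, 'b, 'c) gray \<Rightarrow> 'c \<Rightarrow> 'b \<Rightarrow> 'b \<Rightarrow> bool"
    (\<open>\<guillemotleft>_ : _ \<cong>\<index> _\<guillemotright>\<close>) where
  "\<guillemotleft>\<Gamma> : \<phi> \<cong>\<^bsub>A\<^esub> \<psi>\<guillemotright> \<longleftrightarrow> \<guillemotleft>\<Gamma> : \<phi> \<Rrightarrow>\<^bsub>A\<^esub> \<psi>\<guillemotright> \<and> (\<exists>\<Delta>. inverse3 A \<Gamma> \<Delta>)"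

text \<open>
  Enrichment: the homs are 2-categories, composition is a 2-functor out of the Gray tensor product,
  and the associativity and unit laws of an enriched category are imposed on the generating
  cells of the (ternary, respectively unary) tensor products.
\<close>

locale gray_category =
  fixes A :: "('o, 'a, 'b, 'c) gray" (structure)
  assumes mor_ends: "f \<in> Mor A \<Longrightarrow> src0 A f \<in> Ob A \<and> tgt0 A f \<in> Ob A"
    and cell2_ends: "\<alpha> \<in> Cell2 A \<Longrightarrow> src1 A \<alpha> \<in> Mor A \<and> tgt1 A \<alpha> \<in> Mor A
      \<and> src0 A (src1 A \<alpha>) = src0 A (tgt1 A \<alpha>) \<and> tgt0 A (src1 A \<alpha>) = tgt0 A (tgt1 A \<alpha>)"
    and cell3_ends: "\<Gamma> \<in> Cell3 A \<Longrightarrow> src2 A \<Gamma> \<in> Cell2 A \<and> tgt2 A \<Gamma> \<in> Cell2 A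
      \<and> src1 A (src2 A \<Gamma>) = src1 A (tgt2 A \<Gamma>) \<and> tgt1 A (src2 A \<Gamma>) = tgt1 A (tgt2 A \<Gamma>)"
    and hom_two_category: "\<lbrakk>X \<in> Ob A; Y \<in> Ob A\<rbrakk> \<Longrightarrow> two_category (hom A X Y)"
    and id1_in: "X \<in> Ob A \<Longrightarrow> \<guillemotleft>id1 A X : X \<rightarrow> X\<guillemotright>"
    and comp_quasifunctor: "\<lbrakk>X \<in> Ob A; Y \<in> Ob A; Z \<in> Ob A\<rbrakk>
      \<Longrightarrow> gray_quasifunctor (hom A Y Z) (hom A X Y) (hom A X Z)
            (comp1 A) (whr2 A) (whl2 A) (whr3 A) (whl3 A) (interch A)"
    and id_left1: "\<guillemotleft>f : X \<rightarrow> Y\<guillemotright> \<Longrightarrow> id1 A Y \<bullet> f = f"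
    and id_right1: "\<guillemotleft>f : X \<rightarrow> Y\<guillemotright> \<Longrightarrow> f \<bullet> id1 A X = f"
    and id_left2: "\<alpha> \<in> tArr (hom A X Y) \<Longrightarrow> id1 A Y \<rhd> \<alpha> = \<alpha>"
    and id_right2: "\<alpha> \<in> tArr (hom A X Y) \<Longrightarrow> \<alpha> \<lhd> id1 A X = \<alpha>"
    and id_left3: "\<Gamma> \<in> tCell (hom A X Y) \<Longrightarrow> id1 A Y \<rhd>\<rhd> \<Gamma> = \<Gamma>"
    and id_right3: "\<Gamma> \<in> tCell (hom A X Y) \<Longrightarrow> \<Gamma> \<lhd>\<lhd> id1 A X = \<Gamma>"
    and assoc111: "\<lbrakk>\<guillemotleft>f : W \<rightarrow> X\<guillemotright>; \<guillemotleft>g : X \<rightarrow> Y\<guillemotright>; \<guillemotleft>h : Y \<rightarrow> Z\<guillemotright>\<rbrakk>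
      \<Longrightarrow> (h \<bullet> g) \<bullet> f = h \<bullet> (g \<bullet> f)"
    and assoc112: "\<lbrakk>\<alpha> \<in> tArr (hom A W X); \<guillemotleft>g : X \<rightarrow> Y\<guillemotright>; \<guillemotleft>h : Y \<rightarrow> Z\<guillemotright>\<rbrakk>
      \<Longrightarrow> (h \<bullet> g) \<rhd> \<alpha> = h \<rhd> (g \<rhd> \<alpha>)"
    and assoc121: "\<lbrakk>\<guillemotleft>f : W \<rightarrow> X\<guillemotright>; \<beta> \<in> tArr (hom A X Y); \<guillemotleft>h : Y \<rightarrow> Z\<guillemotright>\<rbrakk>
      \<Longrightarrow> (h \<rhd> \<beta>) \<lhd> f = h \<rhd> (\<beta> \<lhd> f)"
    and assoc211: "\<lbrakk>\<guillemotleft>f : W \<rightarrow> X\<guillemotright>; \<guillemotleft>g : X \<rightarrow> Y\<guillemotright>; \<gamma> \<in> tArr (hom A Y Z)\<rbrakk>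
      \<Longrightarrow> (\<gamma> \<lhd> g) \<lhd> f = \<gamma> \<lhd> (g \<bullet> f)"
    and assoc113: "\<lbrakk>\<Gamma> \<in> tCell (hom A W X); \<guillemotleft>g : X \<rightarrow> Y\<guillemotright>; \<guillemotleft>h : Y \<rightarrow> Z\<guillemotright>\<rbrakk>
      \<Longrightarrow> (h \<bullet> g) \<rhd>\<rhd> \<Gamma> = h \<rhd>\<rhd> (g \<rhd>\<rhd> \<Gamma>)"
    and assoc131: "\<lbrakk>\<guillemotleft>f : W \<rightarrow> X\<guillemotright>; \<Gamma> \<in> tCell (hom A X Y); \<guillemotleft>h : Y \<rightarrow> Z\<guillemotright>\<rbrakk>
      \<Longrightarrow> (h \<rhd>\<rhd> \<Gamma>) \<lhd>\<lhd> f = h \<rhd>\<rhd> (\<Gamma> \<lhd>\<lhd> f)"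
    and assoc311: "\<lbrakk>\<guillemotleft>f : W \<rightarrow> X\<guillemotright>; \<guillemotleft>g : X \<rightarrow> Y\<guillemotright>; \<Gamma> \<in> tCell (hom A Y Z)\<rbrakk>
      \<Longrightarrow> (\<Gamma> \<lhd>\<lhd> g) \<lhd>\<lhd> f = \<Gamma> \<lhd>\<lhd> (g \<bullet> f)"
    and assoc122: "\<lbrakk>\<alpha> \<in> tArr (hom A W X); \<beta> \<in> tArr (hom A X Y); \<guillemotleft>h : Y \<rightarrow> Z\<guillemotright>\<rbrakk>
      \<Longrightarrow> interch A (h \<rhd> \<beta>) \<alpha> = h \<rhd>\<rhd> interch A \<beta> \<alpha>"
    and assoc212: "\<lbrakk>\<alpha> \<in> tArr (hom A W X); \<guillemotleft>g : X \<rightarrow> Y\<guillemotright>; \<gamma> \<in> tArr (hom A Y Z)\<rbrakk>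
      \<Longrightarrow> interch A (\<gamma> \<lhd> g) \<alpha> = interch A \<gamma> (g \<rhd> \<alpha>)"
    and assoc221: "\<lbrakk>\<guillemotleft>f : W \<rightarrow> X\<guillemotright>; \<beta> \<in> tArr (hom A X Y); \<gamma> \<in> tArr (hom A Y Z)\<rbrakk>
      \<Longrightarrow> interch A \<gamma> \<beta> \<lhd>\<lhd> f = interch A \<gamma> (\<beta> \<lhd> f)"

lemma (in gray_category) underlying_sesquicategory: "sesquicategory A"
proof -
  have hc: "f \<in> Mor A \<Longrightarrow> two_category (hom A (src0 A f) (tgt0 A f))" for f
    using hom_two_category mor_ends by blast
  have qf: "\<guillemotleft>f : X \<rightarrow> Y\<guillemotright> \<Longrightarrow> \<guillemotleft>g : Y \<rightarrow> Z\<guillemotright> \<Longrightarrow> gray_quasifunctor (hom A Y Z) (hom A X Y) (hom A X Z)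
            (comp1 A) (whr2 A) (whl2 A) (whr3 A) (whl3 A) (interch A)" for f g X Y Z
    using comp_quasifunctor mor_ends by (auto simp: in1_def)
  have fr: "\<guillemotleft>f : X \<rightarrow> Y\<guillemotright> \<Longrightarrow> \<guillemotleft>g : Y \<rightarrow> Z\<guillemotright> \<Longrightarrow> two_functor (hom A X Y) (hom A X Z) (comp1 A g) (whl2 A g) (whl3 A g)" for f g X Y Z
    using gray_quasifunctor.functor_right[OF qf] by (auto simp: hom_def)
  have fl: "\<guillemotleft>f : X \<rightarrow> Y\<guillemotright> \<Longrightarrow> \<guillemotleft>g : Y \<rightarrow> Z\<guillemotright> \<Longrightarrow>
     two_functor (hom A Y Z) (hom A X Z) (\<lambda>g. g \<bullet> f) (\<lambda>\<beta>. \<beta> \<lhd> f) (\<lambda>\<Gamma>. \<Gamma> \<lhd>\<lhd> f)" for f g X Y Z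
    using gray_quasifunctor.functor_left[OF qf] by (auto simp: hom_def)
  note defs = in1_def in2_def hom_def tin1_def
  have h1: "\<guillemotleft>f : X \<rightarrow> Y\<guillemotright> \<Longrightarrow> \<guillemotleft>\<alpha> : f \<Rightarrow> g\<guillemotright> \<Longrightarrow> tin1 (hom A X Y) \<alpha> f g" for f g X Y \<alpha>
    by (auto simp: defs)
  have o: "\<guillemotleft>f : X \<rightarrow> Y\<guillemotright> \<longleftrightarrow> f \<in> tObj (hom A X Y)" for f X Y by (auto simp: defs)
  have a: "tin1 (hom A X Y) \<alpha> f g \<longleftrightarrow> \<guillemotleft>\<alpha> : f \<Rightarrow> g\<guillemotright> \<and> \<guillemotleft>f : X \<rightarrow> Y\<guillemotright>" for f g X Y \<alpha>
    by (auto simp: defs)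
  have cid: "tid (hom A X Y) = id2 A" "tcomp (hom A X Y) = vcomp2 A" for X Y by (auto simp: hom_def)
  have arr: "\<guillemotleft>f : X \<rightarrow> Y\<guillemotright> \<Longrightarrow> \<guillemotleft>\<alpha> : f \<Rightarrow> g\<guillemotright> \<Longrightarrow> \<alpha> \<in> tArr (hom A X Y)" for f g X Y \<alpha>
    by (auto simp: defs)
  have c2: "\<guillemotleft>\<alpha> : f \<Rightarrow> g\<guillemotright> \<Longrightarrow> two_category (hom A (src0 A f) (tgt0 A f)) \<and> tin1 (hom A (src0 A f) (tgt0 A f)) \<alpha> f g" for \<alpha> f g
    using hc h1 cell2_ends by (metis in1_def in2_def)
  have par: "\<guillemotleft>\<alpha> : f \<Rightarrow> g\<guillemotright> \<Longrightarrow> \<guillemotleft>f : X \<rightarrow> Y\<guillemotright> \<Longrightarrow> \<guillemotleft>g : X \<rightarrow> Y\<guillemotright>" for \<alpha> f g X Y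
    using cell2_ends by (auto simp: in1_def in2_def)
  have par0: "\<guillemotleft>\<alpha> : f \<Rightarrow> g\<guillemotright> \<Longrightarrow> src0 A f = src0 A g \<and> tgt0 A f = tgt0 A g" for \<alpha> f g
    using cell2_ends by (auto simp: in2_def)
  show "sesquicategory A"
  proof
    fix f assume "f \<in> Mor A" then show "\<guillemotleft>id2 A f : f \<Rightarrow> f\<guillemotright>"
      using two_category.tid_in[OF hc] cid a o by (metis in1_def)
  next
    fix \<alpha> f g \<beta> h assume "\<guillemotleft>\<alpha> : f \<Rightarrow> g\<guillemotright>" "\<guillemotleft>\<beta> : g \<Rightarrow> h\<guillemotright>"
    then show "\<guillemotleft>\<beta> \<odot> \<alpha> : f \<Rightarrow> h\<guillemotright>"
      using two_category.tcomp_in[of "hom A (src0 A f) (tgt0 A f)" \<alpha> f g \<beta> h]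
        c2[of \<alpha> f g] c2[of \<beta> g h] par0[of \<alpha> f g] by (simp add: cid a)
  next
    fix \<alpha> f g assume "\<guillemotleft>\<alpha> : f \<Rightarrow> g\<guillemotright>"
    then show "id2 A g \<odot> \<alpha> = \<alpha>" "\<alpha> \<odot> id2 A f = \<alpha>"
      using c2[of \<alpha> f g] two_category.tcomp_id_left[of "hom A (src0 A f) (tgt0 A f)" \<alpha> f g]
        two_category.tcomp_id_right[of "hom A (src0 A f) (tgt0 A f)" \<alpha> f g] by (simp_all add: cid)
  next
    fix \<alpha> f g \<beta> h \<gamma> k assume "\<guillemotleft>\<alpha> : f \<Rightarrow> g\<guillemotright>" "\<guillemotleft>\<beta> : g \<Rightarrow> h\<guillemotright>" "\<guillemotleft>\<gamma> : h \<Rightarrow> k\<guillemotright>"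
    then show "(\<gamma> \<odot> \<beta>) \<odot> \<alpha> = \<gamma> \<odot> (\<beta> \<odot> \<alpha>)"
      using two_category.tcomp_assoc[of "hom A (src0 A f) (tgt0 A f)" \<alpha> f g \<beta> h \<gamma> k]
        c2[of \<alpha> f g] c2[of \<beta> g h] c2[of \<gamma> h k] par0[of \<alpha> f g] par0[of \<beta> g h] by (simp add: cid)
  next
    fix \<alpha> f f' X Y g Z assume *: "\<guillemotleft>\<alpha> : f \<Rightarrow> f'\<guillemotright>" "\<guillemotleft>f : X \<rightarrow> Y\<guillemotright>" "\<guillemotleft>g : Y \<rightarrow> Z\<guillemotright>"
    then show "\<guillemotleft>g \<rhd> \<alpha> : g \<bullet> f \<Rightarrow> g \<bullet> f'\<guillemotright>"
      using two_functor.arr[OF fr[OF *(2,3)]] a by blast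
  next
    fix f X Y \<beta> g g' Z assume *: "\<guillemotleft>f : X \<rightarrow> Y\<guillemotright>" "\<guillemotleft>\<beta> : g \<Rightarrow> g'\<guillemotright>" "\<guillemotleft>g : Y \<rightarrow> Z\<guillemotright>"
    then show "\<guillemotleft>\<beta> \<lhd> f : g \<bullet> f \<Rightarrow> g' \<bullet> f\<guillemotright>"
      using two_functor.arr[OF fl[OF *(1,3)]] a by blast
  next
    fix f X Y g Z assume *: "\<guillemotleft>f : X \<rightarrow> Y\<guillemotright>" "\<guillemotleft>g : Y \<rightarrow> Z\<guillemotright>"
    then show "g \<rhd> id2 A f = id2 A (g \<bullet> f)" "id2 A g \<lhd> f = id2 A (g \<bullet> f)"
      using two_functor.tid[OF fr[OF *], of f] two_functor.tid[OF fl[OF *], of g] * by (simp_all add: o cid)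
  next
    fix \<alpha> f f' \<alpha>' f'' X Y g Z
    assume *: "\<guillemotleft>\<alpha> : f \<Rightarrow> f'\<guillemotright>" "\<guillemotleft>\<alpha>' : f' \<Rightarrow> f''\<guillemotright>" "\<guillemotleft>f : X \<rightarrow> Y\<guillemotright>" "\<guillemotleft>g : Y \<rightarrow> Z\<guillemotright>"
    then show "g \<rhd> (\<alpha>' \<odot> \<alpha>) = (g \<rhd> \<alpha>') \<odot> (g \<rhd> \<alpha>)"
      using two_functor.tcomp[OF fr[OF *(3,4)], of \<alpha> f f' \<alpha>' f''] * par[of \<alpha> f f']
      by (simp add: a cid)
  next
    fix \<alpha> f f' \<alpha>' f'' X Y g Z
    assume *: "\<guillemotleft>\<alpha> : f \<Rightarrow> f'\<guillemotright>" "\<guillemotleft>\<alpha>' : f' \<Rightarrow> f''\<guillemotright>" "\<guillemotleft>g : X \<rightarrow> Y\<guillemotright>" "\<guillemotleft>f : Y \<rightarrow> Z\<guillemotright>"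
    then show "(\<alpha>' \<odot> \<alpha>) \<lhd> g = (\<alpha>' \<lhd> g) \<odot> (\<alpha> \<lhd> g)"
      using two_functor.tcomp[OF fl[OF *(3,4)], of \<alpha> f f' \<alpha>' f''] * par[of \<alpha> f f']
      by (simp add: a cid)
  next
    fix \<alpha> f f' X Y assume "\<guillemotleft>\<alpha> : f \<Rightarrow> f'\<guillemotright>" "\<guillemotleft>f : X \<rightarrow> Y\<guillemotright>"
    then show "id1 A Y \<rhd> \<alpha> = \<alpha>" "\<alpha> \<lhd> id1 A X = \<alpha>" using arr id_left2 id_right2 by blast+
  next
    fix f X Y g Z assume *: "\<guillemotleft>f : X \<rightarrow> Y\<guillemotright>" "\<guillemotleft>g : Y \<rightarrow> Z\<guillemotright>"
    show "\<guillemotleft>g \<bullet> f : X \<rightarrow> Z\<guillemotright>" using two_functor.obj[OF fr[OF *]] * by (simp add: o)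
  next
    fix \<alpha> f f' W X g Y h Z
    assume "\<guillemotleft>\<alpha> : f \<Rightarrow> f'\<guillemotright>" "\<guillemotleft>f : W \<rightarrow> X\<guillemotright>" "\<guillemotleft>g : X \<rightarrow> Y\<guillemotright>" "\<guillemotleft>h : Y \<rightarrow> Z\<guillemotright>"
    then show "(h \<bullet> g) \<rhd> \<alpha> = h \<rhd> (g \<rhd> \<alpha>)" using assoc112[OF arr] by blast
  next
    fix f W X \<beta> g g' Y h Z
    assume "\<guillemotleft>f : W \<rightarrow> X\<guillemotright>" "\<guillemotleft>\<beta> : g \<Rightarrow> g'\<guillemotright>" "\<guillemotleft>g : X \<rightarrow> Y\<guillemotright>" "\<guillemotleft>h : Y \<rightarrow> Z\<guillemotright>"
    then show "(h \<rhd> \<beta>) \<lhd> f = h \<rhd> (\<beta> \<lhd> f)" using assoc121[OF _ arr] by blast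
  next
    fix f W X g Y \<gamma> h h' Z
    assume "\<guillemotleft>f : W \<rightarrow> X\<guillemotright>" "\<guillemotleft>g : X \<rightarrow> Y\<guillemotright>" "\<guillemotleft>\<gamma> : h \<Rightarrow> h'\<guillemotright>" "\<guillemotleft>h : Y \<rightarrow> Z\<guillemotright>"
    then show "(\<gamma> \<lhd> g) \<lhd> f = \<gamma> \<lhd> (g \<bullet> f)" using assoc211[OF _ _ arr] by blast
  qed (erule (2) assoc111 | erule id1_in id_left1 id_right1 | erule mor_ends | erule cell2_ends)+
qed

locale cofibrant_gray_category = gray_category A + free_on_computad A K H
  for A :: "('o, 'a, 'b, 'c) gray" and K :: "('v, 'e, 'g) computad"
    and H :: "('v, ('v, 'e) path, ('v, 'e, 'g) fcell, 'o, 'a, 'b) smap"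

record ('o, 'a, 'b, 'c, 'o1, 'a1, 'b1, 'c1) gmap = "('o, 'a, 'b, 'o1, 'a1, 'b1) smap" +
  on3 :: "'c \<Rightarrow> 'c1"

locale gray_functor =
  fixes A :: "('o, 'a, 'b, 'c) gray" and B :: "('o1, 'a1, 'b1, 'c1) gray"
    and F :: "('o, 'a, 'b, 'c, 'o1, 'a1, 'b1, 'c1) gmap"
  assumes on_objects: "X \<in> Ob A \<Longrightarrow> on0 F X \<in> Ob B"
    and on_homs: "\<lbrakk>X \<in> Ob A; Y \<in> Ob A\<rbrakk>
      \<Longrightarrow> two_functor (hom A X Y) (hom B (on0 F X) (on0 F Y)) (on1 F) (on2 F) (on3 F)"
    and pres_id1: "X \<in> Ob A \<Longrightarrow> on1 F (id1 A X) = id1 B (on0 F X)"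
    and pres_comp1: "\<lbrakk>\<guillemotleft>f : X \<rightarrow>\<^bsub>A\<^esub> Y\<guillemotright>; \<guillemotleft>g : Y \<rightarrow>\<^bsub>A\<^esub> Z\<guillemotright>\<rbrakk>
      \<Longrightarrow> on1 F (g \<bullet>\<^bsub>A\<^esub> f) = on1 F g \<bullet>\<^bsub>B\<^esub> on1 F f"
    and pres_whl2: "\<lbrakk>\<alpha> \<in> tArr (hom A X Y); \<guillemotleft>g : Y \<rightarrow>\<^bsub>A\<^esub> Z\<guillemotright>\<rbrakk>
      \<Longrightarrow> on2 F (g \<rhd>\<^bsub>A\<^esub> \<alpha>) = on1 F g \<rhd>\<^bsub>B\<^esub> on2 F \<alpha>"
    and pres_whr2: "\<lbrakk>\<guillemotleft>f : X \<rightarrow>\<^bsub>A\<^esub> Y\<guillemotright>; \<beta> \<in> tArr (hom A Y Z)\<rbrakk>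
      \<Longrightarrow> on2 F (\<beta> \<lhd>\<^bsub>A\<^esub> f) = on2 F \<beta> \<lhd>\<^bsub>B\<^esub> on1 F f"
    and pres_whl3: "\<lbrakk>\<Gamma> \<in> tCell (hom A X Y); \<guillemotleft>g : Y \<rightarrow>\<^bsub>A\<^esub> Z\<guillemotright>\<rbrakk>
      \<Longrightarrow> on3 F (g \<rhd>\<rhd>\<^bsub>A\<^esub> \<Gamma>) = on1 F g \<rhd>\<rhd>\<^bsub>B\<^esub> on3 F \<Gamma>"
    and pres_whr3: "\<lbrakk>\<guillemotleft>f : X \<rightarrow>\<^bsub>A\<^esub> Y\<guillemotright>; \<Gamma> \<in> tCell (hom A Y Z)\<rbrakk>
      \<Longrightarrow> on3 F (\<Gamma> \<lhd>\<lhd>\<^bsub>A\<^esub> f) = on3 F \<Gamma> \<lhd>\<lhd>\<^bsub>B\<^esub> on1 F f"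
    and pres_interch: "\<lbrakk>\<alpha> \<in> tArr (hom A X Y); \<beta> \<in> tArr (hom A Y Z)\<rbrakk>
      \<Longrightarrow> on3 F (interch A \<beta> \<alpha>) = interch B (on2 F \<beta>) (on2 F \<alpha>)"


section \<open>Trinatural transformations\<close>

text \<open>
  All component functions are required to be \<^const>\<open>extensional\<close>, so that equality of records is equality
  of all components.
\<close>

record ('o, 'a, 'b, 'a1, 'b1, 'c1) trinat =
  tr0 :: "'o \<Rightarrow> 'a1"
  tradj :: "'a \<Rightarrow> ('b1, 'c1) adjeq"
  tr2 :: "'b \<Rightarrow> 'c1"
  unitor :: "'o \<Rightarrow> 'c1"
  compositor :: "'a \<times> 'a \<Rightarrow> 'c1"

abbreviation tr1 :: "('o, 'a, 'b, 'a1, 'b1, 'c1) trinat \<Rightarrow> 'a \<Rightarrow> 'b1" where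
  "tr1 p f \<equiv> ladj (tradj p f)"

record ('o, 'a, 'b1, 'c1) trimod =
  md0 :: "'o \<Rightarrow> 'b1"
  md1 :: "'a \<Rightarrow> 'c1"

definition composable :: "('o, 'a, 'b, 'm) sesqui_scheme \<Rightarrow> ('a \<times> 'a) set" where
  "composable S = {(g, f). g \<in> Mor S \<and> f \<in> Mor S \<and> tgt0 S f = src0 S g}"

context
  fixes A :: "('o, 'a, 'b, 'c) gray"
    and B :: "('o1, 'a1, 'b1, 'c1) gray" (structure)
    and F :: "('o, 'a, 'b, 'c, 'o1, 'a1, 'b1, 'c1) gmap"
    and G :: "('o, 'a, 'b, 'c, 'o1, 'a1, 'b1, 'c1) gmap"
begin

definition obj_components :: "('o \<Rightarrow> 'a1) \<Rightarrow> bool" where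
  "obj_components p0 \<longleftrightarrow> (\<forall>X \<in> Ob A. \<guillemotleft>p0 X : on0 F X \<rightarrow> on0 G X\<guillemotright>)"

definition adj_components :: "'a set \<Rightarrow> ('o \<Rightarrow> 'a1) \<Rightarrow> ('a \<Rightarrow> ('b1, 'c1) adjeq) \<Rightarrow> bool" where
  "adj_components M p0 p1 \<longleftrightarrow> (\<forall>X Y. \<forall>f \<in> M. \<guillemotleft>f : X \<rightarrow>\<^bsub>A\<^esub> Y\<guillemotright> \<longrightarrow>
     adjoint_equivalence (hom B (on0 F X) (on0 G Y)) (p0 Y \<bullet> on1 F f) (on1 G f \<bullet> p0 X) (p1 f))"

definition cell_components ::
    "'b set \<Rightarrow> ('o \<Rightarrow> 'a1) \<Rightarrow> ('a \<Rightarrow> ('b1, 'c1) adjeq) \<Rightarrow> ('b \<Rightarrow> 'c1) \<Rightarrow> bool" where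
  "cell_components M p0 p1 p2 \<longleftrightarrow> (\<forall>X Y f g. \<forall>\<phi> \<in> M. \<guillemotleft>f : X \<rightarrow>\<^bsub>A\<^esub> Y\<guillemotright> \<and> \<guillemotleft>\<phi> : f \<Rightarrow>\<^bsub>A\<^esub> g\<guillemotright> \<longrightarrow>
     \<guillemotleft>p2 \<phi> : ladj (p1 g) \<odot> (p0 Y \<rhd> on2 F \<phi>) \<cong> (on2 G \<phi> \<lhd> p0 X) \<odot> ladj (p1 f)\<guillemotright>)"

definition unitors :: "('o, 'a, 'b, 'a1, 'b1, 'c1) trinat \<Rightarrow> bool" where
  "unitors p \<longleftrightarrow> (\<forall>X \<in> Ob A. \<guillemotleft>unitor p X : id2 B (tr0 p X) \<cong> tr1 p (id1 A X)\<guillemotright>)"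

definition compositors :: "('o, 'a, 'b, 'a1, 'b1, 'c1) trinat \<Rightarrow> bool" where
  "compositors p \<longleftrightarrow> (\<forall>(g, f) \<in> composable A.
     \<guillemotleft>compositor p (g, f) : (on1 G g \<rhd> tr1 p f) \<odot> (tr1 p g \<lhd> on1 F f) \<cong> tr1 p (g \<bullet>\<^bsub>A\<^esub> f)\<guillemotright>)"

definition trinat_extensional :: "('o, 'a, 'b, 'a1, 'b1, 'c1) trinat \<Rightarrow> bool" where
  "trinat_extensional p \<longleftrightarrow> tr0 p \<in> extensional (Ob A) \<and> tradj p \<in> extensional (Mor A)
     \<and> tr2 p \<in> extensional (Cell2 A) \<and> unitor p \<in> extensional (Ob A)
     \<and> compositor p \<in> extensional (composable A)"

text \<open>Local pseudonaturality consists of the following three laws.\<close>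

definition identity_law :: "('o, 'a, 'b, 'a1, 'b1, 'c1) trinat \<Rightarrow> bool" where
  "identity_law p \<longleftrightarrow> (\<forall>f \<in> Mor A. tr2 p (id2 A f) = \<langle>tr1 p f\<rangle>)"

definition composition_law :: "('o, 'a, 'b, 'a1, 'b1, 'c1) trinat \<Rightarrow> bool" where
  "composition_law p \<longleftrightarrow> (\<forall>X Y f g h \<phi> \<psi>.
     \<guillemotleft>f : X \<rightarrow>\<^bsub>A\<^esub> Y\<guillemotright> \<and> \<guillemotleft>\<phi> : f \<Rightarrow>\<^bsub>A\<^esub> g\<guillemotright> \<and> \<guillemotleft>\<psi> : g \<Rightarrow>\<^bsub>A\<^esub> h\<guillemotright> \<longrightarrow>
     tr2 p (\<psi> \<odot>\<^bsub>A\<^esub> \<phi>) = (\<langle>on2 G \<psi> \<lhd> tr0 p X\<rangle> \<star> tr2 p \<phi>) \<cdot> (tr2 p \<psi> \<star> \<langle>tr0 p Y \<rhd> on2 F \<phi>\<rangle>))"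

definition cell3_law :: "('o, 'a, 'b, 'a1, 'b1, 'c1) trinat \<Rightarrow> bool" where
  "cell3_law p \<longleftrightarrow> (\<forall>X Y f g \<phi> \<phi>' \<Omega>.
     \<guillemotleft>f : X \<rightarrow>\<^bsub>A\<^esub> Y\<guillemotright> \<and> \<guillemotleft>\<phi> : f \<Rightarrow>\<^bsub>A\<^esub> g\<guillemotright> \<and> \<guillemotleft>\<Omega> : \<phi> \<Rrightarrow>\<^bsub>A\<^esub> \<phi>'\<guillemotright> \<longrightarrow>
     ((on3 G \<Omega> \<lhd>\<lhd> tr0 p X) \<star> \<langle>tr1 p f\<rangle>) \<cdot> tr2 p \<phi>
       = tr2 p \<phi>' \<cdot> (\<langle>tr1 p g\<rangle> \<star> (tr0 p Y \<rhd>\<rhd> on3 F \<Omega>)))"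

definition right_whiskering_law :: "('o, 'a, 'b, 'a1, 'b1, 'c1) trinat \<Rightarrow> bool" where
  "right_whiskering_law p \<longleftrightarrow> (\<forall>X Y Z f f' \<phi> g.
     \<guillemotleft>f : X \<rightarrow>\<^bsub>A\<^esub> Y\<guillemotright> \<and> \<guillemotleft>\<phi> : f \<Rightarrow>\<^bsub>A\<^esub> f'\<guillemotright> \<and> \<guillemotleft>g : Y \<rightarrow>\<^bsub>A\<^esub> Z\<guillemotright> \<longrightarrow>
     tr2 p (g \<rhd>\<^bsub>A\<^esub> \<phi>) \<cdot> (compositor p (g, f') \<star> \<langle>tr0 p Z \<rhd> (on1 F g \<rhd> on2 F \<phi>)\<rangle>)
       = (\<langle>(on1 G g \<rhd> on2 G \<phi>) \<lhd> tr0 p X\<rangle> \<star> compositor p (g, f))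
         \<cdot> ((on1 G g \<rhd>\<rhd> tr2 p \<phi>) \<star> \<langle>tr1 p g \<lhd> on1 F f\<rangle>)
         \<cdot> (\<langle>on1 G g \<rhd> tr1 p f'\<rangle> \<star> inv3 B (interch B (tr1 p g) (on2 F \<phi>))))"

definition left_whiskering_law :: "('o, 'a, 'b, 'a1, 'b1, 'c1) trinat \<Rightarrow> bool" where
  "left_whiskering_law p \<longleftrightarrow> (\<forall>X Y Z f g g' \<psi>.
     \<guillemotleft>f : X \<rightarrow>\<^bsub>A\<^esub> Y\<guillemotright> \<and> \<guillemotleft>g : Y \<rightarrow>\<^bsub>A\<^esub> Z\<guillemotright> \<and> \<guillemotleft>\<psi> : g \<Rightarrow>\<^bsub>A\<^esub> g'\<guillemotright> \<longrightarrow>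
     tr2 p (\<psi> \<lhd>\<^bsub>A\<^esub> f) \<cdot> (compositor p (g', f) \<star> \<langle>tr0 p Z \<rhd> (on2 F \<psi> \<lhd> on1 F f)\<rangle>)
       = (\<langle>(on2 G \<psi> \<lhd> on1 G f) \<lhd> tr0 p X\<rangle> \<star> compositor p (g, f))
         \<cdot> (interch B (on2 G \<psi>) (tr1 p f) \<star> \<langle>tr1 p g \<lhd> on1 F f\<rangle>)
         \<cdot> (\<langle>on1 G g' \<rhd> tr1 p f\<rangle> \<star> (tr2 p \<psi> \<lhd>\<lhd> on1 F f)))"

definition associativity_law :: "('o, 'a, 'b, 'a1, 'b1, 'c1) trinat \<Rightarrow> bool" where
  "associativity_law p \<longleftrightarrow> (\<forall>W X Y Z e f g.
     \<guillemotleft>e : W \<rightarrow>\<^bsub>A\<^esub> X\<guillemotright> \<and> \<guillemotleft>f : X \<rightarrow>\<^bsub>A\<^esub> Y\<guillemotright> \<and> \<guillemotleft>g : Y \<rightarrow>\<^bsub>A\<^esub> Z\<guillemotright> \<longrightarrow>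
     compositor p (g, f \<bullet>\<^bsub>A\<^esub> e)
         \<cdot> ((on1 G g \<rhd>\<rhd> compositor p (f, e)) \<star> \<langle>(tr1 p g \<lhd> on1 F f) \<lhd> on1 F e\<rangle>)
       = compositor p (g \<bullet>\<^bsub>A\<^esub> f, e)
         \<cdot> (\<langle>on1 G g \<rhd> (on1 G f \<rhd> tr1 p e)\<rangle> \<star> (compositor p (g, f) \<lhd>\<lhd> on1 F e)))"

definition unit_laws :: "('o, 'a, 'b, 'a1, 'b1, 'c1) trinat \<Rightarrow> bool" where
  "unit_laws p \<longleftrightarrow> (\<forall>X Y f. \<guillemotleft>f : X \<rightarrow>\<^bsub>A\<^esub> Y\<guillemotright> \<longrightarrow>
     compositor p (f, id1 A X) \<cdot> ((on1 G f \<rhd>\<rhd> unitor p X) \<star> \<langle>tr1 p f\<rangle>) = \<langle>tr1 p f\<rangle>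
   \<and> compositor p (id1 A Y, f) \<cdot> (\<langle>tr1 p f\<rangle> \<star> (unitor p Y \<lhd>\<lhd> on1 F f)) = \<langle>tr1 p f\<rangle>)"

definition trinatural :: "('o, 'a, 'b, 'a1, 'b1, 'c1) trinat \<Rightarrow> bool" where
  "trinatural p \<longleftrightarrow> trinat_extensional p
     \<and> obj_components (tr0 p)
     \<and> adj_components (Mor A) (tr0 p) (tradj p)
     \<and> cell_components (Cell2 A) (tr0 p) (tradj p) (tr2 p)
     \<and> unitors p \<and> compositors p
     \<and> identity_law p \<and> composition_law p \<and> cell3_law p
     \<and> right_whiskering_law p \<and> left_whiskering_law p
     \<and> associativity_law p \<and> unit_laws p"

definition strict_adj :: "('o \<Rightarrow> 'a1) \<Rightarrow> ('a \<Rightarrow> ('b1, 'c1) adjeq) \<Rightarrow> bool" where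
  "strict_adj p0 p1 \<longleftrightarrow>
     (\<forall>X \<in> Ob A. p1 (id1 A X) = adjeq_id (hom B (on0 F X) (on0 G X)) (p0 X))
   \<and> (\<forall>X Y Z f g. \<guillemotleft>f : X \<rightarrow>\<^bsub>A\<^esub> Y\<guillemotright> \<and> \<guillemotleft>g : Y \<rightarrow>\<^bsub>A\<^esub> Z\<guillemotright> \<longrightarrow>
        p1 (g \<bullet>\<^bsub>A\<^esub> f) = adjeq_comp (hom B (on0 F X) (on0 G Z))
          (adjeq_image (\<lambda>\<alpha>. on1 G g \<rhd> \<alpha>) (\<lambda>\<Gamma>. on1 G g \<rhd>\<rhd> \<Gamma>) (p1 f))
          (adjeq_image (\<lambda>\<alpha>. \<alpha> \<lhd> on1 F f) (\<lambda>\<Gamma>. \<Gamma> \<lhd>\<lhd> on1 F f) (p1 g)))"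

definition semistrict :: "('o, 'a, 'b, 'a1, 'b1, 'c1) trinat \<Rightarrow> bool" where
  "semistrict p \<longleftrightarrow> trinatural p \<and> strict_adj (tr0 p) (tradj p)
     \<and> (\<forall>X \<in> Ob A. unitor p X = \<langle>id2 B (tr0 p X)\<rangle>)
     \<and> (\<forall>(g, f) \<in> composable A. compositor p (g, f) = \<langle>tr1 p (g \<bullet>\<^bsub>A\<^esub> f)\<rangle>)"

text \<open>
  The data of a semi-strict transformation before any axiom is imposed. Evaluating the laws above
  at \<open>semistrict_data p0 p1 p2\<close> gives their semi-strict form.
\<close>

definition semistrict_data ::
    "('o \<Rightarrow> 'a1) \<Rightarrow> ('a \<Rightarrow> ('b1, 'c1) adjeq) \<Rightarrow> ('b \<Rightarrow> 'c1) \<Rightarrow> ('o, 'a, 'b, 'a1, 'b1, 'c1) trinat" where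
  "semistrict_data p0 p1 p2 = \<lparr>tr0 = p0, tradj = p1, tr2 = p2,
     unitor = (\<lambda>X \<in> Ob A. \<langle>id2 B (p0 X)\<rangle>),
     compositor = (\<lambda>(g, f) \<in> composable A. \<langle>ladj (p1 (g \<bullet>\<^bsub>A\<^esub> f))\<rangle>)\<rparr>"

definition adj_extension ::
    "'a set \<Rightarrow> ('o \<Rightarrow> 'a1) \<Rightarrow> ('a \<Rightarrow> ('b1, 'c1) adjeq) \<Rightarrow> ('a \<Rightarrow> ('b1, 'c1) adjeq) \<Rightarrow> bool" where
  "adj_extension M p0 p1 P1 \<longleftrightarrow> P1 \<in> extensional (Mor A)
     \<and> (\<forall>f \<in> M. P1 f = p1 f) \<and> adj_components (Mor A) p0 P1 \<and> strict_adj p0 P1"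

definition cell_extension ::
    "'b set \<Rightarrow> ('o \<Rightarrow> 'a1) \<Rightarrow> ('a \<Rightarrow> ('b1, 'c1) adjeq) \<Rightarrow> ('b \<Rightarrow> 'c1) \<Rightarrow> ('b \<Rightarrow> 'c1) \<Rightarrow> bool" where
  "cell_extension M p0 P1 p2 P2 \<longleftrightarrow> P2 \<in> extensional (Cell2 A)
     \<and> (\<forall>\<phi> \<in> M. P2 \<phi> = p2 \<phi>) \<and> cell_components (Cell2 A) p0 P1 P2
     \<and> identity_law (semistrict_data p0 P1 P2)
     \<and> composition_law (semistrict_data p0 P1 P2)
     \<and> right_whiskering_law (semistrict_data p0 P1 P2)
     \<and> left_whiskering_law (semistrict_data p0 P1 P2)"


section \<open>Trimodifications and perturbations\<close>

context
  fixes p q :: "('o, 'a, 'b, 'a1, 'b1, 'c1) trinat"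
begin

definition mod_obj_components :: "('o \<Rightarrow> 'b1) \<Rightarrow> bool" where
  "mod_obj_components s0 \<longleftrightarrow> (\<forall>X \<in> Ob A. \<guillemotleft>s0 X : tr0 p X \<Rightarrow> tr0 q X\<guillemotright>)"

definition mod_mor_components :: "'a set \<Rightarrow> ('o \<Rightarrow> 'b1) \<Rightarrow> ('a \<Rightarrow> 'c1) \<Rightarrow> bool" where
  "mod_mor_components M s0 s1 \<longleftrightarrow> (\<forall>X Y. \<forall>f \<in> M. \<guillemotleft>f : X \<rightarrow>\<^bsub>A\<^esub> Y\<guillemotright> \<longrightarrow>
     \<guillemotleft>s1 f : (on1 G f \<rhd> s0 X) \<odot> tr1 p f \<cong> tr1 q f \<odot> (s0 Y \<lhd> on1 F f)\<guillemotright>)"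

definition local_modification :: "'b set \<Rightarrow> ('o \<Rightarrow> 'b1) \<Rightarrow> ('a \<Rightarrow> 'c1) \<Rightarrow> bool" where
  "local_modification M s0 s1 \<longleftrightarrow> (\<forall>X Y f g. \<forall>\<phi> \<in> M. \<guillemotleft>f : X \<rightarrow>\<^bsub>A\<^esub> Y\<guillemotright> \<and> \<guillemotleft>\<phi> : f \<Rightarrow>\<^bsub>A\<^esub> g\<guillemotright> \<longrightarrow>
     (tr2 q \<phi> \<star> \<langle>s0 Y \<lhd> on1 F f\<rangle>)
       \<cdot> (\<langle>tr1 q g\<rangle> \<star> inv3 B (interch B (s0 Y) (on2 F \<phi>)))
       \<cdot> (s1 g \<star> \<langle>tr0 p Y \<rhd> on2 F \<phi>\<rangle>)
     = (\<langle>on2 G \<phi> \<lhd> tr0 q X\<rangle> \<star> s1 f)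
       \<cdot> (interch B (on2 G \<phi>) (s0 X) \<star> \<langle>tr1 p f\<rangle>)
       \<cdot> (\<langle>on1 G g \<rhd> s0 X\<rangle> \<star> tr2 p \<phi>))"

definition mod_unit_law :: "('o \<Rightarrow> 'b1) \<Rightarrow> ('a \<Rightarrow> 'c1) \<Rightarrow> bool" where
  "mod_unit_law s0 s1 \<longleftrightarrow> (\<forall>X \<in> Ob A.
     s1 (id1 A X) \<cdot> (\<langle>s0 X\<rangle> \<star> unitor p X) = unitor q X \<star> \<langle>s0 X\<rangle>)"

definition mod_composition_law :: "('o \<Rightarrow> 'b1) \<Rightarrow> ('a \<Rightarrow> 'c1) \<Rightarrow> bool" where
  "mod_composition_law s0 s1 \<longleftrightarrow> (\<forall>X Y Z f g. \<guillemotleft>f : X \<rightarrow>\<^bsub>A\<^esub> Y\<guillemotright> \<and> \<guillemotleft>g : Y \<rightarrow>\<^bsub>A\<^esub> Z\<guillemotright> \<longrightarrow>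
     s1 (g \<bullet>\<^bsub>A\<^esub> f) \<cdot> (\<langle>on1 G g \<rhd> (on1 G f \<rhd> s0 X)\<rangle> \<star> compositor p (g, f))
     = (compositor q (g, f) \<star> \<langle>(s0 Z \<lhd> on1 F g) \<lhd> on1 F f\<rangle>)
       \<cdot> (\<langle>on1 G g \<rhd> tr1 q f\<rangle> \<star> (s1 g \<lhd>\<lhd> on1 F f))
       \<cdot> ((on1 G g \<rhd>\<rhd> s1 f) \<star> \<langle>tr1 p g \<lhd> on1 F f\<rangle>))"

definition trimodification :: "('o, 'a, 'b1, 'c1) trimod \<Rightarrow> bool" where
  "trimodification s \<longleftrightarrow> md0 s \<in> extensional (Ob A) \<and> md1 s \<in> extensional (Mor A)
     \<and> mod_obj_components (md0 s)
     \<and> mod_mor_components (Mor A) (md0 s) (md1 s)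
     \<and> local_modification (Cell2 A) (md0 s) (md1 s)
     \<and> mod_unit_law (md0 s) (md1 s) \<and> mod_composition_law (md0 s) (md1 s)"

definition mod_extension :: "'a set \<Rightarrow> ('o \<Rightarrow> 'b1) \<Rightarrow> ('a \<Rightarrow> 'c1) \<Rightarrow> ('a \<Rightarrow> 'c1) \<Rightarrow> bool" where
  "mod_extension M s0 s1 S1 \<longleftrightarrow> S1 \<in> extensional (Mor A)
     \<and> (\<forall>f \<in> M. S1 f = s1 f) \<and> mod_mor_components (Mor A) s0 S1
     \<and> mod_unit_law s0 S1 \<and> mod_composition_law s0 S1"

definition perturbation_components ::
    "('o, 'a, 'b1, 'c1) trimod \<Rightarrow> ('o, 'a, 'b1, 'c1) trimod \<Rightarrow> ('o \<Rightarrow> 'c1) \<Rightarrow> bool" where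
  "perturbation_components s t \<Omega> \<longleftrightarrow> (\<forall>X \<in> Ob A. \<guillemotleft>\<Omega> X : md0 s X \<Rrightarrow> md0 t X\<guillemotright>)"

definition perturbation_axiom ::
    "'a set \<Rightarrow> ('o, 'a, 'b1, 'c1) trimod \<Rightarrow> ('o, 'a, 'b1, 'c1) trimod \<Rightarrow> ('o \<Rightarrow> 'c1) \<Rightarrow> bool" where
  "perturbation_axiom M s t \<Omega> \<longleftrightarrow> (\<forall>X Y. \<forall>f \<in> M. \<guillemotleft>f : X \<rightarrow>\<^bsub>A\<^esub> Y\<guillemotright> \<longrightarrow>
     md1 t f \<cdot> ((on1 G f \<rhd>\<rhd> \<Omega> X) \<star> \<langle>tr1 p f\<rangle>)
       = (\<langle>tr1 q f\<rangle> \<star> (\<Omega> Y \<lhd>\<lhd> on1 F f)) \<cdot> md1 s f)"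

definition perturbation ::
    "('o, 'a, 'b1, 'c1) trimod \<Rightarrow> ('o, 'a, 'b1, 'c1) trimod \<Rightarrow> ('o \<Rightarrow> 'c1) \<Rightarrow> bool" where
  "perturbation s t \<Omega> \<longleftrightarrow> \<Omega> \<in> extensional (Ob A)
     \<and> perturbation_components s t \<Omega> \<and> perturbation_axiom (Mor A) s t \<Omega>"

end

end

end

theory Submission
  imports Defs
begin

text \<open>
  A component \<open>p\<^sub>\<phi>\<close> is a square in a hom-2-category, with \<open>p\<^sub>f\<close> and \<open>p\<^sub>g\<close> as top and bottom edges. Such
  squares (quintets) form a double category, and the interchangers are quintets which are compatible
  with both pastings. The laws for semi-strict transformations express \<open>p\<^sub>\<phi>\<close> for a composite or
  whiskered 2-cell as a pasting of quintets, so the associativity, unit and interchange laws of the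
  double category say that the cells which may serve as \<open>p\<^sub>\<phi>\<close> form a sesquicategory over the free
  sesquicategory \<open>\<AA>\<close>. The universal property of \<open>\<AA>\<close> then yields the extension. The local modification
  condition says that the \<open>\<sigma>\<^sub>f\<close> form a cylinder between two pasted quintets, and cylinders can be
  pasted as well, so the 2-cells which satisfy it are closed under all operations of the
  sesquicategory and include all 2-cells as soon as they include the generators. In the same way the
  perturbation axiom is inherited by composite morphisms.
\<close>

section \<open>Calculus in Gray-categories\<close>

text \<open>The order of the extensions is forced: the edges of the square at a 2-cell are the
  \<open>p_f\<close> for composite \<open>f\<close>, so the adjoint equivalences are extended along
  paths before any 2-cell is considered. What makes the lifting of 2-cells possible is that a
  sesquicategory has no interchange law for horizontally adjacent 2-cells: the lifted cells must
  satisfy associativity, unit laws and functoriality of whiskering, and none of these compares the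
  two orders in which adjacent 2-cells can be applied. In a Gray-category the two orders are related
  by the interchanger, a 3-cell, so compatibility with it is an instance of the assumed condition on
  3-cells. The two whiskering laws look asymmetric, since one uses an interchanger and the other an
  inverse interchanger; passing to the inverse reflects a square in its diagonal, and after this
  both laws are horizontal pastings. The universal property gives a functor into a sesquicategory of
  pairs; it is a section because its first component agrees with the given isomorphism on
  generators.\<close>

definition invertible3 :: "('o, 'a, 'b, 'c) gray \<Rightarrow> 'c \<Rightarrow> bool" where
  "invertible3 A \<Gamma> \<longleftrightarrow> (\<exists>\<Delta>. inverse3 A \<Gamma> \<Delta>)"

lemma iso3_iff: "\<guillemotleft>\<Gamma> : \<phi> \<cong>\<^bsub>A\<^esub> \<psi>\<guillemotright> \<longleftrightarrow> \<guillemotleft>\<Gamma> : \<phi> \<Rrightarrow>\<^bsub>A\<^esub> \<psi>\<guillemotright> \<and> invertible3 A \<Gamma>"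
  by (simp add: iso3_def invertible3_def)

text \<open>Operations and boundaries of \<open>hom A X Y\<close> do not depend on \<open>X\<close>
  and \<open>Y\<close>; only its carriers do. Hence each law of a hom-2-category, or of composition
  as a quasi-functor, can be restated for cells of \<open>A\<close> with equations between sources
  and targets as side conditions, which the simplifier discharges.\<close>

lemma hom_simps [simp]:
  "tid (hom A X Y) = id2 A" "tcomp (hom A X Y) = vcomp2 A" "tidc (hom A X Y) = id3 A"
  "tvcomp (hom A X Y) = vcomp3 A" "thcomp (hom A X Y) = hcomp3 A"
  "tdom (hom A X Y) = src1 A" "tcod (hom A X Y) = tgt1 A"
  "tsrc (hom A X Y) = src2 A" "ttgt (hom A X Y) = tgt2 A"
  by (simp_all add: hom_def)

context gray_category
begin

lemma tObj_hom [simp]: "f \<in> tObj (hom A X Y) \<longleftrightarrow> f \<in> Mor A \<and> src0 A f = X \<and> tgt0 A f = Y"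
  by (simp add: hom_def in1_def)

lemma tArr_hom [simp]: "\<alpha> \<in> tArr (hom A X Y) \<longleftrightarrow> \<alpha> \<in> Cell2 A \<and> src0 A (src1 A \<alpha>) = X \<and> tgt0 A (src1 A \<alpha>) = Y"
  using cell2_ends by (auto simp add: hom_def in1_def)

lemma tCell_hom [simp]: "\<Gamma> \<in> tCell (hom A X Y) \<longleftrightarrow>
    \<Gamma> \<in> Cell3 A \<and> src0 A (src1 A (src2 A \<Gamma>)) = X \<and> tgt0 A (src1 A (src2 A \<Gamma>)) = Y"
  using cell2_ends cell3_ends by (auto simp add: hom_def in1_def)

lemma tin1_hom [simp]: "tin1 (hom A X Y) \<alpha> f g \<longleftrightarrow>
    \<alpha> \<in> Cell2 A \<and> src0 A (src1 A \<alpha>) = X \<and> tgt0 A (src1 A \<alpha>) = Y \<and> src1 A \<alpha> = f \<and> tgt1 A \<alpha> = g"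
  by (auto simp: tin1_def)

lemma tin2_hom [simp]: "tin2 (hom A X Y) \<Gamma> u v \<longleftrightarrow> \<Gamma> \<in> Cell3 A \<and>
    src0 A (src1 A (src2 A \<Gamma>)) = X \<and> tgt0 A (src1 A (src2 A \<Gamma>)) = Y \<and> src2 A \<Gamma> = u \<and> tgt2 A \<Gamma> = v"
  by (auto simp: tin2_def)

lemma ob_ends [simp]: "f \<in> Mor A \<Longrightarrow> src0 A f \<in> Ob A" "f \<in> Mor A \<Longrightarrow> tgt0 A f \<in> Ob A"
  using mor_ends by auto

text \<open>Orientation: the endpoints of a target are rewritten to those of the source, so that
  side conditions are normalised to statements about \<open>src1\<close>.\<close>

lemma mor_ends2 [simp]: "\<alpha> \<in> Cell2 A \<Longrightarrow> src1 A \<alpha> \<in> Mor A" "\<alpha> \<in> Cell2 A \<Longrightarrow> tgt1 A \<alpha> \<in> Mor A"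
  "\<alpha> \<in> Cell2 A \<Longrightarrow> src0 A (tgt1 A \<alpha>) = src0 A (src1 A \<alpha>)"
  "\<alpha> \<in> Cell2 A \<Longrightarrow> tgt0 A (tgt1 A \<alpha>) = tgt0 A (src1 A \<alpha>)"
  using cell2_ends by auto

lemma cell_ends3 [simp]: "\<Gamma> \<in> Cell3 A \<Longrightarrow> src2 A \<Gamma> \<in> Cell2 A" "\<Gamma> \<in> Cell3 A \<Longrightarrow> tgt2 A \<Gamma> \<in> Cell2 A"
  "\<Gamma> \<in> Cell3 A \<Longrightarrow> src1 A (tgt2 A \<Gamma>) = src1 A (src2 A \<Gamma>)"
  "\<Gamma> \<in> Cell3 A \<Longrightarrow> tgt1 A (tgt2 A \<Gamma>) = tgt1 A (src2 A \<Gamma>)"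
  using cell3_ends by auto

lemma id1_ends [simp]: assumes "X \<in> Ob A"
  shows "id1 A X \<in> Mor A" "src0 A (id1 A X) = X" "tgt0 A (id1 A X) = X"
  using id1_in[OF assms] by (auto simp: in1_def)

lemma quasi: "\<lbrakk>f \<in> Mor A; g \<in> Mor A; tgt0 A f = src0 A g\<rbrakk> \<Longrightarrow>
  gray_quasifunctor (hom A (src0 A g) (tgt0 A g)) (hom A (src0 A f) (src0 A g)) (hom A (src0 A f) (tgt0 A g))
            (comp1 A) (whr2 A) (whl2 A) (whr3 A) (whl3 A) (interch A)"
  by (rule comp_quasifunctor) auto

lemma comp1_ends [simp]: assumes "f \<in> Mor A" "g \<in> Mor A" "tgt0 A f = src0 A g"
  shows "g \<bullet> f \<in> Mor A" "src0 A (g \<bullet> f) = src0 A f" "tgt0 A (g \<bullet> f) = tgt0 A g"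
  using two_functor.obj[OF gray_quasifunctor.functor_left[OF quasi[OF assms], of f], of g] assms by auto

lemma comp1_unit [simp]: "f \<in> Mor A \<Longrightarrow> tgt0 A f = Y \<Longrightarrow> id1 A Y \<bullet> f = f"
   "f \<in> Mor A \<Longrightarrow> src0 A f = Y \<Longrightarrow> f \<bullet> id1 A Y = f"
  using id_left1 id_right1 by (auto simp: in1_def)

lemma comp1_assoc [simp]: "\<lbrakk>f \<in> Mor A; g \<in> Mor A; h \<in> Mor A; tgt0 A f = src0 A g; tgt0 A g = src0 A h\<rbrakk>
  \<Longrightarrow> (h \<bullet> g) \<bullet> f = h \<bullet> (g \<bullet> f)"
  using assoc111 by (auto simp: in1_def)

lemma homcat: "f \<in> Mor A \<Longrightarrow> two_category (hom A (src0 A f) (tgt0 A f))"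
  by (rule hom_two_category) auto

lemma homcat2: "\<alpha> \<in> Cell2 A \<Longrightarrow> two_category (hom A (src0 A (src1 A \<alpha>)) (tgt0 A (src1 A \<alpha>)))"
  by (rule homcat) auto

lemma id2_ends [simp]: assumes "f \<in> Mor A"
  shows "id2 A f \<in> Cell2 A" "src1 A (id2 A f) = f" "tgt1 A (id2 A f) = f"
  using two_category.tid_in[OF homcat[OF assms], of f] assms by auto

lemma vcomp2_ends [simp]: assumes "\<alpha> \<in> Cell2 A" "\<beta> \<in> Cell2 A" "tgt1 A \<alpha> = src1 A \<beta>"
  shows "\<beta> \<odot> \<alpha> \<in> Cell2 A" "src1 A (\<beta> \<odot> \<alpha>) = src1 A \<alpha>" "tgt1 A (\<beta> \<odot> \<alpha>) = tgt1 A \<beta>"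
  \<comment> \<open>The matching condition turns \<open>tgt1 A \<alpha>\<close> into
    \<open>src1 A \<beta>\<close> before \<open>mor_ends2\<close> can act on it. So its instance for
    \<open>\<alpha>\<close> is inserted as a fact, and the simp rule is switched off lest it reduce
    that fact to \<open>True\<close>. The same pattern recurs below.\<close>
  using two_category.tcomp_in[OF homcat2[OF assms(1)], of \<alpha> "src1 A \<alpha>" "tgt1 A \<alpha>" \<beta> "tgt1 A \<beta>"] assms
    mor_ends2[of \<alpha>] by (auto simp del: mor_ends2)

lemma vcomp2_unit [simp]: assumes "\<alpha> \<in> Cell2 A"
  shows "tgt1 A \<alpha> = g \<Longrightarrow> id2 A g \<odot> \<alpha> = \<alpha>" "src1 A \<alpha> = f \<Longrightarrow> \<alpha> \<odot> id2 A f = \<alpha>"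
  using two_category.tcomp_id_left[OF homcat2[OF assms(1)], of \<alpha>]
   two_category.tcomp_id_right[OF homcat2[OF assms(1)], of \<alpha>] assms by auto

lemma vcomp2_assoc [simp]: "\<lbrakk>\<alpha> \<in> Cell2 A; \<beta> \<in> Cell2 A; \<gamma> \<in> Cell2 A; tgt1 A \<alpha> = src1 A \<beta>; tgt1 A \<beta> = src1 A \<gamma>\<rbrakk>
  \<Longrightarrow> (\<gamma> \<odot> \<beta>) \<odot> \<alpha> = \<gamma> \<odot> (\<beta> \<odot> \<alpha>)"
  using two_category.tcomp_assoc[OF homcat2, of \<alpha> \<alpha> "src1 A \<alpha>" "tgt1 A \<alpha>" \<beta> "tgt1 A \<beta>" \<gamma> "tgt1 A \<gamma>"]
    mor_ends2[of \<alpha>] mor_ends2[of \<beta>] by (auto simp del: mor_ends2)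

lemma whl2_functor: "g \<in> Mor A \<Longrightarrow> W \<in> Ob A \<Longrightarrow> two_functor (hom A W (src0 A g)) (hom A W (tgt0 A g)) (comp1 A g) (whl2 A g) (whl3 A g)"
  using gray_quasifunctor.functor_right[OF comp_quasifunctor, of W "src0 A g" "tgt0 A g" g] by simp

lemma whr2_functor: "f \<in> Mor A \<Longrightarrow> Z \<in> Ob A \<Longrightarrow> two_functor (hom A (tgt0 A f) Z) (hom A (src0 A f) Z) (\<lambda>g. g \<bullet> f) (\<lambda>\<beta>. \<beta> \<lhd> f) (\<lambda>\<Gamma>. \<Gamma> \<lhd>\<lhd> f)"
  using gray_quasifunctor.functor_left[OF comp_quasifunctor, of "src0 A f" "tgt0 A f" Z f] by simp

lemma whl2_ends [simp]: assumes "g \<in> Mor A" "\<alpha> \<in> Cell2 A" "tgt0 A (src1 A \<alpha>) = src0 A g"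
  shows "g \<rhd> \<alpha> \<in> Cell2 A" "src1 A (g \<rhd> \<alpha>) = g \<bullet> src1 A \<alpha>" "tgt1 A (g \<rhd> \<alpha>) = g \<bullet> tgt1 A \<alpha>"
  using two_functor.arr[OF whl2_functor[OF assms(1), of "src0 A (src1 A \<alpha>)"], of \<alpha> "src1 A \<alpha>" "tgt1 A \<alpha>"] assms
  by auto

lemma whr2_ends [simp]: assumes "f \<in> Mor A" "\<alpha> \<in> Cell2 A" "tgt0 A f = src0 A (src1 A \<alpha>)"
  shows "\<alpha> \<lhd> f \<in> Cell2 A" "src1 A (\<alpha> \<lhd> f) = src1 A \<alpha> \<bullet> f" "tgt1 A (\<alpha> \<lhd> f) = tgt1 A \<alpha> \<bullet> f"
  using two_functor.arr[OF whr2_functor[OF assms(1), of "tgt0 A (src1 A \<alpha>)"], of \<alpha> "src1 A \<alpha>" "tgt1 A \<alpha>"] assms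
  by auto

lemma whl2_id2 [simp]: "\<lbrakk>g \<in> Mor A; f \<in> Mor A; tgt0 A f = src0 A g\<rbrakk> \<Longrightarrow> g \<rhd> id2 A f = id2 A (g \<bullet> f)"
  using two_functor.tid[OF whl2_functor[of g "src0 A f"], of f] by auto

lemma whr2_id2 [simp]: "\<lbrakk>g \<in> Mor A; f \<in> Mor A; tgt0 A f = src0 A g\<rbrakk> \<Longrightarrow> id2 A g \<lhd> f = id2 A (g \<bullet> f)"
  using two_functor.tid[OF whr2_functor[of f "tgt0 A g"], of g] by auto

lemma whl2_vcomp2 [simp]: "\<lbrakk>g \<in> Mor A; \<alpha> \<in> Cell2 A; \<alpha>' \<in> Cell2 A; tgt0 A (src1 A \<alpha>) = src0 A g; tgt1 A \<alpha> = src1 A \<alpha>'\<rbrakk>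
  \<Longrightarrow> g \<rhd> (\<alpha>' \<odot> \<alpha>) = (g \<rhd> \<alpha>') \<odot> (g \<rhd> \<alpha>)"
  using two_functor.tcomp[OF whl2_functor[of g "src0 A (src1 A \<alpha>)"], of \<alpha> "src1 A \<alpha>" "tgt1 A \<alpha>" \<alpha>' "tgt1 A \<alpha>'"]
    mor_ends2[of \<alpha>] by (auto simp del: mor_ends2 intro: ob_ends mor_ends2)

lemma whr2_vcomp2 [simp]: "\<lbrakk>g \<in> Mor A; \<alpha> \<in> Cell2 A; \<alpha>' \<in> Cell2 A; tgt0 A g = src0 A (src1 A \<alpha>); tgt1 A \<alpha> = src1 A \<alpha>'\<rbrakk>
  \<Longrightarrow> (\<alpha>' \<odot> \<alpha>) \<lhd> g = (\<alpha>' \<lhd> g) \<odot> (\<alpha> \<lhd> g)"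
  using two_functor.tcomp[OF whr2_functor[of g "tgt0 A (src1 A \<alpha>)"], of \<alpha> "src1 A \<alpha>" "tgt1 A \<alpha>" \<alpha>' "tgt1 A \<alpha>'"]
    mor_ends2[of \<alpha>] by (auto simp del: mor_ends2 intro: ob_ends mor_ends2)

lemma wh2_id1 [simp]: "\<lbrakk>\<alpha> \<in> Cell2 A; tgt0 A (src1 A \<alpha>) = Y\<rbrakk> \<Longrightarrow> id1 A Y \<rhd> \<alpha> = \<alpha>"
  "\<lbrakk>\<alpha> \<in> Cell2 A; src0 A (src1 A \<alpha>) = X\<rbrakk> \<Longrightarrow> \<alpha> \<lhd> id1 A X = \<alpha>"
  using id_left2 id_right2 by auto

lemma wh2_assoc [simp]:
  "\<lbrakk>\<alpha> \<in> Cell2 A; g \<in> Mor A; h \<in> Mor A; tgt0 A (src1 A \<alpha>) = src0 A g; tgt0 A g = src0 A h\<rbrakk>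
    \<Longrightarrow> (h \<bullet> g) \<rhd> \<alpha> = h \<rhd> (g \<rhd> \<alpha>)"
  "\<lbrakk>f \<in> Mor A; \<alpha> \<in> Cell2 A; h \<in> Mor A; tgt0 A f = src0 A (src1 A \<alpha>); tgt0 A (src1 A \<alpha>) = src0 A h\<rbrakk>
    \<Longrightarrow> (h \<rhd> \<alpha>) \<lhd> f = h \<rhd> (\<alpha> \<lhd> f)"
  "\<lbrakk>f \<in> Mor A; \<alpha> \<in> Cell2 A; g \<in> Mor A; tgt0 A f = src0 A g; tgt0 A g = src0 A (src1 A \<alpha>)\<rbrakk>
    \<Longrightarrow> (\<alpha> \<lhd> g) \<lhd> f = \<alpha> \<lhd> (g \<bullet> f)"
  using assoc112 assoc121 assoc211 by (auto simp: in1_def)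

section \<open>3-cells: vertical and horizontal composition, whiskering\<close>

lemma homcat3: "\<Gamma> \<in> Cell3 A \<Longrightarrow> two_category (hom A (src0 A (src1 A (src2 A \<Gamma>))) (tgt0 A (src1 A (src2 A \<Gamma>))))"
  by (rule homcat2) auto

lemma id3_ends [simp]: assumes "\<alpha> \<in> Cell2 A"
  shows "\<langle>\<alpha>\<rangle> \<in> Cell3 A" "src2 A \<langle>\<alpha>\<rangle> = \<alpha>" "tgt2 A \<langle>\<alpha>\<rangle> = \<alpha>"
  using two_category.tidc_in[OF homcat2[OF assms], of \<alpha>] assms by auto

lemma vcomp3_ends [simp]: assumes "\<Gamma> \<in> Cell3 A" "\<Delta> \<in> Cell3 A" "tgt2 A \<Gamma> = src2 A \<Delta>"
  shows "\<Delta> \<cdot> \<Gamma> \<in> Cell3 A" "src2 A (\<Delta> \<cdot> \<Gamma>) = src2 A \<Gamma>" "tgt2 A (\<Delta> \<cdot> \<Gamma>) = tgt2 A \<Delta>"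
  using two_category.tvcomp_in[OF homcat3[OF assms(1)], of \<Gamma> "src2 A \<Gamma>" "tgt2 A \<Gamma>" \<Delta> "tgt2 A \<Delta>"] assms
    cell_ends3[of \<Gamma>] by (auto simp del: cell_ends3)

lemma vcomp3_unit [simp]: assumes "\<Gamma> \<in> Cell3 A"
  shows "tgt2 A \<Gamma> = \<psi> \<Longrightarrow> \<langle>\<psi>\<rangle> \<cdot> \<Gamma> = \<Gamma>" "src2 A \<Gamma> = \<phi> \<Longrightarrow> \<Gamma> \<cdot> \<langle>\<phi>\<rangle> = \<Gamma>"
  using two_category.tvcomp_id_left[OF homcat3[OF assms(1)], of \<Gamma>]
   two_category.tvcomp_id_right[OF homcat3[OF assms(1)], of \<Gamma>] assms by auto

lemma vcomp3_assoc [simp]: "\<lbrakk>\<Gamma> \<in> Cell3 A; \<Delta> \<in> Cell3 A; \<Theta> \<in> Cell3 A; tgt2 A \<Gamma> = src2 A \<Delta>; tgt2 A \<Delta> = src2 A \<Theta>\<rbrakk>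
  \<Longrightarrow> (\<Theta> \<cdot> \<Delta>) \<cdot> \<Gamma> = \<Theta> \<cdot> (\<Delta> \<cdot> \<Gamma>)"
  using two_category.tvcomp_assoc[OF homcat3, of \<Gamma> \<Gamma> "src2 A \<Gamma>" "tgt2 A \<Gamma>" \<Delta> "tgt2 A \<Delta>" \<Theta> "tgt2 A \<Theta>"]
    cell_ends3[of \<Gamma>] cell_ends3[of \<Delta>] by (auto simp del: cell_ends3)

lemma hcomp3_ends [simp]: assumes "\<Gamma> \<in> Cell3 A" "\<Delta> \<in> Cell3 A" "tgt1 A (src2 A \<Gamma>) = src1 A (src2 A \<Delta>)"
  shows "\<Delta> \<star> \<Gamma> \<in> Cell3 A" "src2 A (\<Delta> \<star> \<Gamma>) = src2 A \<Delta> \<odot> src2 A \<Gamma>" "tgt2 A (\<Delta> \<star> \<Gamma>) = tgt2 A \<Delta> \<odot> tgt2 A \<Gamma>"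
  using two_category.thcomp_in[OF homcat3[OF assms(1)], of \<Gamma> "src2 A \<Gamma>" "tgt2 A \<Gamma>" \<Delta> "src2 A \<Delta>" "tgt2 A \<Delta>"] assms
    mor_ends2[of "src2 A \<Gamma>"] by (auto simp del: mor_ends2)

lemma hcomp3_unit [simp]: assumes "\<Gamma> \<in> Cell3 A"
  shows "tgt1 A (src2 A \<Gamma>) = g \<Longrightarrow> \<langle>id2 A g\<rangle> \<star> \<Gamma> = \<Gamma>" "src1 A (src2 A \<Gamma>) = f \<Longrightarrow> \<Gamma> \<star> \<langle>id2 A f\<rangle> = \<Gamma>"
  using two_category.thcomp_id_left[OF homcat3[OF assms(1)], of \<Gamma>]
   two_category.thcomp_id_right[OF homcat3[OF assms(1)], of \<Gamma>] assms by auto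

lemma hcomp3_assoc [simp]: "\<lbrakk>\<Gamma> \<in> Cell3 A; \<Delta> \<in> Cell3 A; \<Theta> \<in> Cell3 A;
   tgt1 A (src2 A \<Gamma>) = src1 A (src2 A \<Delta>); tgt1 A (src2 A \<Delta>) = src1 A (src2 A \<Theta>)\<rbrakk>
  \<Longrightarrow> (\<Theta> \<star> \<Delta>) \<star> \<Gamma> = \<Theta> \<star> (\<Delta> \<star> \<Gamma>)"
  using two_category.thcomp_assoc[OF homcat3, of \<Gamma> \<Gamma> "src2 A \<Gamma>" "tgt2 A \<Gamma>" \<Delta> "src2 A \<Delta>" "tgt2 A \<Delta>" \<Theta> "src2 A \<Theta>" "tgt2 A \<Theta>"]
    mor_ends2[of "src2 A \<Gamma>"] mor_ends2[of "src2 A \<Delta>"] by (auto simp del: mor_ends2)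

lemma hcomp3_id3 [simp]: "\<lbrakk>\<alpha> \<in> Cell2 A; \<beta> \<in> Cell2 A; tgt1 A \<alpha> = src1 A \<beta>\<rbrakk> \<Longrightarrow> \<langle>\<beta>\<rangle> \<star> \<langle>\<alpha>\<rangle> = \<langle>\<beta> \<odot> \<alpha>\<rangle>"
  using two_category.thcomp_tidc[OF homcat2, of \<alpha> \<alpha> "src1 A \<alpha>" "tgt1 A \<alpha>" \<beta> "tgt1 A \<beta>"]
    mor_ends2[of \<alpha>] by (auto simp del: mor_ends2)

text \<open>Right-nested companion of \<open>hcomp3_id3\<close>: horizontal composites are
  normalised to the right, so consecutive whiskerings by 2-cells have to be fused in this
  form.\<close>

lemma hcomp3_id3_id3 [simp]: "\<lbrakk>\<Gamma> \<in> Cell3 A; \<alpha> \<in> Cell2 A; \<beta> \<in> Cell2 A; tgt1 A \<alpha> = src1 A \<beta>; tgt1 A (src2 A \<Gamma>) = src1 A \<alpha>\<rbrakk>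
  \<Longrightarrow> \<langle>\<beta>\<rangle> \<star> (\<langle>\<alpha>\<rangle> \<star> \<Gamma>) = \<langle>\<beta> \<odot> \<alpha>\<rangle> \<star> \<Gamma>"
  by (subst hcomp3_assoc[symmetric]) (auto simp del: hcomp3_assoc)

lemma interchange3: "\<lbrakk>\<Gamma> \<in> Cell3 A; \<Gamma>' \<in> Cell3 A; \<Delta> \<in> Cell3 A; \<Delta>' \<in> Cell3 A;
   tgt2 A \<Gamma> = src2 A \<Gamma>'; tgt2 A \<Delta> = src2 A \<Delta>'; tgt1 A (src2 A \<Gamma>) = src1 A (src2 A \<Delta>)\<rbrakk>
  \<Longrightarrow> (\<Delta>' \<cdot> \<Delta>) \<star> (\<Gamma>' \<cdot> \<Gamma>) = (\<Delta>' \<star> \<Gamma>') \<cdot> (\<Delta> \<star> \<Gamma>)"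
  using two_category.interchange[OF homcat3, of \<Gamma> \<Gamma> "src2 A \<Gamma>" "tgt2 A \<Gamma>" \<Gamma>' "tgt2 A \<Gamma>'" \<Delta> "src2 A \<Delta>" "tgt2 A \<Delta>" \<Delta>' "tgt2 A \<Delta>'"]
    mor_ends2[of "src2 A \<Gamma>"] cell_ends3[of \<Gamma>] cell_ends3[of \<Delta>] by (auto simp del: mor_ends2 cell_ends3)

lemma hcomp3_vcomp3 [simp]:
  "\<lbrakk>\<Gamma> \<in> Cell3 A; \<Gamma>' \<in> Cell3 A; \<alpha> \<in> Cell2 A; tgt2 A \<Gamma> = src2 A \<Gamma>'; tgt1 A (src2 A \<Gamma>) = src1 A \<alpha>\<rbrakk>
    \<Longrightarrow> \<langle>\<alpha>\<rangle> \<star> (\<Gamma>' \<cdot> \<Gamma>) = (\<langle>\<alpha>\<rangle> \<star> \<Gamma>') \<cdot> (\<langle>\<alpha>\<rangle> \<star> \<Gamma>)"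
  "\<lbrakk>\<Gamma> \<in> Cell3 A; \<Gamma>' \<in> Cell3 A; \<alpha> \<in> Cell2 A; tgt2 A \<Gamma> = src2 A \<Gamma>'; tgt1 A \<alpha> = src1 A (src2 A \<Gamma>)\<rbrakk>
    \<Longrightarrow> (\<Gamma>' \<cdot> \<Gamma>) \<star> \<langle>\<alpha>\<rangle> = (\<Gamma>' \<star> \<langle>\<alpha>\<rangle>) \<cdot> (\<Gamma> \<star> \<langle>\<alpha>\<rangle>)"
  using interchange3[of \<Gamma> \<Gamma>' "\<langle>\<alpha>\<rangle>" "\<langle>\<alpha>\<rangle>"] interchange3[of "\<langle>\<alpha>\<rangle>" "\<langle>\<alpha>\<rangle>" \<Gamma> \<Gamma>'] by auto

text \<open>Both sides equal \<open>\<Delta> \<star> \<Gamma>\<close>. The equation has no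
  terminating orientation for the simplifier, so later proofs invoke it by hand exactly where two
  independent 3-cells trade places.\<close>

lemma interchange_swap:
  assumes "\<Gamma> \<in> Cell3 A" "\<Delta> \<in> Cell3 A" "tgt1 A (src2 A \<Gamma>) = src1 A (src2 A \<Delta>)"
  shows "(\<langle>tgt2 A \<Delta>\<rangle> \<star> \<Gamma>) \<cdot> (\<Delta> \<star> \<langle>src2 A \<Gamma>\<rangle>) = (\<Delta> \<star> \<langle>tgt2 A \<Gamma>\<rangle>) \<cdot> (\<langle>src2 A \<Delta>\<rangle> \<star> \<Gamma>)"
  using interchange3[of "\<langle>src2 A \<Gamma>\<rangle>" \<Gamma> \<Delta> "\<langle>tgt2 A \<Delta>\<rangle>"] interchange3[of \<Gamma> "\<langle>tgt2 A \<Gamma>\<rangle>" "\<langle>src2 A \<Delta>\<rangle>" \<Delta>] assms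
  by auto

text \<open>Vertical composites are nested to the right, so an equation between two-fold composites
  does not match inside a longer one; this version carries a tail \<open>\<Theta>\<close>. That
  \<open>\<Delta>\<close> and \<open>\<Delta>'\<close> have the same source is recovered from the
  equation itself.\<close>

lemma vcomp3_swap:
  assumes "\<Gamma> \<cdot> \<Delta> = \<Gamma>' \<cdot> \<Delta>'" "\<Gamma> \<in> Cell3 A" "\<Delta> \<in> Cell3 A" "\<Gamma>' \<in> Cell3 A" "\<Delta>' \<in> Cell3 A" "\<Theta> \<in> Cell3 A"
    "tgt2 A \<Delta> = src2 A \<Gamma>" "tgt2 A \<Delta>' = src2 A \<Gamma>'" "tgt2 A \<Theta> = src2 A \<Delta>"
  shows "\<Gamma> \<cdot> (\<Delta> \<cdot> \<Theta>) = \<Gamma>' \<cdot> (\<Delta>' \<cdot> \<Theta>)"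
proof -
  have "src2 A (\<Gamma> \<cdot> \<Delta>) = src2 A (\<Gamma>' \<cdot> \<Delta>')" by (simp only: assms(1))
  then have "src2 A \<Delta> = src2 A \<Delta>'" using assms(2-) by simp
  then show ?thesis using assms vcomp3_assoc[of \<Theta> \<Delta> \<Gamma>] vcomp3_assoc[of \<Theta> \<Delta>' \<Gamma>'] by simp
qed

lemma whl3_ends [simp]: assumes "g \<in> Mor A" "\<Gamma> \<in> Cell3 A" "tgt0 A (src1 A (src2 A \<Gamma>)) = src0 A g"
  shows "g \<rhd>\<rhd> \<Gamma> \<in> Cell3 A" "src2 A (g \<rhd>\<rhd> \<Gamma>) = g \<rhd> src2 A \<Gamma>" "tgt2 A (g \<rhd>\<rhd> \<Gamma>) = g \<rhd> tgt2 A \<Gamma>"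
  using two_functor.cell[OF whl2_functor[OF assms(1), of "src0 A (src1 A (src2 A \<Gamma>))"], of \<Gamma> "src2 A \<Gamma>" "tgt2 A \<Gamma>"] assms
  by auto

lemma whr3_ends [simp]: assumes "f \<in> Mor A" "\<Gamma> \<in> Cell3 A" "tgt0 A f = src0 A (src1 A (src2 A \<Gamma>))"
  shows "\<Gamma> \<lhd>\<lhd> f \<in> Cell3 A" "src2 A (\<Gamma> \<lhd>\<lhd> f) = src2 A \<Gamma> \<lhd> f" "tgt2 A (\<Gamma> \<lhd>\<lhd> f) = tgt2 A \<Gamma> \<lhd> f"
  using two_functor.cell[OF whr2_functor[OF assms(1), of "tgt0 A (src1 A (src2 A \<Gamma>))"], of \<Gamma> "src2 A \<Gamma>" "tgt2 A \<Gamma>"] assms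
  by auto

lemma whl3_id3 [simp]: "\<lbrakk>g \<in> Mor A; \<alpha> \<in> Cell2 A; tgt0 A (src1 A \<alpha>) = src0 A g\<rbrakk> \<Longrightarrow> g \<rhd>\<rhd> \<langle>\<alpha>\<rangle> = \<langle>g \<rhd> \<alpha>\<rangle>"
  using two_functor.tidc[OF whl2_functor[of g "src0 A (src1 A \<alpha>)"], of \<alpha>] by auto

lemma whr3_id3 [simp]: "\<lbrakk>g \<in> Mor A; \<alpha> \<in> Cell2 A; tgt0 A g = src0 A (src1 A \<alpha>)\<rbrakk> \<Longrightarrow> \<langle>\<alpha>\<rangle> \<lhd>\<lhd> g = \<langle>\<alpha> \<lhd> g\<rangle>"
  using two_functor.tidc[OF whr2_functor[of g "tgt0 A (src1 A \<alpha>)"], of \<alpha>] by auto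

lemma whl3_vcomp3 [simp]: "\<lbrakk>g \<in> Mor A; \<Gamma> \<in> Cell3 A; \<Gamma>' \<in> Cell3 A; tgt0 A (src1 A (src2 A \<Gamma>)) = src0 A g; tgt2 A \<Gamma> = src2 A \<Gamma>'\<rbrakk>
  \<Longrightarrow> g \<rhd>\<rhd> (\<Gamma>' \<cdot> \<Gamma>) = (g \<rhd>\<rhd> \<Gamma>') \<cdot> (g \<rhd>\<rhd> \<Gamma>)"
  using two_functor.tvcomp[OF whl2_functor[of g "src0 A (src1 A (src2 A \<Gamma>))"], of \<Gamma> "src2 A \<Gamma>" "tgt2 A \<Gamma>" \<Gamma>' "tgt2 A \<Gamma>'"]
    cell_ends3[of \<Gamma>] by (auto simp del: cell_ends3 intro: ob_ends mor_ends2)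

lemma whr3_vcomp3 [simp]: "\<lbrakk>g \<in> Mor A; \<Gamma> \<in> Cell3 A; \<Gamma>' \<in> Cell3 A; tgt0 A g = src0 A (src1 A (src2 A \<Gamma>)); tgt2 A \<Gamma> = src2 A \<Gamma>'\<rbrakk>
  \<Longrightarrow> (\<Gamma>' \<cdot> \<Gamma>) \<lhd>\<lhd> g = (\<Gamma>' \<lhd>\<lhd> g) \<cdot> (\<Gamma> \<lhd>\<lhd> g)"
  using two_functor.tvcomp[OF whr2_functor[of g "tgt0 A (src1 A (src2 A \<Gamma>))"], of \<Gamma> "src2 A \<Gamma>" "tgt2 A \<Gamma>" \<Gamma>' "tgt2 A \<Gamma>'"]
    cell_ends3[of \<Gamma>] by (auto simp del: cell_ends3 intro: ob_ends mor_ends2)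

lemma whl3_hcomp3 [simp]: "\<lbrakk>g \<in> Mor A; \<Gamma> \<in> Cell3 A; \<Delta> \<in> Cell3 A; tgt0 A (src1 A (src2 A \<Gamma>)) = src0 A g;
    tgt1 A (src2 A \<Gamma>) = src1 A (src2 A \<Delta>)\<rbrakk> \<Longrightarrow> g \<rhd>\<rhd> (\<Delta> \<star> \<Gamma>) = (g \<rhd>\<rhd> \<Delta>) \<star> (g \<rhd>\<rhd> \<Gamma>)"
  using two_functor.thcomp[OF whl2_functor[of g "src0 A (src1 A (src2 A \<Gamma>))"], of \<Gamma> "src2 A \<Gamma>" "tgt2 A \<Gamma>" \<Delta> "src2 A \<Delta>" "tgt2 A \<Delta>"]
    mor_ends2[of "src2 A \<Gamma>"] by (auto simp del: mor_ends2 intro: ob_ends mor_ends2(1,2))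

lemma whr3_hcomp3 [simp]: "\<lbrakk>g \<in> Mor A; \<Gamma> \<in> Cell3 A; \<Delta> \<in> Cell3 A; tgt0 A g = src0 A (src1 A (src2 A \<Gamma>));
    tgt1 A (src2 A \<Gamma>) = src1 A (src2 A \<Delta>)\<rbrakk> \<Longrightarrow> (\<Delta> \<star> \<Gamma>) \<lhd>\<lhd> g = (\<Delta> \<lhd>\<lhd> g) \<star> (\<Gamma> \<lhd>\<lhd> g)"
  using two_functor.thcomp[OF whr2_functor[of g "tgt0 A (src1 A (src2 A \<Gamma>))"], of \<Gamma> "src2 A \<Gamma>" "tgt2 A \<Gamma>" \<Delta> "src2 A \<Delta>" "tgt2 A \<Delta>"]
    mor_ends2[of "src2 A \<Gamma>"] by (auto simp del: mor_ends2 intro: ob_ends mor_ends2(1,2))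

lemma wh3_id1 [simp]: "\<lbrakk>\<Gamma> \<in> Cell3 A; tgt0 A (src1 A (src2 A \<Gamma>)) = Y\<rbrakk> \<Longrightarrow> id1 A Y \<rhd>\<rhd> \<Gamma> = \<Gamma>"
  "\<lbrakk>\<Gamma> \<in> Cell3 A; src0 A (src1 A (src2 A \<Gamma>)) = X\<rbrakk> \<Longrightarrow> \<Gamma> \<lhd>\<lhd> id1 A X = \<Gamma>"
  using id_left3 id_right3 by auto

lemma wh3_assoc [simp]:
  "\<lbrakk>\<Gamma> \<in> Cell3 A; g \<in> Mor A; h \<in> Mor A; tgt0 A (src1 A (src2 A \<Gamma>)) = src0 A g; tgt0 A g = src0 A h\<rbrakk>
    \<Longrightarrow> (h \<bullet> g) \<rhd>\<rhd> \<Gamma> = h \<rhd>\<rhd> (g \<rhd>\<rhd> \<Gamma>)"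
  "\<lbrakk>f \<in> Mor A; \<Gamma> \<in> Cell3 A; h \<in> Mor A; tgt0 A f = src0 A (src1 A (src2 A \<Gamma>)); tgt0 A (src1 A (src2 A \<Gamma>)) = src0 A h\<rbrakk>
    \<Longrightarrow> (h \<rhd>\<rhd> \<Gamma>) \<lhd>\<lhd> f = h \<rhd>\<rhd> (\<Gamma> \<lhd>\<lhd> f)"
  "\<lbrakk>f \<in> Mor A; \<Gamma> \<in> Cell3 A; g \<in> Mor A; tgt0 A f = src0 A g; tgt0 A g = src0 A (src1 A (src2 A \<Gamma>))\<rbrakk>
    \<Longrightarrow> (\<Gamma> \<lhd>\<lhd> g) \<lhd>\<lhd> f = \<Gamma> \<lhd>\<lhd> (g \<bullet> f)"
  using assoc113 assoc131 assoc311 by (auto simp: in1_def)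

section \<open>Inverses of 3-cells\<close>

lemma inverse3_unique: assumes "inverse3 A \<Gamma> \<Delta>" "inverse3 A \<Gamma> \<Delta>'" shows "\<Delta> = \<Delta>'"
proof -
  have "\<Delta> = \<Delta> \<cdot> (\<Gamma> \<cdot> \<Delta>')" using assms by (auto simp: inverse3_def in3_def)
  also have "\<dots> = (\<Delta> \<cdot> \<Gamma>) \<cdot> \<Delta>'" using assms by (subst vcomp3_assoc) (auto simp: inverse3_def in3_def)
  also have "\<dots> = \<Delta>'" using assms by (auto simp: inverse3_def in3_def)
  finally show ?thesis .
qed

text \<open>Uniqueness of inverses makes the definite description in \<open>inv3\<close> denote.
  Afterwards an inverse is always exhibited explicitly, and both invertibility and the value of
  \<open>inv3\<close> are read off from it.\<close>

lemma inverse3_inv3: "invertible3 A \<Gamma> \<Longrightarrow> inverse3 A \<Gamma> (inv3 A \<Gamma>)"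
  unfolding invertible3_def inv3_def by (rule theI') (auto intro: inverse3_unique)

lemma inv3_eqI: "inverse3 A \<Gamma> \<Delta> \<Longrightarrow> inv3 A \<Gamma> = \<Delta>"
  using inverse3_unique inverse3_inv3 unfolding invertible3_def by blast

lemma invertible3I: "inverse3 A \<Gamma> \<Delta> \<Longrightarrow> invertible3 A \<Gamma>"
  unfolding invertible3_def by blast

lemma inv3_ends [simp]: assumes "invertible3 A \<Gamma>"
  shows "inv3 A \<Gamma> \<in> Cell3 A" "src2 A (inv3 A \<Gamma>) = tgt2 A \<Gamma>" "tgt2 A (inv3 A \<Gamma>) = src2 A \<Gamma>"
  using inverse3_inv3[OF assms] by (auto simp: inverse3_def in3_def)

lemma inv3_inverse [simp]: assumes "invertible3 A \<Gamma>"
  shows "inv3 A \<Gamma> \<cdot> \<Gamma> = \<langle>src2 A \<Gamma>\<rangle>" "\<Gamma> \<cdot> inv3 A \<Gamma> = \<langle>tgt2 A \<Gamma>\<rangle>"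
  using inverse3_inv3[OF assms] by (auto simp: inverse3_def in3_def)

lemma invertible3_in: "invertible3 A \<Gamma> \<Longrightarrow> \<Gamma> \<in> Cell3 A"
  by (auto simp: inverse3_def invertible3_def)

lemma inv3_inverse_assoc [simp]: assumes "invertible3 A \<Gamma>" "\<Theta> \<in> Cell3 A"
  shows "tgt2 A \<Theta> = src2 A \<Gamma> \<Longrightarrow> inv3 A \<Gamma> \<cdot> (\<Gamma> \<cdot> \<Theta>) = \<Theta>" "tgt2 A \<Theta> = tgt2 A \<Gamma> \<Longrightarrow> \<Gamma> \<cdot> (inv3 A \<Gamma> \<cdot> \<Theta>) = \<Theta>"
  by (subst vcomp3_assoc[symmetric]; use invertible3_in[of \<Gamma>] assms in simp)+

lemma inverse3_id3: "\<alpha> \<in> Cell2 A \<Longrightarrow> inverse3 A \<langle>\<alpha>\<rangle> \<langle>\<alpha>\<rangle>"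
  by (simp add: inverse3_def in3_def)

lemma invertible3_id3 [simp]: "\<alpha> \<in> Cell2 A \<Longrightarrow> invertible3 A \<langle>\<alpha>\<rangle>"
  and inv3_id3 [simp]: "\<alpha> \<in> Cell2 A \<Longrightarrow> inv3 A \<langle>\<alpha>\<rangle> = \<langle>\<alpha>\<rangle>"
  by (auto intro: invertible3I inv3_eqI inverse3_id3)

lemma inverse3_sym: "inverse3 A \<Gamma> \<Delta> \<Longrightarrow> inverse3 A \<Delta> \<Gamma>"
  by (simp add: inverse3_def in3_def)

lemma invertible3_inv3 [simp]: "invertible3 A \<Gamma> \<Longrightarrow> invertible3 A (inv3 A \<Gamma>)"
  and inv3_inv3 [simp]: "invertible3 A \<Gamma> \<Longrightarrow> inv3 A (inv3 A \<Gamma>) = \<Gamma>"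
  by (blast intro: invertible3I inv3_eqI inverse3_sym inverse3_inv3)+

context
  fixes \<Gamma> \<Delta> assumes \<Gamma>: "invertible3 A \<Gamma>" and \<Delta>: "invertible3 A \<Delta>"
begin

lemma inverse3_vcomp3: "tgt2 A \<Gamma> = src2 A \<Delta> \<Longrightarrow> inverse3 A (\<Delta> \<cdot> \<Gamma>) (inv3 A \<Gamma> \<cdot> inv3 A \<Delta>)"
  using \<Gamma> \<Delta> invertible3_in[OF \<Gamma>] invertible3_in[OF \<Delta>] by (simp add: inverse3_def in3_def)

lemma invertible3_vcomp3 [simp]: "tgt2 A \<Gamma> = src2 A \<Delta> \<Longrightarrow> invertible3 A (\<Delta> \<cdot> \<Gamma>)"
  and inv3_vcomp3 [simp]: "tgt2 A \<Gamma> = src2 A \<Delta> \<Longrightarrow> inv3 A (\<Delta> \<cdot> \<Gamma>) = inv3 A \<Gamma> \<cdot> inv3 A \<Delta>"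
  by (auto intro: invertible3I inv3_eqI inverse3_vcomp3)

lemma inverse3_hcomp3: "tgt1 A (src2 A \<Gamma>) = src1 A (src2 A \<Delta>) \<Longrightarrow> inverse3 A (\<Delta> \<star> \<Gamma>) (inv3 A \<Delta> \<star> inv3 A \<Gamma>)"
  using \<Gamma> \<Delta> invertible3_in[OF \<Gamma>] invertible3_in[OF \<Delta>]
  by (auto simp add: inverse3_def in3_def interchange3[symmetric])

lemma invertible3_hcomp3 [simp]: "tgt1 A (src2 A \<Gamma>) = src1 A (src2 A \<Delta>) \<Longrightarrow> invertible3 A (\<Delta> \<star> \<Gamma>)"
  and inv3_hcomp3 [simp]: "tgt1 A (src2 A \<Gamma>) = src1 A (src2 A \<Delta>) \<Longrightarrow> inv3 A (\<Delta> \<star> \<Gamma>) = inv3 A \<Delta> \<star> inv3 A \<Gamma>"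
  by (auto intro: invertible3I inv3_eqI inverse3_hcomp3)

end

lemma inverse3_whl3: assumes "g \<in> Mor A" "invertible3 A \<Gamma>" "tgt0 A (src1 A (src2 A \<Gamma>)) = src0 A g"
  shows "inverse3 A (g \<rhd>\<rhd> \<Gamma>) (g \<rhd>\<rhd> inv3 A \<Gamma>)"
  using assms invertible3_in[OF assms(2)] by (simp add: inverse3_def in3_def whl3_vcomp3[symmetric] del: whl3_vcomp3)

lemma invertible3_whl3 [simp]: "\<lbrakk>g \<in> Mor A; invertible3 A \<Gamma>; tgt0 A (src1 A (src2 A \<Gamma>)) = src0 A g\<rbrakk> \<Longrightarrow> invertible3 A (g \<rhd>\<rhd> \<Gamma>)"
  and inv3_whl3 [simp]: "\<lbrakk>g \<in> Mor A; invertible3 A \<Gamma>; tgt0 A (src1 A (src2 A \<Gamma>)) = src0 A g\<rbrakk> \<Longrightarrow> inv3 A (g \<rhd>\<rhd> \<Gamma>) = g \<rhd>\<rhd> inv3 A \<Gamma>"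
  by (auto intro: invertible3I inv3_eqI inverse3_whl3)

lemma inverse3_whr3: assumes "g \<in> Mor A" "invertible3 A \<Gamma>" "tgt0 A g = src0 A (src1 A (src2 A \<Gamma>))"
  shows "inverse3 A (\<Gamma> \<lhd>\<lhd> g) (inv3 A \<Gamma> \<lhd>\<lhd> g)"
  using assms invertible3_in[OF assms(2)] by (simp add: inverse3_def in3_def whr3_vcomp3[symmetric] del: whr3_vcomp3)

lemma invertible3_whr3 [simp]: "\<lbrakk>g \<in> Mor A; invertible3 A \<Gamma>; tgt0 A g = src0 A (src1 A (src2 A \<Gamma>))\<rbrakk> \<Longrightarrow> invertible3 A (\<Gamma> \<lhd>\<lhd> g)"
  and inv3_whr3 [simp]: "\<lbrakk>g \<in> Mor A; invertible3 A \<Gamma>; tgt0 A g = src0 A (src1 A (src2 A \<Gamma>))\<rbrakk> \<Longrightarrow> inv3 A (\<Gamma> \<lhd>\<lhd> g) = inv3 A \<Gamma> \<lhd>\<lhd> g"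
  by (auto intro: invertible3I inv3_eqI inverse3_whr3)

section \<open>Interchangers\<close>

lemma quasi2: assumes "\<alpha> \<in> Cell2 A" "\<beta> \<in> Cell2 A" "tgt0 A (src1 A \<alpha>) = src0 A (src1 A \<beta>)"
  shows "gray_quasifunctor (hom A (src0 A (src1 A \<beta>)) (tgt0 A (src1 A \<beta>))) (hom A (src0 A (src1 A \<alpha>)) (src0 A (src1 A \<beta>)))
    (hom A (src0 A (src1 A \<alpha>)) (tgt0 A (src1 A \<beta>)))
            (comp1 A) (whr2 A) (whl2 A) (whr3 A) (whl3 A) (interch A)"
  using quasi[of "src1 A \<alpha>" "src1 A \<beta>"] assms by simp

lemma tinverse_hom: "tinverse (hom A X Y) \<Gamma> \<Delta> \<Longrightarrow> inverse3 A \<Gamma> \<Delta>"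
  by (auto simp: tinverse_def inverse3_def in3_def)

lemma interch_ends [simp]: assumes "\<alpha> \<in> Cell2 A" "\<beta> \<in> Cell2 A" "tgt0 A (src1 A \<alpha>) = src0 A (src1 A \<beta>)"
  shows "interch A \<beta> \<alpha> \<in> Cell3 A"
    "src2 A (interch A \<beta> \<alpha>) = (tgt1 A \<beta> \<rhd> \<alpha>) \<odot> (\<beta> \<lhd> src1 A \<alpha>)"
    "tgt2 A (interch A \<beta> \<alpha>) = (\<beta> \<lhd> tgt1 A \<alpha>) \<odot> (src1 A \<beta> \<rhd> \<alpha>)"
    "invertible3 A (interch A \<beta> \<alpha>)"
proof -
  have "tiso2 (hom A (src0 A (src1 A \<alpha>)) (tgt0 A (src1 A \<beta>))) (interch A \<beta> \<alpha>)
      ((tgt1 A \<beta> \<rhd> \<alpha>) \<odot> (\<beta> \<lhd> src1 A \<alpha>)) ((\<beta> \<lhd> tgt1 A \<alpha>) \<odot> (src1 A \<beta> \<rhd> \<alpha>))"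
    using gray_quasifunctor.interchanger[OF quasi2[OF assms], of \<beta> "src1 A \<beta>" "tgt1 A \<beta>" \<alpha> "src1 A \<alpha>" "tgt1 A \<alpha>"] assms
    by simp
  then show "interch A \<beta> \<alpha> \<in> Cell3 A"
    "src2 A (interch A \<beta> \<alpha>) = (tgt1 A \<beta> \<rhd> \<alpha>) \<odot> (\<beta> \<lhd> src1 A \<alpha>)"
    "tgt2 A (interch A \<beta> \<alpha>) = (\<beta> \<lhd> tgt1 A \<alpha>) \<odot> (src1 A \<beta> \<rhd> \<alpha>)"
    "invertible3 A (interch A \<beta> \<alpha>)"
    by (auto simp: tiso2_def invertible3_def dest: tinverse_hom)
qed

lemma interch_id2_left [simp]:
  assumes "\<alpha> \<in> Cell2 A" "g \<in> Mor A" "tgt0 A (src1 A \<alpha>) = src0 A g"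
  shows "interch A (id2 A g) \<alpha> = \<langle>g \<rhd> \<alpha>\<rangle>"
proof -
  interpret gray_quasifunctor "hom A (src0 A g) (tgt0 A g)" "hom A (src0 A (src1 A \<alpha>)) (src0 A g)"
    "hom A (src0 A (src1 A \<alpha>)) (tgt0 A g)" "comp1 A" "whr2 A" "whl2 A" "whr3 A" "whl3 A" "interch A"
    using quasi[of "src1 A \<alpha>" g] assms by simp
  show ?thesis using interchanger_id_left[of g \<alpha> "src1 A \<alpha>" "tgt1 A \<alpha>"] assms by simp
qed

lemma interch_id2_right [simp]:
  assumes "\<beta> \<in> Cell2 A" "f \<in> Mor A" "tgt0 A f = src0 A (src1 A \<beta>)"
  shows "interch A \<beta> (id2 A f) = \<langle>\<beta> \<lhd> f\<rangle>"
proof -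
  interpret gray_quasifunctor "hom A (tgt0 A f) (tgt0 A (src1 A \<beta>))" "hom A (src0 A f) (tgt0 A f)"
    "hom A (src0 A f) (tgt0 A (src1 A \<beta>))" "comp1 A" "whr2 A" "whl2 A" "whr3 A" "whl3 A" "interch A"
    using quasi[of f "src1 A \<beta>"] assms by simp
  show ?thesis using interchanger_id_right[of \<beta> "src1 A \<beta>" "tgt1 A \<beta>" f] assms by simp
qed

lemma interch_vcomp2_left [simp]:
  "\<lbrakk>\<alpha> \<in> Cell2 A; \<beta> \<in> Cell2 A; \<beta>' \<in> Cell2 A; tgt1 A \<beta> = src1 A \<beta>'; tgt0 A (src1 A \<alpha>) = src0 A (src1 A \<beta>)\<rbrakk>
   \<Longrightarrow> interch A (\<beta>' \<odot> \<beta>) \<alpha> = (\<langle>\<beta>' \<lhd> tgt1 A \<alpha>\<rangle> \<star> interch A \<beta> \<alpha>) \<cdot> (interch A \<beta>' \<alpha> \<star> \<langle>\<beta> \<lhd> src1 A \<alpha>\<rangle>)"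
  using gray_quasifunctor.interchanger_comp_left[OF quasi2, of \<alpha> \<beta> \<beta> "src1 A \<beta>" "tgt1 A \<beta>" \<beta>' "tgt1 A \<beta>'" \<alpha>]
  mor_ends2[of \<beta>] by (auto simp del: mor_ends2)

lemma interch_vcomp2_right [simp]:
  "\<lbrakk>\<alpha> \<in> Cell2 A; \<beta> \<in> Cell2 A; \<alpha>' \<in> Cell2 A; tgt1 A \<alpha> = src1 A \<alpha>'; tgt0 A (src1 A \<alpha>) = src0 A (src1 A \<beta>)\<rbrakk>
   \<Longrightarrow> interch A \<beta> (\<alpha>' \<odot> \<alpha>) = (interch A \<beta> \<alpha>' \<star> \<langle>src1 A \<beta> \<rhd> \<alpha>\<rangle>) \<cdot> (\<langle>tgt1 A \<beta> \<rhd> \<alpha>'\<rangle> \<star> interch A \<beta> \<alpha>)"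
  using gray_quasifunctor.interchanger_comp_right[OF quasi2, of \<alpha> \<beta> \<beta> "src1 A \<beta>" "tgt1 A \<beta>" \<alpha> "src1 A \<alpha>" "tgt1 A \<alpha>" \<alpha>' "tgt1 A \<alpha>'"]
  mor_ends2[of \<alpha>] by (auto simp del: mor_ends2)

lemma interch_assoc [simp]:
  "\<lbrakk>\<alpha> \<in> Cell2 A; \<beta> \<in> Cell2 A; h \<in> Mor A; tgt0 A (src1 A \<alpha>) = src0 A (src1 A \<beta>); tgt0 A (src1 A \<beta>) = src0 A h\<rbrakk>
   \<Longrightarrow> interch A (h \<rhd> \<beta>) \<alpha> = h \<rhd>\<rhd> interch A \<beta> \<alpha>"
  "\<lbrakk>\<alpha> \<in> Cell2 A; \<beta> \<in> Cell2 A; h \<in> Mor A; tgt0 A (src1 A \<alpha>) = src0 A h; tgt0 A h = src0 A (src1 A \<beta>)\<rbrakk>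
   \<Longrightarrow> interch A (\<beta> \<lhd> h) \<alpha> = interch A \<beta> (h \<rhd> \<alpha>)"
  "\<lbrakk>\<alpha> \<in> Cell2 A; \<beta> \<in> Cell2 A; h \<in> Mor A; tgt0 A (src1 A \<alpha>) = src0 A (src1 A \<beta>); tgt0 A h = src0 A (src1 A \<alpha>)\<rbrakk>
   \<Longrightarrow> interch A \<beta> (\<alpha> \<lhd> h) = interch A \<beta> \<alpha> \<lhd>\<lhd> h"
  using assoc122 assoc212 assoc221 by (auto simp: in1_def)

lemma interch_natural_left:
  "\<lbrakk>\<alpha> \<in> Cell2 A; \<Gamma> \<in> Cell3 A; tgt0 A (src1 A \<alpha>) = src0 A (src1 A (src2 A \<Gamma>))\<rbrakk>
   \<Longrightarrow> interch A (tgt2 A \<Gamma>) \<alpha> \<cdot> (\<langle>tgt1 A (src2 A \<Gamma>) \<rhd> \<alpha>\<rangle> \<star> (\<Gamma> \<lhd>\<lhd> src1 A \<alpha>))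
     = ((\<Gamma> \<lhd>\<lhd> tgt1 A \<alpha>) \<star> \<langle>src1 A (src2 A \<Gamma>) \<rhd> \<alpha>\<rangle>) \<cdot> interch A (src2 A \<Gamma>) \<alpha>"
  using gray_quasifunctor.interchanger_natural_left[OF quasi2, of \<alpha> "src2 A \<Gamma>" \<Gamma> "src2 A \<Gamma>" "tgt2 A \<Gamma>" _ _ \<alpha>]
  by simp

lemma interch_natural_right:
  "\<lbrakk>\<beta> \<in> Cell2 A; \<Gamma> \<in> Cell3 A; tgt0 A (src1 A (src2 A \<Gamma>)) = src0 A (src1 A \<beta>)\<rbrakk>
   \<Longrightarrow> interch A \<beta> (tgt2 A \<Gamma>) \<cdot> ((tgt1 A \<beta> \<rhd>\<rhd> \<Gamma>) \<star> \<langle>\<beta> \<lhd> src1 A (src2 A \<Gamma>)\<rangle>)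
     = (\<langle>\<beta> \<lhd> tgt1 A (src2 A \<Gamma>)\<rangle> \<star> (src1 A \<beta> \<rhd>\<rhd> \<Gamma>)) \<cdot> interch A \<beta> (src2 A \<Gamma>)"
  using gray_quasifunctor.interchanger_natural_right[OF quasi2, of "src2 A \<Gamma>" \<beta> \<beta> _ _ \<Gamma> "src2 A \<Gamma>" "tgt2 A \<Gamma>"]
  by simp

end

section \<open>Quintets in a Gray-category\<close>

text \<open>The 3-cell alone knows only the two boundary composites. Pasting needs their
  factorisations, so all four edges are stored.\<close>

datatype ('b, 'c) quintet = Quintet (qtop: 'b) (qleft: 'b) (qbot: 'b) (qright: 'b) (qcell: 'c)

lemma quintet_eqI: "\<lbrakk>qtop P = qtop Q; qleft P = qleft Q; qbot P = qbot Q; qright P = qright Q; qcell P = qcell Q\<rbrakk> \<Longrightarrow> P = Q"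
  by (rule quintet.expand) simp

context gray_category
begin

definition is_quintet :: "('b, 'c) quintet \<Rightarrow> bool" where
  "is_quintet Q \<longleftrightarrow> qtop Q \<in> Cell2 A \<and> qleft Q \<in> Cell2 A \<and> qbot Q \<in> Cell2 A \<and> qright Q \<in> Cell2 A
     \<and> qcell Q \<in> Cell3 A
     \<and> src1 A (qleft Q) = src1 A (qtop Q) \<and> src1 A (qright Q) = tgt1 A (qtop Q)
     \<and> src1 A (qbot Q) = tgt1 A (qleft Q) \<and> tgt1 A (qright Q) = tgt1 A (qbot Q)
     \<and> src2 A (qcell Q) = qbot Q \<odot> qleft Q \<and> tgt2 A (qcell Q) = qright Q \<odot> qtop Q"

text \<open>\<open>R\<close> stands to the right of \<open>Q\<close>, along the common edge
  \<open>qleft R = qright Q\<close>; in \<open>vpaste\<close> it stands below, along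
  \<open>qtop R = qbot Q\<close>. The 3-cells run from the left-bottom composite to the top-right
  one, which fixes the order of the two factors.\<close>

definition hpaste :: "('b, 'c) quintet \<Rightarrow> ('b, 'c) quintet \<Rightarrow> ('b, 'c) quintet" where
  "hpaste R Q = Quintet (qtop R \<odot> qtop Q) (qleft Q) (qbot R \<odot> qbot Q) (qright R)
     ((qcell R \<star> \<langle>qtop Q\<rangle>) \<cdot> (\<langle>qbot R\<rangle> \<star> qcell Q))"

definition vpaste :: "('b, 'c) quintet \<Rightarrow> ('b, 'c) quintet \<Rightarrow> ('b, 'c) quintet" where
  "vpaste R Q = Quintet (qtop Q) (qleft R \<odot> qleft Q) (qbot R) (qright R \<odot> qright Q)
     ((\<langle>qright R\<rangle> \<star> qcell Q) \<cdot> (qcell R \<star> \<langle>qleft Q\<rangle>))"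

text \<open>Named after the pasting for which it is neutral: \<open>vid\<close> for
  \<open>vpaste\<close>, with identities as its left and right edges, and \<open>hid\<close> for
  \<open>hpaste\<close>.\<close>

definition vid :: "'b \<Rightarrow> ('b, 'c) quintet" where
  "vid \<alpha> = Quintet \<alpha> (id2 A (src1 A \<alpha>)) \<alpha> (id2 A (tgt1 A \<alpha>)) \<langle>\<alpha>\<rangle>"

definition hid :: "'b \<Rightarrow> ('b, 'c) quintet" where
  "hid \<alpha> = Quintet (id2 A (src1 A \<alpha>)) \<alpha> (id2 A (tgt1 A \<alpha>)) \<alpha> \<langle>\<alpha>\<rangle>"

definition wlq :: "'a \<Rightarrow> ('b, 'c) quintet \<Rightarrow> ('b, 'c) quintet" where
  "wlq g Q = Quintet (g \<rhd> qtop Q) (g \<rhd> qleft Q) (g \<rhd> qbot Q) (g \<rhd> qright Q) (g \<rhd>\<rhd> qcell Q)"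

definition wrq :: "('b, 'c) quintet \<Rightarrow> 'a \<Rightarrow> ('b, 'c) quintet" where
  "wrq Q f = Quintet (qtop Q \<lhd> f) (qleft Q \<lhd> f) (qbot Q \<lhd> f) (qright Q \<lhd> f) (qcell Q \<lhd>\<lhd> f)"

text \<open>Reflection in the diagonal. It exchanges the two boundary composites, so the 3-cell has
  to be inverted.\<close>

definition transpose :: "('b, 'c) quintet \<Rightarrow> ('b, 'c) quintet" where
  "transpose Q = Quintet (qleft Q) (qtop Q) (qright Q) (qbot Q) (inv3 A (qcell Q))"

text \<open>The inverse interchanger is the \<open>transpose\<close> of this quintet.\<close>

definition iq :: "'b \<Rightarrow> 'b \<Rightarrow> ('b, 'c) quintet" where
  "iq \<beta> \<alpha> = Quintet (src1 A \<beta> \<rhd> \<alpha>) (\<beta> \<lhd> src1 A \<alpha>) (tgt1 A \<beta> \<rhd> \<alpha>) (\<beta> \<lhd> tgt1 A \<alpha>) (interch A \<beta> \<alpha>)"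

lemma hpaste_sel [simp]: "qtop (hpaste R Q) = qtop R \<odot> qtop Q" "qleft (hpaste R Q) = qleft Q"
  "qbot (hpaste R Q) = qbot R \<odot> qbot Q" "qright (hpaste R Q) = qright R"
  by (simp_all add: hpaste_def)

lemma vpaste_sel [simp]: "qtop (vpaste R Q) = qtop Q" "qleft (vpaste R Q) = qleft R \<odot> qleft Q"
  "qbot (vpaste R Q) = qbot R" "qright (vpaste R Q) = qright R \<odot> qright Q"
  by (simp_all add: vpaste_def)

lemma vid_sel [simp]: "qtop (vid \<alpha>) = \<alpha>" "qleft (vid \<alpha>) = id2 A (src1 A \<alpha>)" "qbot (vid \<alpha>) = \<alpha>"
  "qright (vid \<alpha>) = id2 A (tgt1 A \<alpha>)" "qcell (vid \<alpha>) = \<langle>\<alpha>\<rangle>"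
  by (simp_all add: vid_def)

lemma hid_sel [simp]: "qtop (hid \<alpha>) = id2 A (src1 A \<alpha>)" "qleft (hid \<alpha>) = \<alpha>" "qbot (hid \<alpha>) = id2 A (tgt1 A \<alpha>)"
  "qright (hid \<alpha>) = \<alpha>" "qcell (hid \<alpha>) = \<langle>\<alpha>\<rangle>"
  by (simp_all add: hid_def)

lemma wlq_sel [simp]: "qtop (wlq g Q) = g \<rhd> qtop Q" "qleft (wlq g Q) = g \<rhd> qleft Q"
  "qbot (wlq g Q) = g \<rhd> qbot Q" "qright (wlq g Q) = g \<rhd> qright Q" "qcell (wlq g Q) = g \<rhd>\<rhd> qcell Q"
  by (simp_all add: wlq_def)

lemma wrq_sel [simp]: "qtop (wrq Q f) = qtop Q \<lhd> f" "qleft (wrq Q f) = qleft Q \<lhd> f"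
  "qbot (wrq Q f) = qbot Q \<lhd> f" "qright (wrq Q f) = qright Q \<lhd> f" "qcell (wrq Q f) = qcell Q \<lhd>\<lhd> f"
  by (simp_all add: wrq_def)

lemma transpose_sel [simp]: "qtop (transpose Q) = qleft Q" "qleft (transpose Q) = qtop Q"
  "qbot (transpose Q) = qright Q" "qright (transpose Q) = qbot Q" "qcell (transpose Q) = inv3 A (qcell Q)"
  by (simp_all add: transpose_def)

lemma iq_sel [simp]: "qtop (iq \<beta> \<alpha>) = src1 A \<beta> \<rhd> \<alpha>" "qleft (iq \<beta> \<alpha>) = \<beta> \<lhd> src1 A \<alpha>"
  "qbot (iq \<beta> \<alpha>) = tgt1 A \<beta> \<rhd> \<alpha>" "qright (iq \<beta> \<alpha>) = \<beta> \<lhd> tgt1 A \<alpha>" "qcell (iq \<beta> \<alpha>) = interch A \<beta> \<alpha>"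
  by (simp_all add: iq_def)

section \<open>The double category of quintets\<close>

lemma is_quintetD:
  assumes "is_quintet Q"
  shows "qtop Q \<in> Cell2 A" "qleft Q \<in> Cell2 A" "qbot Q \<in> Cell2 A" "qright Q \<in> Cell2 A" "qcell Q \<in> Cell3 A"
    "src1 A (qleft Q) = src1 A (qtop Q)" "src1 A (qright Q) = tgt1 A (qtop Q)"
    "src1 A (qbot Q) = tgt1 A (qleft Q)" "tgt1 A (qright Q) = tgt1 A (qbot Q)"
    "src2 A (qcell Q) = qbot Q \<odot> qleft Q" "tgt2 A (qcell Q) = qright Q \<odot> qtop Q"
  using assms by (auto simp: is_quintet_def)

text \<open>Pasting presupposes only the equation of the common edge; that the top edges and the
  bottom edges are composable follows. The conclusions are oriented for use as simp rules.\<close>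

lemma hmatch:
  assumes "is_quintet Q" "is_quintet R" "qleft R = qright Q"
  shows "qleft R = qright Q" "src1 A (qtop R) = tgt1 A (qtop Q)" "src1 A (qbot R) = tgt1 A (qbot Q)"
  using assms unfolding is_quintet_def by metis+

lemma vmatch:
  assumes "is_quintet Q" "is_quintet R" "qtop R = qbot Q"
  shows "qtop R = qbot Q" "src1 A (qleft R) = tgt1 A (qleft Q)" "src1 A (qright R) = tgt1 A (qbot Q)"
  using assms unfolding is_quintet_def by metis+

lemma is_quintet_hpaste [simp]:
  assumes "is_quintet Q" "is_quintet R" "qleft R = qright Q"
  shows "is_quintet (hpaste R Q)"
proof -
  note [simp] = is_quintetD[OF assms(1)] is_quintetD[OF assms(2)] hmatch[OF assms]
  show ?thesis unfolding is_quintet_def by (simp add: hpaste_def)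
qed

lemma is_quintet_vpaste [simp]:
  assumes "is_quintet Q" "is_quintet R" "qtop R = qbot Q"
  shows "is_quintet (vpaste R Q)"
proof -
  note [simp] = is_quintetD[OF assms(1)] is_quintetD[OF assms(2)] vmatch[OF assms]
  show ?thesis unfolding is_quintet_def by (simp add: vpaste_def)
qed

lemma hpaste_assoc:
  assumes "is_quintet Q" "is_quintet R" "is_quintet S" "qleft R = qright Q" "qleft S = qright R"
  shows "hpaste (hpaste S R) Q = hpaste S (hpaste R Q)"
proof -
  note [simp] = is_quintetD[OF assms(1)] is_quintetD[OF assms(2)] is_quintetD[OF assms(3)]
    hmatch[OF assms(1,2,4)] hmatch[OF assms(2,3,5)]
  show ?thesis by (simp add: hpaste_def)
qed

lemma vpaste_assoc:
  assumes "is_quintet Q" "is_quintet R" "is_quintet S" "qtop R = qbot Q" "qtop S = qbot R"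
  shows "vpaste (vpaste S R) Q = vpaste S (vpaste R Q)"
proof -
  note [simp] = is_quintetD[OF assms(1)] is_quintetD[OF assms(2)] is_quintetD[OF assms(3)]
    vmatch[OF assms(1,2,4)] vmatch[OF assms(2,3,5)]
  show ?thesis by (simp add: vpaste_def)
qed

text \<open>In both readings the lower left cell \<open>Q'\<close> acts before and the upper right
  cell \<open>R\<close> after the other two. The readings differ only in the order of the remaining
  diagonal pair \<open>Q\<close> and \<open>R'\<close>, which act on disjoint parts of the
  boundary.\<close>

lemma hpaste_vpaste:
  assumes q: "is_quintet Q" "is_quintet R" "is_quintet Q'" "is_quintet R'"
   and m: "qleft R = qright Q" "qleft R' = qright Q'" "qtop Q' = qbot Q" "qtop R' = qbot R"
  shows "hpaste (vpaste R' R) (vpaste Q' Q) = vpaste (hpaste R' Q') (hpaste R Q)"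
proof -
  note [simp] = is_quintetD[OF q(1)] is_quintetD[OF q(2)] is_quintetD[OF q(3)] is_quintetD[OF q(4)]
    hmatch[OF q(1,2) m(1)] hmatch[OF q(3,4) m(2)] vmatch[OF q(1,3) m(3)] vmatch[OF q(2,4) m(4)]
  have "(\<langle>qright R'\<rangle> \<star> (\<langle>qbot R\<rangle> \<star> qcell Q)) \<cdot> (qcell R' \<star> \<langle>qbot Q \<odot> qleft Q\<rangle>)
     = (qcell R' \<star> \<langle>qright Q \<odot> qtop Q\<rangle>) \<cdot> (\<langle>qbot R'\<rangle> \<star> (\<langle>qright Q'\<rangle> \<star> qcell Q))"
    using interchange_swap[of "qcell Q" "qcell R'"] by simp
  from vcomp3_swap[OF this] show ?thesis by (simp add: hpaste_def vpaste_def)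
qed

lemma is_quintet_vid [simp]: "\<alpha> \<in> Cell2 A \<Longrightarrow> is_quintet (vid \<alpha>)"
  and is_quintet_hid [simp]: "\<alpha> \<in> Cell2 A \<Longrightarrow> is_quintet (hid \<alpha>)"
  by (simp_all add: is_quintet_def)

lemma vpaste_vid [simp]: assumes "is_quintet Q"
  shows "\<alpha> = qbot Q \<Longrightarrow> vpaste (vid \<alpha>) Q = Q" "\<alpha> = qtop Q \<Longrightarrow> vpaste Q (vid \<alpha>) = Q"
  using is_quintetD[OF assms] by (simp_all add: vpaste_def)

lemma hpaste_hid [simp]: assumes "is_quintet Q"
  shows "\<alpha> = qright Q \<Longrightarrow> hpaste (hid \<alpha>) Q = Q" "\<alpha> = qleft Q \<Longrightarrow> hpaste Q (hid \<alpha>) = Q"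
  using is_quintetD[OF assms] by (simp_all add: hpaste_def)

lemma hpaste_vid: "\<lbrakk>\<alpha> \<in> Cell2 A; \<beta> \<in> Cell2 A; src1 A \<beta> = tgt1 A \<alpha>\<rbrakk> \<Longrightarrow> hpaste (vid \<beta>) (vid \<alpha>) = vid (\<beta> \<odot> \<alpha>)"
  by (simp add: hpaste_def vid_def)

lemma is_quintet_wlq [simp]:
  assumes "is_quintet Q" "g \<in> Mor A" "tgt0 A (src1 A (qtop Q)) = src0 A g"
  shows "is_quintet (wlq g Q)"
proof -
  note [simp] = is_quintetD[OF assms(1)]
  show ?thesis using assms(2,3) unfolding is_quintet_def by simp
qed

lemma is_quintet_wrq [simp]:
  assumes "is_quintet Q" "g \<in> Mor A" "tgt0 A g = src0 A (src1 A (qtop Q))"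
  shows "is_quintet (wrq Q g)"
proof -
  note [simp] = is_quintetD[OF assms(1)]
  show ?thesis using assms(2,3) unfolding is_quintet_def by simp
qed

lemma wlq_hpaste: assumes "is_quintet Q" "is_quintet R" "qleft R = qright Q" "g \<in> Mor A" "tgt0 A (src1 A (qtop Q)) = src0 A g"
  shows "wlq g (hpaste R Q) = hpaste (wlq g R) (wlq g Q)"
proof -
  note [simp] = is_quintetD[OF assms(1)] is_quintetD[OF assms(2)] hmatch[OF assms(1,2,3)]
  show ?thesis using assms(4,5) by (simp add: hpaste_def wlq_def)
qed

lemma wrq_hpaste: assumes "is_quintet Q" "is_quintet R" "qleft R = qright Q" "g \<in> Mor A" "tgt0 A g = src0 A (src1 A (qtop Q))"
  shows "wrq (hpaste R Q) g = hpaste (wrq R g) (wrq Q g)"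
proof -
  note [simp] = is_quintetD[OF assms(1)] is_quintetD[OF assms(2)] hmatch[OF assms(1,2,3)]
  show ?thesis using assms(4,5) by (simp add: hpaste_def wrq_def)
qed

lemma wlq_vpaste: assumes "is_quintet Q" "is_quintet R" "qtop R = qbot Q" "g \<in> Mor A" "tgt0 A (src1 A (qtop Q)) = src0 A g"
  shows "wlq g (vpaste R Q) = vpaste (wlq g R) (wlq g Q)"
proof -
  note [simp] = is_quintetD[OF assms(1)] is_quintetD[OF assms(2)] vmatch[OF assms(1,2,3)]
  show ?thesis using assms(4,5) by (simp add: vpaste_def wlq_def)
qed

lemma wrq_vpaste: assumes "is_quintet Q" "is_quintet R" "qtop R = qbot Q" "g \<in> Mor A" "tgt0 A g = src0 A (src1 A (qtop Q))"
  shows "wrq (vpaste R Q) g = vpaste (wrq R g) (wrq Q g)"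
proof -
  note [simp] = is_quintetD[OF assms(1)] is_quintetD[OF assms(2)] vmatch[OF assms(1,2,3)]
  show ?thesis using assms(4,5) by (simp add: vpaste_def wrq_def)
qed

lemma wq_vid [simp]: "\<lbrakk>\<alpha> \<in> Cell2 A; g \<in> Mor A; tgt0 A (src1 A \<alpha>) = src0 A g\<rbrakk> \<Longrightarrow> wlq g (vid \<alpha>) = vid (g \<rhd> \<alpha>)"
  "\<lbrakk>\<alpha> \<in> Cell2 A; g \<in> Mor A; tgt0 A g = src0 A (src1 A \<alpha>)\<rbrakk> \<Longrightarrow> wrq (vid \<alpha>) g = vid (\<alpha> \<lhd> g)"
  by (simp_all add: wlq_def wrq_def vid_def)

lemma wq_id1 [simp]:  assumes "is_quintet Q"
  shows "tgt0 A (src1 A (qtop Q)) = Y \<Longrightarrow> wlq (id1 A Y) Q = Q" "src0 A (src1 A (qtop Q)) = X \<Longrightarrow> wrq Q (id1 A X) = Q"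
  using is_quintetD[OF assms] by (auto intro!: quintet_eqI)

lemma wq_assoc: assumes "is_quintet Q"
  shows "\<lbrakk>g \<in> Mor A; h \<in> Mor A; tgt0 A (src1 A (qtop Q)) = src0 A g; tgt0 A g = src0 A h\<rbrakk>
    \<Longrightarrow> wlq (h \<bullet> g) Q = wlq h (wlq g Q)"
  "\<lbrakk>f \<in> Mor A; h \<in> Mor A; tgt0 A f = src0 A (src1 A (qtop Q)); tgt0 A (src1 A (qtop Q)) = src0 A h\<rbrakk>
    \<Longrightarrow> wrq (wlq h Q) f = wlq h (wrq Q f)"
  "\<lbrakk>f \<in> Mor A; g \<in> Mor A; tgt0 A f = src0 A g; tgt0 A g = src0 A (src1 A (qtop Q))\<rbrakk>
    \<Longrightarrow> wrq (wrq Q g) f = wrq Q (g \<bullet> f)"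
  using is_quintetD[OF assms] by (simp_all add: wlq_def wrq_def)

lemma is_quintet_transpose [simp]: assumes "is_quintet Q" "invertible3 A (qcell Q)" shows "is_quintet (transpose Q)"
proof -
  note [simp] = is_quintetD[OF assms(1)]
  show ?thesis using assms(2) by (simp add: is_quintet_def)
qed

lemma invertible3_paste [simp]: assumes "is_quintet Q" "is_quintet R" "invertible3 A (qcell Q)" "invertible3 A (qcell R)"
  shows "qleft R = qright Q \<Longrightarrow> invertible3 A (qcell (hpaste R Q))"
    "qtop R = qbot Q \<Longrightarrow> invertible3 A (qcell (vpaste R Q))"
proof -
  note [simp] = is_quintetD[OF assms(1)] is_quintetD[OF assms(2)] assms(3,4)
  { assume "qleft R = qright Q"
    note [simp] = hmatch[OF assms(1,2) this]
    show "invertible3 A (qcell (hpaste R Q))" by (simp add: hpaste_def) }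
  { assume "qtop R = qbot Q"
    note [simp] = vmatch[OF assms(1,2) this]
    show "invertible3 A (qcell (vpaste R Q))" by (simp add: vpaste_def) }
qed

text \<open>Reflection exchanges the two directions of pasting. This converts the compositionality
  of interchangers into that of their inverses.\<close>

lemma transpose_hpaste: assumes "is_quintet Q" "is_quintet R" "invertible3 A (qcell Q)" "invertible3 A (qcell R)"
   "qleft R = qright Q"
  shows "transpose (hpaste R Q) = vpaste (transpose R) (transpose Q)"
proof -
  note [simp] = is_quintetD[OF assms(1)] is_quintetD[OF assms(2)] assms(3,4) hmatch[OF assms(1,2,5)]
  show ?thesis by (simp add: transpose_def hpaste_def vpaste_def)
qed

lemma transpose_vpaste: assumes "is_quintet Q" "is_quintet R" "invertible3 A (qcell Q)" "invertible3 A (qcell R)"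
   "qtop R = qbot Q"
  shows "transpose (vpaste R Q) = hpaste (transpose R) (transpose Q)"
proof -
  note [simp] = is_quintetD[OF assms(1)] is_quintetD[OF assms(2)] assms(3,4) vmatch[OF assms(1,2,5)]
  show ?thesis by (simp add: transpose_def hpaste_def vpaste_def)
qed

lemma transpose_wq:
  assumes "is_quintet Q" "invertible3 A (qcell Q)"
  shows "\<lbrakk>g \<in> Mor A; tgt0 A (src1 A (qtop Q)) = src0 A g\<rbrakk> \<Longrightarrow> transpose (wlq g Q) = wlq g (transpose Q)"
    "\<lbrakk>g \<in> Mor A; tgt0 A g = src0 A (src1 A (qtop Q))\<rbrakk> \<Longrightarrow> transpose (wrq Q g) = wrq (transpose Q) g"
  using is_quintetD[OF assms(1)] assms(2) by (simp_all add: wlq_def wrq_def transpose_def)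

lemma transpose_id [simp]: "\<alpha> \<in> Cell2 A \<Longrightarrow> transpose (vid \<alpha>) = hid \<alpha>" "\<alpha> \<in> Cell2 A \<Longrightarrow> transpose (hid \<alpha>) = vid \<alpha>"
  by (simp_all add: transpose_def vid_def hid_def)

section \<open>Interchanger quintets\<close>

lemma is_quintet_iq [simp]:
  "\<lbrakk>\<alpha> \<in> Cell2 A; \<beta> \<in> Cell2 A; tgt0 A (src1 A \<alpha>) = src0 A (src1 A \<beta>)\<rbrakk> \<Longrightarrow> is_quintet (iq \<beta> \<alpha>)"
  by (simp add: is_quintet_def)

lemma iq_id2 [simp]:
  "\<lbrakk>\<alpha> \<in> Cell2 A; g \<in> Mor A; tgt0 A (src1 A \<alpha>) = src0 A g\<rbrakk> \<Longrightarrow> iq (id2 A g) \<alpha> = vid (g \<rhd> \<alpha>)"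
  "\<lbrakk>\<beta> \<in> Cell2 A; f \<in> Mor A; tgt0 A f = src0 A (src1 A \<beta>)\<rbrakk> \<Longrightarrow> iq \<beta> (id2 A f) = hid (\<beta> \<lhd> f)"
  by (simp_all add: iq_def vid_def hid_def)

text \<open>Supplies the endpoint equations that \<open>mor_ends2\<close> cannot produce once
  \<open>tgt1 A \<beta>\<close> has been rewritten by the matching condition.\<close>

lemma composable_ends: "\<lbrakk>\<beta> \<in> Cell2 A; \<beta>' \<in> Cell2 A; tgt1 A \<beta> = src1 A \<beta>'\<rbrakk> \<Longrightarrow>
   src0 A (src1 A \<beta>') = src0 A (src1 A \<beta>) \<and> tgt0 A (src1 A \<beta>') = tgt0 A (src1 A \<beta>)"
  by (metis mor_ends2(3,4))

text \<open>Since \<open>iq\<close> puts its first argument on the vertical edges and the second on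
  the horizontal ones, the composition law of interchangers in the first variable is vertical
  pasting, and in the second variable, in the next lemma, horizontal pasting.\<close>

lemma iq_vcomp2_left:
  "\<lbrakk>\<alpha> \<in> Cell2 A; \<beta> \<in> Cell2 A; \<beta>' \<in> Cell2 A; tgt1 A \<beta> = src1 A \<beta>'; tgt0 A (src1 A \<alpha>) = src0 A (src1 A \<beta>)\<rbrakk>
   \<Longrightarrow> iq (\<beta>' \<odot> \<beta>) \<alpha> = vpaste (iq \<beta>' \<alpha>) (iq \<beta> \<alpha>)"
  using composable_ends[of \<beta> \<beta>'] by (simp add: iq_def vpaste_def)

lemma iq_vcomp2_right:
  "\<lbrakk>\<alpha> \<in> Cell2 A; \<beta> \<in> Cell2 A; \<alpha>' \<in> Cell2 A; tgt1 A \<alpha> = src1 A \<alpha>'; tgt0 A (src1 A \<alpha>) = src0 A (src1 A \<beta>)\<rbrakk>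
   \<Longrightarrow> iq \<beta> (\<alpha>' \<odot> \<alpha>) = hpaste (iq \<beta> \<alpha>') (iq \<beta> \<alpha>)"
  using composable_ends[of \<alpha> \<alpha>'] by (simp add: iq_def hpaste_def)

lemma iq_assoc:
  "\<lbrakk>\<alpha> \<in> Cell2 A; \<beta> \<in> Cell2 A; h \<in> Mor A; tgt0 A (src1 A \<alpha>) = src0 A (src1 A \<beta>); tgt0 A (src1 A \<beta>) = src0 A h\<rbrakk>
   \<Longrightarrow> iq (h \<rhd> \<beta>) \<alpha> = wlq h (iq \<beta> \<alpha>)"
  "\<lbrakk>\<alpha> \<in> Cell2 A; \<beta> \<in> Cell2 A; h \<in> Mor A; tgt0 A (src1 A \<alpha>) = src0 A h; tgt0 A h = src0 A (src1 A \<beta>)\<rbrakk>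
   \<Longrightarrow> iq (\<beta> \<lhd> h) \<alpha> = iq \<beta> (h \<rhd> \<alpha>)"
  "\<lbrakk>\<alpha> \<in> Cell2 A; \<beta> \<in> Cell2 A; h \<in> Mor A; tgt0 A (src1 A \<alpha>) = src0 A (src1 A \<beta>); tgt0 A h = src0 A (src1 A \<alpha>)\<rbrakk>
   \<Longrightarrow> iq \<beta> (\<alpha> \<lhd> h) = wrq (iq \<beta> \<alpha>) h"
  by (simp_all add: iq_def wlq_def wrq_def)

text \<open>
  The 3-cells \<open>\<Sigma>\<close> and \<open>T\<close> between the top and bottom edges turn the quintet \<open>Q\<close> into \<open>R\<close>.
  The local modification condition and the naturality of interchangers both have this form.
\<close>

definition cyl :: "('b, 'c) quintet \<Rightarrow> ('b, 'c) quintet \<Rightarrow> 'c \<Rightarrow> 'c \<Rightarrow> bool" where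
  "cyl Q R \<Sigma> T \<longleftrightarrow> is_quintet Q \<and> is_quintet R \<and> qleft R = qleft Q \<and> qright R = qright Q
    \<and> \<Sigma> \<in> Cell3 A \<and> src2 A \<Sigma> = qtop Q \<and> tgt2 A \<Sigma> = qtop R
    \<and> T \<in> Cell3 A \<and> src2 A T = qbot Q \<and> tgt2 A T = qbot R
    \<and> qcell R \<cdot> (T \<star> \<langle>qleft Q\<rangle>) = (\<langle>qright Q\<rangle> \<star> \<Sigma>) \<cdot> qcell Q"

section \<open>Pasting of cylinders\<close>

lemma cylD: assumes "cyl Q R \<Sigma> T"
  shows "is_quintet Q" "is_quintet R" "qleft R = qleft Q" "qright R = qright Q"
    "\<Sigma> \<in> Cell3 A" "src2 A \<Sigma> = qtop Q" "tgt2 A \<Sigma> = qtop R"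
    "T \<in> Cell3 A" "src2 A T = qbot Q" "tgt2 A T = qbot R"
    "src1 A (qtop R) = src1 A (qtop Q)"  "tgt1 A (qtop R) = tgt1 A (qtop Q)" "tgt1 A (qbot R) = tgt1 A (qbot Q)"
  using assms unfolding cyl_def is_quintet_def by metis+

lemma cyl_eq: "cyl Q R \<Sigma> T \<Longrightarrow> qcell R \<cdot> (T \<star> \<langle>qleft Q\<rangle>) = (\<langle>qright Q\<rangle> \<star> \<Sigma>) \<cdot> qcell Q"
  by (simp add: cyl_def)

lemma cyl_refl: assumes "is_quintet Q" shows "cyl Q Q \<langle>qtop Q\<rangle> \<langle>qbot Q\<rangle>"
proof -
  note [simp] = is_quintetD[OF assms(1)]
  show ?thesis using assms by (simp add: cyl_def)
qed

text \<open>The degenerate cylinder on a 3-cell; it settles the local modification condition at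
  identity 2-cells.\<close>

lemma cyl_vid: assumes "\<Gamma> \<in> Cell3 A" shows "cyl (vid (src2 A \<Gamma>)) (vid (tgt2 A \<Gamma>)) \<Gamma> \<Gamma>"
  using assms by (simp add: cyl_def)

lemma cyl_trans: assumes "cyl Q R \<Sigma> T" "cyl R S \<Sigma>' T'" shows "cyl Q S (\<Sigma>' \<cdot> \<Sigma>) (T' \<cdot> T)"
proof -
  note [simp] = is_quintetD[OF cylD(1)[OF assms(1)]]
  note [simp] = is_quintetD[OF cylD(2)[OF assms(1)]]
  note [simp] = is_quintetD[OF cylD(2)[OF assms(2)]]
  note [simp] = cylD[OF assms(1)] cylD[OF assms(2)]
  have "qcell S \<cdot> ((T' \<cdot> T) \<star> \<langle>qleft Q\<rangle>) = (qcell S \<cdot> (T' \<star> \<langle>qleft Q\<rangle>)) \<cdot> (T \<star> \<langle>qleft Q\<rangle>)" by simp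
  also have "\<dots> = ((\<langle>qright Q\<rangle> \<star> \<Sigma>') \<cdot> qcell R) \<cdot> (T \<star> \<langle>qleft Q\<rangle>)" using cyl_eq[OF assms(2)] by simp
  also have "\<dots> = (\<langle>qright Q\<rangle> \<star> \<Sigma>') \<cdot> (qcell R \<cdot> (T \<star> \<langle>qleft Q\<rangle>))" by simp
  also have "\<dots> = (\<langle>qright Q\<rangle> \<star> \<Sigma>') \<cdot> ((\<langle>qright Q\<rangle> \<star> \<Sigma>) \<cdot> qcell Q)" by (simp only: cyl_eq[OF assms(1)])
  also have "\<dots> = (\<langle>qright Q\<rangle> \<star> (\<Sigma>' \<cdot> \<Sigma>)) \<cdot> qcell Q" by simp
  finally show ?thesis by (simp add: cyl_def)
qed

text \<open>The bottom 3-cell \<open>T\<close> of the upper cylinder is the top 3-cell of the lower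
  one, so the two equations are applied one after the other, each whiskered by an edge of the other
  quintet.\<close>

lemma cyl_vpaste: assumes c: "cyl Q R \<Sigma> T" "cyl Q' R' T U" shows "cyl (vpaste Q' Q) (vpaste R' R) \<Sigma> U"
proof -
  have m: "qtop Q' = qbot Q" "qtop R' = qbot R" using cylD[OF c(1)] cylD[OF c(2)] by auto
  note q = cylD(1,2)[OF c(1)] cylD(1,2)[OF c(2)]
  note [simp] = is_quintetD[OF q(1)] is_quintetD[OF q(2)] is_quintetD[OF q(3)] is_quintetD[OF q(4)]
    vmatch[OF q(1,3) m(1)] vmatch[OF q(2,4) m(2)]
  note [simp] = cylD[OF assms(1)] cylD[OF assms(2)]
  have [simp]: "T \<in> Cell3 A" by simp
  have "qcell (vpaste R' R) \<cdot> (U \<star> \<langle>qleft Q' \<odot> qleft Q\<rangle>)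
     = (\<langle>qright Q'\<rangle> \<star> qcell R) \<cdot> ((qcell R' \<cdot> (U \<star> \<langle>qleft Q'\<rangle>)) \<star> \<langle>qleft Q\<rangle>)"
    by (simp add: vpaste_def)
  also have "\<dots> = (\<langle>qright Q'\<rangle> \<star> qcell R) \<cdot> (((\<langle>qright Q'\<rangle> \<star> T) \<cdot> qcell Q') \<star> \<langle>qleft Q\<rangle>)"
    by (simp only: cyl_eq[OF c(2)])
  also have "\<dots> = (\<langle>qright Q'\<rangle> \<star> (qcell R \<cdot> (T \<star> \<langle>qleft Q\<rangle>))) \<cdot> (qcell Q' \<star> \<langle>qleft Q\<rangle>)"
    by simp
  also have "\<dots> = (\<langle>qright Q'\<rangle> \<star> ((\<langle>qright Q\<rangle> \<star> \<Sigma>) \<cdot> qcell Q)) \<cdot> (qcell Q' \<star> \<langle>qleft Q\<rangle>)"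
    by (simp only: cyl_eq[OF c(1)])
  also have "\<dots> = (\<langle>qright Q' \<odot> qright Q\<rangle> \<star> \<Sigma>) \<cdot> qcell (vpaste Q' Q)" by (simp add: vpaste_def)
  finally show ?thesis using q m by (simp add: cyl_def)
qed

lemma cyl_hpaste: assumes c: "cyl Q R \<Sigma> T" "cyl Q' R' \<Sigma>' T'" and m: "qleft Q' = qright Q"
  shows "cyl (hpaste Q' Q) (hpaste R' R) (\<Sigma>' \<star> \<Sigma>) (T' \<star> T)"
proof -
  have m': "qleft R' = qright R" using cylD[OF c(1)] cylD[OF c(2)] m by auto
  note q = cylD(1,2)[OF c(1)] cylD(1,2)[OF c(2)]
  note [simp] = is_quintetD[OF q(1)] is_quintetD[OF q(2)] is_quintetD[OF q(3)] is_quintetD[OF q(4)]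
    hmatch[OF q(1,3) m(1)] hmatch[OF q(2,4) m']
  note [simp] = cylD[OF assms(1)] cylD[OF assms(2)]
  \<comment> \<open>Of the two whiskered factorisations of \<open>T' \<star> T\<close> this one puts
    \<open>T\<close> next to \<open>qcell R\<close>, where the first cylinder equation
    applies.\<close>
  have a: "T' \<star> T = (\<langle>qbot R'\<rangle> \<star> T) \<cdot> (T' \<star> \<langle>qbot Q\<rangle>)"
    using interchange3[of "\<langle>qbot Q\<rangle>" T T' "\<langle>qbot R'\<rangle>"] by simp
  have b: "(\<langle>qtop R'\<rangle> \<star> \<Sigma>) \<cdot> (\<Sigma>' \<star> \<langle>qtop Q\<rangle>) = \<Sigma>' \<star> \<Sigma>"
    using interchange3[of "\<langle>qtop Q\<rangle>" \<Sigma> \<Sigma>' "\<langle>qtop R'\<rangle>"] by simp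
  have "qcell (hpaste R' R) \<cdot> ((T' \<star> T) \<star> \<langle>qleft Q\<rangle>)
     = (qcell R' \<star> \<langle>qtop R\<rangle>) \<cdot> ((\<langle>qbot R'\<rangle> \<star> (qcell R \<cdot> (T \<star> \<langle>qleft Q\<rangle>))) \<cdot> (T' \<star> \<langle>qbot Q \<odot> qleft Q\<rangle>))"
    by (simp add: hpaste_def a)
  also have "\<dots> = (qcell R' \<star> \<langle>qtop R\<rangle>) \<cdot> ((\<langle>qbot R'\<rangle> \<star> ((\<langle>qright Q\<rangle> \<star> \<Sigma>) \<cdot> qcell Q)) \<cdot> (T' \<star> \<langle>qbot Q \<odot> qleft Q\<rangle>))"
    by (simp only: cyl_eq[OF c(1)])
  also have "\<dots> = ((qcell R' \<star> \<langle>qtop R\<rangle>) \<cdot> (\<langle>qbot R' \<odot> qright Q\<rangle> \<star> \<Sigma>)) \<cdot> ((\<langle>qbot R'\<rangle> \<star> qcell Q) \<cdot> (T' \<star> \<langle>qbot Q \<odot> qleft Q\<rangle>))"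
    by simp
  \<comment> \<open>Two independent pairs trade places: \<open>\<Sigma>\<close> moves past
    \<open>qcell R'\<close>, and in the next step \<open>T'\<close> past \<open>qcell Q\<close>.
    This makes \<open>qcell R'\<close> and \<open>T'\<close> adjacent, ready for the second cylinder
    equation.\<close>
  also have "(qcell R' \<star> \<langle>qtop R\<rangle>) \<cdot> (\<langle>qbot R' \<odot> qright Q\<rangle> \<star> \<Sigma>) = (\<langle>qright Q' \<odot> qtop R'\<rangle> \<star> \<Sigma>) \<cdot> (qcell R' \<star> \<langle>qtop Q\<rangle>)"
    using interchange_swap[of \<Sigma> "qcell R'"] by simp
  also have "(\<langle>qbot R'\<rangle> \<star> qcell Q) \<cdot> (T' \<star> \<langle>qbot Q \<odot> qleft Q\<rangle>) = (T' \<star> \<langle>qright Q \<odot> qtop Q\<rangle>) \<cdot> (\<langle>qbot Q'\<rangle> \<star> qcell Q)"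
    using interchange_swap[of "qcell Q" T'] by simp
  also have "((\<langle>qright Q' \<odot> qtop R'\<rangle> \<star> \<Sigma>) \<cdot> (qcell R' \<star> \<langle>qtop Q\<rangle>)) \<cdot> ((T' \<star> \<langle>qright Q \<odot> qtop Q\<rangle>) \<cdot> (\<langle>qbot Q'\<rangle> \<star> qcell Q))
    = (\<langle>qright Q' \<odot> qtop R'\<rangle> \<star> \<Sigma>) \<cdot> (((qcell R' \<cdot> (T' \<star> \<langle>qleft Q'\<rangle>)) \<star> \<langle>qtop Q\<rangle>) \<cdot> (\<langle>qbot Q'\<rangle> \<star> qcell Q))" by simp
  also have "\<dots> = (\<langle>qright Q' \<odot> qtop R'\<rangle> \<star> \<Sigma>) \<cdot> ((((\<langle>qright Q'\<rangle> \<star> \<Sigma>') \<cdot> qcell Q') \<star> \<langle>qtop Q\<rangle>) \<cdot> (\<langle>qbot Q'\<rangle> \<star> qcell Q))"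
    by (simp only: cyl_eq[OF c(2)])
  also have "\<dots> = (\<langle>qright Q'\<rangle> \<star> ((\<langle>qtop R'\<rangle> \<star> \<Sigma>) \<cdot> (\<Sigma>' \<star> \<langle>qtop Q\<rangle>))) \<cdot> qcell (hpaste Q' Q)"
    by (simp add: hpaste_def)
  finally show ?thesis using q m m' by (simp add: cyl_def b)
qed

lemma cyl_wlq: assumes "cyl Q R \<Sigma> T" "g \<in> Mor A" "tgt0 A (src1 A (qtop Q)) = src0 A g"
  shows "cyl (wlq g Q) (wlq g R) (g \<rhd>\<rhd> \<Sigma>) (g \<rhd>\<rhd> T)"
proof -
  note [simp] = is_quintetD[OF cylD(1)[OF assms(1)]]
  note [simp] = is_quintetD[OF cylD(2)[OF assms(1)]]
  note [simp] = cylD[OF assms(1)] assms(2,3)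
  show ?thesis using arg_cong[OF cyl_eq[OF assms(1)], of "whl3 A g"] by (simp add: cyl_def)
qed

lemma cyl_wrq: assumes "cyl Q R \<Sigma> T" "g \<in> Mor A" "tgt0 A g = src0 A (src1 A (qtop Q))"
  shows "cyl (wrq Q g) (wrq R g) (\<Sigma> \<lhd>\<lhd> g) (T \<lhd>\<lhd> g)"
proof -
  note [simp] = is_quintetD[OF cylD(1)[OF assms(1)]]
  note [simp] = is_quintetD[OF cylD(2)[OF assms(1)]]
  note [simp] = cylD[OF assms(1)] assms(2,3)
  show ?thesis using arg_cong[OF cyl_eq[OF assms(1)], of "\<lambda>\<Gamma>. \<Gamma> \<lhd>\<lhd> g"] by (simp add: cyl_def)
qed

lemma cyl_iq: assumes "\<beta> \<in> Cell2 A" "\<Gamma> \<in> Cell3 A" "tgt0 A (src1 A (src2 A \<Gamma>)) = src0 A (src1 A \<beta>)"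
  shows "cyl (iq \<beta> (src2 A \<Gamma>)) (iq \<beta> (tgt2 A \<Gamma>)) (src1 A \<beta> \<rhd>\<rhd> \<Gamma>) (tgt1 A \<beta> \<rhd>\<rhd> \<Gamma>)"
  using assms interch_natural_right[OF assms] by (simp add: cyl_def)

text \<open>Naturality of the interchanger in its first variable, composed with the inverse
  interchangers at both ends. The varying 3-cell then sits on the top and bottom edges, as
  \<open>cyl\<close> demands, because \<open>transpose\<close> has moved it there from the left and
  right.\<close>

lemma cyl_transpose_iq: assumes "\<alpha> \<in> Cell2 A" "\<Gamma> \<in> Cell3 A" "tgt0 A (src1 A \<alpha>) = src0 A (src1 A (src2 A \<Gamma>))"
  shows "cyl (transpose (iq (src2 A \<Gamma>) \<alpha>)) (transpose (iq (tgt2 A \<Gamma>) \<alpha>)) (\<Gamma> \<lhd>\<lhd> src1 A \<alpha>) (\<Gamma> \<lhd>\<lhd> tgt1 A \<alpha>)"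
proof -
  note [simp] = assms
  let ?I = "interch A (src2 A \<Gamma>) \<alpha>" and ?J = "interch A (tgt2 A \<Gamma>) \<alpha>"
  let ?L = "(\<Gamma> \<lhd>\<lhd> tgt1 A \<alpha>) \<star> \<langle>src1 A (src2 A \<Gamma>) \<rhd> \<alpha>\<rangle>" and ?R = "\<langle>tgt1 A (src2 A \<Gamma>) \<rhd> \<alpha>\<rangle> \<star> (\<Gamma> \<lhd>\<lhd> src1 A \<alpha>)"
  have "inv3 A ?J \<cdot> ?L = inv3 A ?J \<cdot> ((?L \<cdot> ?I) \<cdot> inv3 A ?I)" by simp
  also have "\<dots> = inv3 A ?J \<cdot> ((?J \<cdot> ?R) \<cdot> inv3 A ?I)" by (simp only: interch_natural_left[OF assms])
  also have "\<dots> = ?R \<cdot> inv3 A ?I" by simp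
  finally show ?thesis by (simp add: cyl_def)
qed

end

section \<open>Lifting along a free sesquicategory\<close>

text \<open>
  A family of sets \<open>D \<phi>\<close> indexed by the 2-cells of \<open>S\<close>, with operations lying over those of \<open>S\<close>,
  forms a sesquicategory over \<open>S\<close>. If \<open>S\<close> is free, then it has a section extending any choice on
  the generating 2-cells.
\<close>

definition displayed_cells :: "('o, 'a, 'b, 'm) sesqui_scheme \<Rightarrow> ('b \<Rightarrow> 'd set) \<Rightarrow> ('a \<Rightarrow> 'd)
    \<Rightarrow> ('a \<Rightarrow> 'b \<Rightarrow> 'd \<Rightarrow> 'd) \<Rightarrow> ('b \<Rightarrow> 'd \<Rightarrow> 'a \<Rightarrow> 'd) \<Rightarrow> ('b \<Rightarrow> 'd \<Rightarrow> 'b \<Rightarrow> 'd \<Rightarrow> 'd)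
    \<Rightarrow> ('o, 'a, 'b \<times> 'd) sesqui" where
  "displayed_cells S D i l r v = \<lparr>Ob = Ob S, Mor = Mor S, Cell2 = {(\<phi>, x). \<phi> \<in> Cell2 S \<and> x \<in> D \<phi>},
     src0 = src0 S, tgt0 = tgt0 S, src1 = (\<lambda>c. src1 S (fst c)), tgt1 = (\<lambda>c. tgt1 S (fst c)),
     id1 = id1 S, id2 = (\<lambda>f. (id2 S f, i f)), comp1 = comp1 S,
     whl2 = (\<lambda>g c. (g \<rhd>\<^bsub>S\<^esub> fst c, l g (fst c) (snd c))),
     whr2 = (\<lambda>c f. (fst c \<lhd>\<^bsub>S\<^esub> f, r (fst c) (snd c) f)),
     vcomp2 = (\<lambda>d c. (fst d \<odot>\<^bsub>S\<^esub> fst c, v (fst d) (snd d) (fst c) (snd c)))\<rparr>"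

lemma displayed_cells_sel [simp]:
  "Ob (displayed_cells S D i l r v) = Ob S" "Mor (displayed_cells S D i l r v) = Mor S"
  "src0 (displayed_cells S D i l r v) = src0 S" "tgt0 (displayed_cells S D i l r v) = tgt0 S"
  "id1 (displayed_cells S D i l r v) = id1 S" "comp1 (displayed_cells S D i l r v) = comp1 S"
  "src1 (displayed_cells S D i l r v) c = src1 S (fst c)" "tgt1 (displayed_cells S D i l r v) c = tgt1 S (fst c)"
  "id2 (displayed_cells S D i l r v) f = (id2 S f, i f)"
  "whl2 (displayed_cells S D i l r v) g c = (g \<rhd>\<^bsub>S\<^esub> fst c, l g (fst c) (snd c))"
  "whr2 (displayed_cells S D i l r v) c f = (fst c \<lhd>\<^bsub>S\<^esub> f, r (fst c) (snd c) f)"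
  "vcomp2 (displayed_cells S D i l r v) d c = (fst d \<odot>\<^bsub>S\<^esub> fst c, v (fst d) (snd d) (fst c) (snd c))"
  "Cell2 (displayed_cells S D i l r v) = {(\<phi>, x). \<phi> \<in> Cell2 S \<and> x \<in> D \<phi>}"
  by (simp_all add: displayed_cells_def)

context free_on_computad
begin

lemma edge_path_in: "e \<in> edges K \<Longrightarrow> edge_path K e \<in> paths K"
  using edge_ends by (simp add: paths_def edge_path_def)

lemma on1_path: "p \<in> paths K \<Longrightarrow> on1 H p \<in> Mor S \<and> src0 S (on1 H p) = on0 H (psrc p) \<and> tgt0 S (on1 H p) = on0 H (ptgt p)"
  using on1_in[of p "psrc p" "ptgt p"] by (simp add: in1_def free_sesqui_def)

lemma on1_Nil: "x \<in> vertices K \<Longrightarrow> on1 H (Path x [] x) = id1 S (on0 H x)"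
  using on1_id1[of x] by (simp add: free_sesqui_def)

lemma on1_path_comp: "\<lbrakk>p \<in> paths K; q \<in> paths K; ptgt p = psrc q\<rbrakk> \<Longrightarrow> on1 H (path_comp q p) = on1 H q \<bullet>\<^bsub>S\<^esub> on1 H p"
  using on1_comp1[of p "psrc p" "ptgt p" q "ptgt q"] by (simp add: free_sesqui_def in1_def)

lemma path_Cons: "walk K x (e # es) y \<Longrightarrow> Path x (e # es) y = path_comp (Path (etgt K e) es y) (edge_path K e)
    \<and> edge_path K e \<in> paths K \<and> Path (etgt K e) es y \<in> paths K"
  by (simp add: path_comp_def edge_path_def paths_def edge_ends)

lemma mor_cases: assumes "f \<in> Mor S" obtains p where "p \<in> paths K" "f = on1 H p"
  using bij1 assms by (auto simp: bij_betw_def free_sesqui_def)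

lemma ob_cases: assumes "X \<in> Ob S" obtains x where "x \<in> vertices K" "X = on0 H x"
  using bij0 assms by (auto simp: bij_betw_def free_sesqui_def)

lemma cell_cases: assumes "\<phi> \<in> Cell2 S" obtains c where "c \<in> fcells K" "\<phi> = on2 H c"
  using bij2 assms by (auto simp: bij_betw_def free_sesqui_def)

lemma on0_inj: "\<lbrakk>x \<in> vertices K; y \<in> vertices K; on0 H x = on0 H y\<rbrakk> \<Longrightarrow> x = y"
  using bij0 by (auto simp: bij_betw_def free_sesqui_def inj_on_def)

lemma on1_inj: "\<lbrakk>p \<in> paths K; q \<in> paths K; on1 H p = on1 H q\<rbrakk> \<Longrightarrow> p = q"
  using bij1 by (auto simp: bij_betw_def free_sesqui_def inj_on_def)

lemma on2_inj: "\<lbrakk>c \<in> fcells K; d \<in> fcells K; on2 H c = on2 H d\<rbrakk> \<Longrightarrow> c = d"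
  using bij2 by (auto simp: bij_betw_def free_sesqui_def inj_on_def)

text \<open>Every morphism of \<open>S\<close> is the image of a path, and a path is an iterated
  composite of edges. The rule serves the uniqueness of extensions along morphisms and the passage
  of the perturbation axiom to composites.\<close>

lemma mor_induct [consumes 1, case_names id gen comp]:
  assumes "f \<in> Mor S"
    and id: "\<And>X. X \<in> Ob S \<Longrightarrow> P (id1 S X)"
    and gen: "\<And>f. f \<in> generating_mors K H \<Longrightarrow> P f"
    and comp: "\<And>f g. \<lbrakk>f \<in> Mor S; g \<in> Mor S; tgt0 S f = src0 S g; P f; P g\<rbrakk> \<Longrightarrow> P (g \<bullet>\<^bsub>S\<^esub> f)"
  shows "P f"
proof -
  have *: "walk K x es y \<Longrightarrow> P (on1 H (Path x es y))" for x es y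
  proof (induction es arbitrary: x)
    case Nil
    then show ?case using id[of "on0 H x"] on0_in[of x] by (auto simp: on1_Nil free_sesqui_def)
  next
    case (Cons e es)
    from path_Cons[OF Cons.prems] have c: "Path x (e # es) y = path_comp (Path (etgt K e) es y) (edge_path K e)"
      "edge_path K e \<in> paths K" "Path (etgt K e) es y \<in> paths K" by auto
    have "P (on1 H (edge_path K e))" using gen Cons.prems by (auto simp: generating_mors_def)
    moreover have "P (on1 H (Path (etgt K e) es y))" using Cons by auto
    moreover have "ptgt (edge_path K e) = psrc (Path (etgt K e) es y)" by (simp add: edge_path_def)
    ultimately show ?case unfolding c(1) using comp on1_path[OF c(2)] on1_path[OF c(3)] on1_path_comp[OF c(2,3)] by simp
  qed
  obtain p where "p \<in> paths K" "f = on1 H p" using assms(1) by (rule mor_cases)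
  then show ?thesis using *[of "psrc p" "pedges p" "ptgt p"] by (simp add: paths_def)
qed

lemma on2_cell: "c \<in> fcells K \<Longrightarrow> on2 H c \<in> Cell2 S \<and> src1 S (on2 H c) = on1 H (fsrc c) \<and> tgt1 S (on2 H c) = on1 H (ftgt c)"
  using on2_in[of c "fsrc c" "ftgt c"] by (simp add: in2_def free_sesqui_def)

lemma fcell_ends: "c \<in> fcells K \<Longrightarrow> fsrc c \<in> paths K \<and> ftgt c \<in> paths K \<and> psrc (fsrc c) = psrc (ftgt c) \<and> ptgt (fsrc c) = ptgt (ftgt c)"
  using step_walk_ends by (simp add: fcells_def)

lemma generator_step: "c \<in> generators K \<Longrightarrow> generator_cell K c \<in> fcells K"
  using generator_ends[of c] path_ends[of "gsrc K c"]
  by (auto simp: fcells_def generator_cell_def steps_def step_src_def step_tgt_def path_id path_unit_left path_unit_right)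

lemma generating_cells_in: "\<phi> \<in> generating_cells K H \<Longrightarrow> \<phi> \<in> Cell2 S"
  using generator_step on2_cell by (auto simp: generating_cells_def)

lemma generating_mors_in: "f \<in> generating_mors K H \<Longrightarrow> f \<in> Mor S"
  using edge_path_in on1_path by (auto simp: generating_mors_def)

text \<open>A 2-cell of the free sesquicategory is a list of steps, and each step is a generator
  whiskered on both sides, so closure under the four operations suffices.\<close>

lemma cell_induct [consumes 1, case_names id gen comp whl whr]:
  assumes "\<phi> \<in> Cell2 S"
    and id: "\<And>f. f \<in> Mor S \<Longrightarrow> P (id2 S f)"
    and gen: "\<And>\<phi>. \<phi> \<in> generating_cells K H \<Longrightarrow> P \<phi>"
    and comp: "\<And>\<phi> \<psi>. \<lbrakk>\<phi> \<in> Cell2 S; \<psi> \<in> Cell2 S; tgt1 S \<phi> = src1 S \<psi>; P \<phi>; P \<psi>\<rbrakk> \<Longrightarrow> P (\<psi> \<odot>\<^bsub>S\<^esub> \<phi>)"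
    and whl: "\<And>\<phi> g. \<lbrakk>\<phi> \<in> Cell2 S; g \<in> Mor S; tgt0 S (src1 S \<phi>) = src0 S g; P \<phi>\<rbrakk> \<Longrightarrow> P (g \<rhd>\<^bsub>S\<^esub> \<phi>)"
    and whr: "\<And>\<phi> f. \<lbrakk>\<phi> \<in> Cell2 S; f \<in> Mor S; tgt0 S f = src0 S (src1 S \<phi>); P \<phi>\<rbrakk> \<Longrightarrow> P (\<phi> \<lhd>\<^bsub>S\<^esub> f)"
  shows "P \<phi>"
proof -
  interpret FS: sesquicategory "free_sesqui K" by (rule sesquicategory_free_sesqui)
  have one: "P (on2 H (FCell (step_src K w) [w] (step_tgt K w)))" if w: "w \<in> steps K" for w
  proof -
    have c: "gen w \<in> generators K" using w by (simp add: steps_def)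
    let ?g = "generator_cell K (gen w)"
    let ?gr = "?g \<lhd>\<^bsub>free_sesqui K\<^esub> pre w"
    have G: "\<guillemotleft>?g : gsrc K (gen w) \<Rightarrow>\<^bsub>free_sesqui K\<^esub> gtgt K (gen w)\<guillemotright>"
      using generator_step[OF c] by (simp add: free_sesqui_def in2_def generator_cell_def)
    have PR: "\<guillemotleft>pre w : psrc (pre w) \<rightarrow>\<^bsub>free_sesqui K\<^esub> psrc (gsrc K (gen w))\<guillemotright>"
      and GS: "\<guillemotleft>gsrc K (gen w) : psrc (gsrc K (gen w)) \<rightarrow>\<^bsub>free_sesqui K\<^esub> psrc (post w)\<guillemotright>"
      and PO: "\<guillemotleft>post w : psrc (post w) \<rightarrow>\<^bsub>free_sesqui K\<^esub> ptgt (post w)\<guillemotright>"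
      using w generator_ends[OF c] by (auto simp: free_sesqui_def in1_def steps_def)
    have gr: "on2 H ?gr = on2 H ?g \<lhd>\<^bsub>S\<^esub> on1 H (pre w)" by (rule on2_whr2[OF PR G GS])
    have "P (on2 H ?g)" using gen c by (auto simp: generating_cells_def)
    then have 1: "P (on2 H ?gr)" unfolding gr
      by (rule whr[rotated 3]) (use on2_in[OF G] on1_in[OF PR] on1_in[OF GS] in \<open>auto simp: in1_def in2_def\<close>)
    \<comment> \<open>A single step is its generator whiskered first by \<open>pre w\<close> and
      then by \<open>post w\<close>; the identity paths around the bare generator are absorbed by
      path composition.\<close>
    have "FCell (step_src K w) [w] (step_tgt K w) = post w \<rhd>\<^bsub>free_sesqui K\<^esub> ?gr"
      using w generator_ends[OF c] by (cases w) (auto simp: free_sesqui_def generator_cell_def step_src_def step_tgt_def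
          path_comp_def path.expand steps_def)
    also have "on2 H \<dots> = on1 H (post w) \<rhd>\<^bsub>S\<^esub> on2 H ?gr"
      by (rule on2_whl2[OF FS.whr2_in[OF PR G GS] FS.comp1_in[OF PR GS] PO])
    finally show ?thesis
      using whl[OF _ _ _ 1, of "on1 H (post w)"] on2_in[OF FS.whr2_in[OF PR G GS]] on1_in[OF FS.comp1_in[OF PR GS]] on1_in[OF PO]
      by (simp add: in1_def in2_def)
  qed
  have *: "step_walk K q ws r \<Longrightarrow> P (on2 H (FCell q ws r))" for q ws r
  proof (induction ws arbitrary: q)
    case Nil then show ?case using on2_id2[of q] id on1_path[of q] by (auto simp: free_sesqui_def)
  next
    case (Cons w ws)
    then have w: "w \<in> steps K" "step_src K w = q" "step_walk K (step_tgt K w) ws r" by auto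
    have m: "FCell q [w] (step_tgt K w) \<in> fcells K" "FCell (step_tgt K w) ws r \<in> fcells K"
      using w step_ends by (auto simp: fcells_def)
    then have "on2 H (FCell q (w # ws) r) = on2 H (FCell (step_tgt K w) ws r) \<odot>\<^bsub>S\<^esub> on2 H (FCell q [w] (step_tgt K w))"
      using on2_vcomp2[of "FCell q [w] (step_tgt K w)" q "step_tgt K w" "FCell (step_tgt K w) ws r" r]
      by (auto simp: free_sesqui_def in2_def)
    then show ?case using comp[OF _ _ _ one[OF w(1)] Cons.IH[OF w(3)]] on2_cell[OF m(1)] on2_cell[OF m(2)] w(2) by simp
  qed
  obtain c where "c \<in> fcells K" "\<phi> = on2 H c" using assms(1) by (rule cell_cases)
  then show ?thesis using *[of "fsrc c" "fsteps c" "ftgt c"] by (simp add: fcells_def)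
qed

text \<open>The counterpart of \<open>ex1_cell_lift\<close> one dimension lower: \<open>u\<close>
  and \<open>m\<close> make the pairs of a morphism and an element of its fibre into a category over
  the morphisms of \<open>S\<close>. Here the section is built by recursion on edge lists; it is
  used for adjoint equivalences and for the 3-cells of trimodifications.\<close>

lemma ex1_mor_lift:
  fixes D :: "'a \<Rightarrow> 'd set"
  assumes u: "\<And>X. X \<in> Ob S \<Longrightarrow> u X \<in> D (id1 S X)"
    and m: "\<And>f g x y. \<lbrakk>f \<in> Mor S; g \<in> Mor S; tgt0 S f = src0 S g; x \<in> D f; y \<in> D g\<rbrakk> \<Longrightarrow> m g y f x \<in> D (g \<bullet>\<^bsub>S\<^esub> f)"
    and ul: "\<And>f x. \<lbrakk>f \<in> Mor S; x \<in> D f\<rbrakk> \<Longrightarrow> m (id1 S (tgt0 S f)) (u (tgt0 S f)) f x = x"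
    and ur: "\<And>f x. \<lbrakk>f \<in> Mor S; x \<in> D f\<rbrakk> \<Longrightarrow> m f x (id1 S (src0 S f)) (u (src0 S f)) = x"
    and assoc: "\<And>f g h x y z. \<lbrakk>f \<in> Mor S; g \<in> Mor S; h \<in> Mor S; tgt0 S f = src0 S g; tgt0 S g = src0 S h;
        x \<in> D f; y \<in> D g; z \<in> D h\<rbrakk> \<Longrightarrow> m (h \<bullet>\<^bsub>S\<^esub> g) (m h z g y) f x = m h z (g \<bullet>\<^bsub>S\<^esub> f) (m g y f x)"
    and d: "\<And>f. f \<in> generating_mors K H \<Longrightarrow> d f \<in> D f"
    and ops: "\<And>X. X \<in> Ob S \<Longrightarrow> id1 S X \<in> Mor S"
      "\<And>f g. \<lbrakk>f \<in> Mor S; g \<in> Mor S; tgt0 S f = src0 S g\<rbrakk> \<Longrightarrow> g \<bullet>\<^bsub>S\<^esub> f \<in> Mor S"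
  shows "\<exists>!L. L \<in> extensional (Mor S) \<and> (\<forall>f \<in> generating_mors K H. L f = d f) \<and> (\<forall>f \<in> Mor S. L f \<in> D f)
    \<and> (\<forall>X \<in> Ob S. L (id1 S X) = u X)
    \<and> (\<forall>f g. f \<in> Mor S \<and> g \<in> Mor S \<and> tgt0 S f = src0 S g \<longrightarrow> L (g \<bullet>\<^bsub>S\<^esub> f) = m g (L g) f (L f))"
    (is "\<exists>!L. ?P L")
proof -
  \<comment> \<open>The recursor returns a function of both endpoints: \<open>m\<close> takes the
    underlying morphisms as arguments, and an edge list does not determine them, since the empty
    list says nothing about its vertex.\<close>
  define E where "E = rec_list (\<lambda>x y. u (on0 H x))
      (\<lambda>e es r x y. m (on1 H (Path (etgt K e) es y)) (r (etgt K e) y) (on1 H (edge_path K e)) (d (on1 H (edge_path K e))))"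
  have E_Nil: "E [] x y = u (on0 H x)" for x y by (simp add: E_def)
  have E_Cons: "E (e # es) x y = m (on1 H (Path (etgt K e) es y)) (E es (etgt K e) y) (on1 H (edge_path K e)) (d (on1 H (edge_path K e)))"
    for e es x y by (simp add: E_def)
  have d': "e \<in> edges K \<Longrightarrow> d (on1 H (edge_path K e)) \<in> D (on1 H (edge_path K e))" for e
    using d by (auto simp: generating_mors_def)
  have E_in: "walk K x es y \<Longrightarrow> E es x y \<in> D (on1 H (Path x es y))" for x es y
  proof (induction es arbitrary: x)
    case Nil
    then show ?case using u on0_in[of x] on1_Nil by (auto simp: E_Nil free_sesqui_def)
  next
    case (Cons e es)
    from path_Cons[OF Cons.prems] have c: "Path x (e # es) y = path_comp (Path (etgt K e) es y) (edge_path K e)"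
      "edge_path K e \<in> paths K" "Path (etgt K e) es y \<in> paths K" by auto
    have t: "ptgt (edge_path K e) = psrc (Path (etgt K e) es y)" by (simp add: edge_path_def)
    have e: "e \<in> edges K" "walk K (etgt K e) es y" using Cons.prems by auto
    show ?case unfolding c(1) on1_path_comp[OF c(2,3) t] E_Cons
      using on1_path[OF c(2)] on1_path[OF c(3)] t by (intro m Cons.IH d' e) auto
  qed
  \<comment> \<open>The recursion peels off one edge at a time, whereas \<open>comp1\<close> joins
    arbitrary paths. The right unit law handles the empty list and associativity each further edge;
    the left unit law is what makes single edges come out right below.\<close>
  have E_append: "walk K x es y \<Longrightarrow> walk K y fs z \<Longrightarrow>
     E (es @ fs) x z = m (on1 H (Path y fs z)) (E fs y z) (on1 H (Path x es y)) (E es x y)" for x es y fs z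
  proof (induction es arbitrary: x)
    case Nil
    then have x: "x \<in> vertices K" "x = y" by auto
    have "Path y fs z \<in> paths K" using Nil by (simp add: paths_def)
    from on1_path[OF this] show ?case using ur[OF _ E_in[OF Nil(2)]] on1_Nil x by (simp add: E_Nil)
  next
    case (Cons e es)
    from path_Cons[OF Cons.prems(1)] have c: "Path x (e # es) y = path_comp (Path (etgt K e) es y) (edge_path K e)"
      "edge_path K e \<in> paths K" "Path (etgt K e) es y \<in> paths K" by auto
    have t: "ptgt (edge_path K e) = psrc (Path (etgt K e) es y)" by (simp add: edge_path_def)
    have e: "e \<in> edges K" "walk K (etgt K e) es y" using Cons.prems(1) by auto
    have f: "Path y fs z \<in> paths K" using Cons.prems by (simp add: paths_def)
    have pf: "Path (etgt K e) (es @ fs) z = path_comp (Path y fs z) (Path (etgt K e) es y)" by (simp add: path_comp_def)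
    have "E ((e # es) @ fs) x z = m (on1 H (Path y fs z) \<bullet>\<^bsub>S\<^esub> on1 H (Path (etgt K e) es y))
        (m (on1 H (Path y fs z)) (E fs y z) (on1 H (Path (etgt K e) es y)) (E es (etgt K e) y))
        (on1 H (edge_path K e)) (d (on1 H (edge_path K e)))"
      using Cons.IH[OF e(2) Cons.prems(2)] pf on1_path_comp[OF c(3) f] by (simp add: E_Cons)
    also have "\<dots> = m (on1 H (Path y fs z)) (E fs y z) (on1 H (Path (etgt K e) es y) \<bullet>\<^bsub>S\<^esub> on1 H (edge_path K e))
        (m (on1 H (Path (etgt K e) es y)) (E es (etgt K e) y) (on1 H (edge_path K e)) (d (on1 H (edge_path K e))))"
      using on1_path[OF c(2)] on1_path[OF c(3)] on1_path[OF f] t E_in[OF e(2)] E_in[OF Cons.prems(2)] d'[OF e(1)]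
      by (intro assoc) auto
    also have "on1 H (Path (etgt K e) es y) \<bullet>\<^bsub>S\<^esub> on1 H (edge_path K e) = on1 H (Path x (e # es) y)"
      unfolding c(1) on1_path_comp[OF c(2,3) t] ..
    finally show ?case by (simp add: E_Cons)
  qed
  have E_edge: "e \<in> edges K \<Longrightarrow> E [e] (esrc K e) (etgt K e) = d (on1 H (edge_path K e))" for e
    using ul[of "on1 H (edge_path K e)" "d (on1 H (edge_path K e))"] d'[of e] on1_path[OF edge_path_in[of e]]
      on1_Nil[of "etgt K e"] edge_ends[of e]
    by (simp add: E_Cons E_Nil edge_path_def)
  \<comment> \<open>A morphism comes from exactly one path, since \<open>on1 H\<close> is injective
    on paths, so the value computed along that path is a function of the morphism.\<close>
  define L where "L f = (let p = the_inv_into (paths K) (on1 H) f in E (pedges p) (psrc p) (ptgt p))" for f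
  have inj: "inj_on (on1 H) (paths K)" using on1_inj by (auto simp: inj_on_def)
  have L: "p \<in> paths K \<Longrightarrow> L (on1 H p) = E (pedges p) (psrc p) (ptgt p)" for p
    by (simp add: L_def the_inv_into_f_f[OF inj])
  have 1: "L f \<in> D f" if f: "f \<in> Mor S" for f
  proof -
    obtain p where "p \<in> paths K" "f = on1 H p" using f by (rule mor_cases)
    then show ?thesis using L E_in[of "psrc p" "pedges p" "ptgt p"] by (simp add: paths_def)
  qed
  have 2: "L f = d f" if f: "f \<in> generating_mors K H" for f
  proof -
    obtain e where e: "e \<in> edges K" "f = on1 H (edge_path K e)" using f by (auto simp: generating_mors_def)
    then show ?thesis using L[OF edge_path_in[OF e(1)]] E_edge[OF e(1)] by (simp add: edge_path_def)
  qed
  have 3: "L (id1 S X) = u X" if X: "X \<in> Ob S" for X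
  proof -
    obtain x where "x \<in> vertices K" "X = on0 H x" using X by (rule ob_cases)
    then show ?thesis using L[of "Path x [] x"] on1_Nil[of x] by (simp add: path_id E_Nil)
  qed
  have 4: "L (g \<bullet>\<^bsub>S\<^esub> f) = m g (L g) f (L f)" if fg: "f \<in> Mor S" "g \<in> Mor S" "tgt0 S f = src0 S g" for f g
  proof -
    obtain p where p: "p \<in> paths K" "f = on1 H p" using fg(1) by (rule mor_cases)
    obtain q where q: "q \<in> paths K" "g = on1 H q" using fg(2) by (rule mor_cases)
    \<comment> \<open>Composability in \<open>S\<close> equates only the images of the two vertices;
      injectivity of \<open>on0 H\<close> turns this into composability of the paths.\<close>
    have t: "ptgt p = psrc q"
      using fg(3) on1_path[OF p(1)] on1_path[OF q(1)] p q path_ends on0_inj by metis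
    have "Path (psrc p) (pedges p) (psrc q) = p" using t by (metis path.collapse)
    then show ?thesis unfolding p(2) q(2) on1_path_comp[OF p(1) q(1) t, symmetric]
      using E_append[of "psrc p" "pedges p" "ptgt p" "pedges q" "ptgt q"] L[OF p(1)] L[OF q(1)]
        L[OF path_comp_in[OF p(1) q(1) t]] p q t
      by (simp add: paths_def path_comp_def)
  qed
  show ?thesis
  proof (rule ex1I[of _ "restrict L (Mor S)"])
    show "?P (restrict L (Mor S))" using 1 2 3 4 generating_mors_in ops by auto
    fix M assume M: "?P M"
    have "M f = L f" if "f \<in> Mor S" for f
      using that by (induction rule: mor_induct) (use 2 3 4 M in auto)
    then show "M = restrict L (Mor S)" using M by (auto simp: extensional_def restrict_def)
  qed
qed

text \<open>The free sesquicategory is mapped into \<open>displayed_cells\<close>; the first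
  component of this map is \<open>H\<close> again, so the second component, read along the inverse
  of \<open>on2 H\<close>, is the desired section. Preservation of each operation is inherited from
  the map. Uniqueness is \<open>cell_induct\<close>.\<close>

lemma ex1_cell_lift:
  fixes D :: "'b \<Rightarrow> 'd set"
  assumes S: "sesquicategory S" and "sesquicategory (displayed_cells S D i l r v)"
    and d: "\<And>\<phi>. \<phi> \<in> generating_cells K H \<Longrightarrow> d \<phi> \<in> D \<phi>"
  shows "\<exists>!L. L \<in> extensional (Cell2 S) \<and> (\<forall>\<phi> \<in> generating_cells K H. L \<phi> = d \<phi>) \<and> (\<forall>\<phi> \<in> Cell2 S. L \<phi> \<in> D \<phi>)
    \<and> (\<forall>f \<in> Mor S. L (id2 S f) = i f)
    \<and> (\<forall>\<phi> \<psi>. \<phi> \<in> Cell2 S \<and> \<psi> \<in> Cell2 S \<and> tgt1 S \<phi> = src1 S \<psi> \<longrightarrow> L (\<psi> \<odot>\<^bsub>S\<^esub> \<phi>) = v \<psi> (L \<psi>) \<phi> (L \<phi>))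
    \<and> (\<forall>\<phi> g. \<phi> \<in> Cell2 S \<and> g \<in> Mor S \<and> tgt0 S (src1 S \<phi>) = src0 S g \<longrightarrow> L (g \<rhd>\<^bsub>S\<^esub> \<phi>) = l g \<phi> (L \<phi>))
    \<and> (\<forall>\<phi> f. \<phi> \<in> Cell2 S \<and> f \<in> Mor S \<and> tgt0 S f = src0 S (src1 S \<phi>) \<longrightarrow> L (\<phi> \<lhd>\<^bsub>S\<^esub> f) = r \<phi> (L \<phi>) f)"
    (is "\<exists>!L. ?P L")
proof -
  let ?T = "displayed_cells S D i l r v"
  interpret S: sesquicategory S by fact
  interpret T: sesquicategory ?T by fact
  define m1 where "m1 e = on1 H (edge_path K e)" for e
  define m2 where "m2 c = (on2 H (generator_cell K c), d (on2 H (generator_cell K c)))" for c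
  have H: "sesquifunctor (free_sesqui K) S H" by unfold_locales
  have m0_in: "x \<in> vertices K \<Longrightarrow> on0 H x \<in> Ob S" for x using on0_in by (simp add: free_sesqui_def)
  have m1_in: "e \<in> edges K \<Longrightarrow> \<guillemotleft>m1 e : on0 H (esrc K e) \<rightarrow>\<^bsub>S\<^esub> on0 H (etgt K e)\<guillemotright>" for e
    using on1_path[OF edge_path_in[of e]] by (simp add: m1_def in1_def edge_path_def)
  have w: "walk K x es y \<Longrightarrow> eval_walk K S (on0 H) m1 x es = on1 H (Path x es y)" for x es y
  proof (induction es arbitrary: x)
    case Nil then show ?case using on1_Nil by auto
  next
    case (Cons e es)
    from path_Cons[OF Cons.prems] have c: "Path x (e # es) y = path_comp (Path (etgt K e) es y) (edge_path K e)"
      "edge_path K e \<in> paths K" "Path (etgt K e) es y \<in> paths K" by auto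
    have t: "ptgt (edge_path K e) = psrc (Path (etgt K e) es y)" by (simp add: edge_path_def)
    show ?case unfolding c(1) on1_path_comp[OF c(2,3) t] using Cons by (simp add: m1_def)
  qed
  \<comment> \<open>The displayed sesquicategory has the objects, morphisms and composition of
    \<open>S\<close>, so paths evaluate alike in both.\<close>
  have "eval_walk K ?T (on0 H) m1 x es = eval_walk K S (on0 H) m1 x es" for x es
    by (induction es arbitrary: x) auto
  with w have ew: "p \<in> paths K \<Longrightarrow> eval_path K S (on0 H) m1 p = on1 H p"
     "p \<in> paths K \<Longrightarrow> eval_path K ?T (on0 H) m1 p = on1 H p" for p
    by (auto simp: eval_path_def paths_def)
  have gc: "c \<in> generators K \<Longrightarrow> \<guillemotleft>on2 H (generator_cell K c) : on1 H (gsrc K c) \<Rightarrow>\<^bsub>S\<^esub> on1 H (gtgt K c)\<guillemotright>" for c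
    using on2_cell[OF generator_step[of c]] by (simp add: in2_def generator_cell_def)
  have gp: "c \<in> generators K \<Longrightarrow> gsrc K c \<in> paths K \<and> gtgt K c \<in> paths K" for c
    using generator_ends by auto
  have m2_in: "c \<in> generators K \<Longrightarrow> \<guillemotleft>m2 c : eval_path K ?T (on0 H) m1 (gsrc K c) \<Rightarrow>\<^bsub>?T\<^esub> eval_path K ?T (on0 H) m1 (gtgt K c)\<guillemotright>" for c
    using gc[of c] gp[of c] ew d by (auto simp: in2_def m2_def generating_cells_def)
  have m2_in': "c \<in> generators K \<Longrightarrow> \<guillemotleft>fst (m2 c) : eval_path K S (on0 H) m1 (gsrc K c) \<Rightarrow>\<^bsub>S\<^esub> eval_path K S (on0 H) m1 (gtgt K c)\<guillemotright>" for c
    using gc[of c] gp[of c] ew by (auto simp: in2_def m2_def)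
  have m1_T: "e \<in> edges K \<Longrightarrow> \<guillemotleft>m1 e : on0 H (esrc K e) \<rightarrow>\<^bsub>?T\<^esub> on0 H (etgt K e)\<guillemotright>" for e
    using m1_in by (simp add: in1_def)
  have m0_T: "x \<in> vertices K \<Longrightarrow> on0 H x \<in> Ob ?T" for x using m0_in by simp
  define L' where "L' = \<lparr>on0 = on0 H, on1 = eval_path K ?T (on0 H) m1,
     on2 = (\<lambda>c. eval_steps K ?T (on0 H) m1 m2 (fsrc c) (fsteps c))\<rparr>"
  interpret L': sesquifunctor "free_sesqui K" ?T L'
    unfolding L'_def by (rule free_sesqui_universal(1)[OF T.sesquicategory_axioms m0_T m1_T m2_in])
  have L'_gen: "c \<in> generators K \<Longrightarrow> on2 L' (generator_cell K c) = m2 c" for c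
    using free_sesqui_universal(3)[OF T.sesquicategory_axioms m0_T m1_T m2_in, of c]
    by (simp add: L'_def generator_cell_def)
  \<comment> \<open>The map \<open>L'\<close> followed by the projection to \<open>S\<close>. It
    agrees with \<open>H\<close> on all generating data, so the uniqueness clause of the universal
    property identifies the two on 2-cells, in \<open>fst_L'\<close>.\<close>
  let ?E = "\<lparr>on0 = on0 L', on1 = on1 L', on2 = (\<lambda>c. fst (on2 L' c))\<rparr>"
  have E: "sesquifunctor (free_sesqui K) S ?E"
  proof (unfold_locales, goal_cases)
    case (1 X) then show ?case using L'.on0_in by simp
  next
    case (2 f X Y) then show ?case using L'.on1_in by (simp add: in1_def)
  next
    case (3 \<alpha> f g) then show ?case using L'.on2_in by (fastforce simp: in2_def)
  next
    case (4 X) then show ?case using L'.on1_id1 by simp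
  next
    case (5 f X Y g Z) then show ?case using L'.on1_comp1 by simp
  next
    case (6 f) then show ?case using L'.on2_id2 by simp
  next
    case (7 \<alpha> f g \<beta> h) then show ?case using L'.on2_vcomp2 by simp
  next
    case (8 \<alpha> f f' X Y g Z) then show ?case using L'.on2_whl2[OF 8] by simp
  next
    case (9 f X Y \<beta> g g' Z) then show ?case using L'.on2_whr2[OF 9] by simp
  qed
  have fst_L': "c \<in> fcells K \<Longrightarrow> fst (on2 L' c) = on2 H c" for c
  proof -
    note univ = free_sesqui_universal(4)[OF S.sesquicategory_axioms m0_in m1_in m2_in']
    have "\<forall>c \<in> fcells K. on2 H c = eval_steps K S (on0 H) m1 (\<lambda>c. fst (m2 c)) (fsrc c) (fsteps c)"
      using univ[OF _ _ _ H] by (simp add: m1_def m2_def)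
    moreover have "\<forall>c \<in> fcells K. on2 ?E c = eval_steps K S (on0 H) m1 (\<lambda>c. fst (m2 c)) (fsrc c) (fsteps c)"
      using univ[OF _ _ _ E] L'_gen ew edge_path_in by (simp add: L'_def m1_def)
    ultimately show "c \<in> fcells K \<Longrightarrow> fst (on2 L' c) = on2 H c" by simp
  qed
  have on1_L': "p \<in> paths K \<Longrightarrow> on1 L' p = on1 H p" for p using ew by (simp add: L'_def)
  define L where "L \<phi> = snd (on2 L' (the_inv_into (fcells K) (on2 H) \<phi>))" for \<phi>
  have inj: "inj_on (on2 H) (fcells K)" using on2_inj by (auto simp: inj_on_def)
  have L: "c \<in> fcells K \<Longrightarrow> on2 L' c = (on2 H c, L (on2 H c))" for c
    using fst_L' by (simp add: L_def the_inv_into_f_f[OF inj] prod_eq_iff)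
  have L'_in: "c \<in> fcells K \<Longrightarrow> on2 L' c \<in> Cell2 ?T" for c
    using L'.on2_in[of c "fsrc c" "ftgt c"] by (simp add: free_sesqui_def in2_def)
  let ?S = "free_sesqui K"
  have 1: "L \<phi> \<in> D \<phi>" if "\<phi> \<in> Cell2 S" for \<phi>
    using cell_cases[OF that] L L'_in by (smt (verit) displayed_cells_sel(13) mem_Collect_eq case_prodD)
  have 2: "L \<phi> = d \<phi>" if "\<phi> \<in> generating_cells K H" for \<phi>
    using that L'_gen L[OF generator_step] by (auto simp: generating_cells_def m2_def)
  have 3: "L (id2 S f) = i f" if "f \<in> Mor S" for f
  proof -
    obtain p where p: "p \<in> paths K" "f = on1 H p" using \<open>f \<in> Mor S\<close> by (rule mor_cases)
    have "FCell p [] p \<in> fcells K" using p by (simp add: fcells_def)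
    from L[OF this] show ?thesis using L'.on2_id2[of p] on2_id2[of p] on1_L'[OF p(1)] p by (auto simp: free_sesqui_def)
  qed
  have 4: "L (\<psi> \<odot>\<^bsub>S\<^esub> \<phi>) = v \<psi> (L \<psi>) \<phi> (L \<phi>)" if *: "\<phi> \<in> Cell2 S" "\<psi> \<in> Cell2 S" "tgt1 S \<phi> = src1 S \<psi>" for \<phi> \<psi>
  proof -
    obtain c where c: "c \<in> fcells K" "\<phi> = on2 H c" using *(1) by (rule cell_cases)
    obtain e where e: "e \<in> fcells K" "\<psi> = on2 H e" using *(2) by (rule cell_cases)
    \<comment> \<open>Here and in the two whiskering cases, composability in \<open>S\<close> is
      pulled back to the free sesquicategory along the injective maps of \<open>H\<close>; only then
      can functoriality of \<open>L'\<close> be applied.\<close>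
    have "ftgt c = fsrc e" using *(3) on2_cell[OF c(1)] on2_cell[OF e(1)] fcell_ends[OF c(1)] fcell_ends[OF e(1)] on1_inj c e by metis
    then have i: "\<guillemotleft>c : fsrc c \<Rightarrow>\<^bsub>?S\<^esub> fsrc e\<guillemotright>" "\<guillemotleft>e : fsrc e \<Rightarrow>\<^bsub>?S\<^esub> ftgt e\<guillemotright>"
      using c e by (auto simp: in2_def free_sesqui_def)
    then have "e \<odot>\<^bsub>?S\<^esub> c \<in> fcells K"
      using sesquicategory.vcomp2_in[OF sesquicategory_free_sesqui i] by (simp add: in2_def free_sesqui_def)
    from L[OF this] L[OF c(1)] L[OF e(1)] show ?thesis using L'.on2_vcomp2[OF i] on2_vcomp2[OF i] c e by simp
  qed
  have 5: "L (g \<rhd>\<^bsub>S\<^esub> \<phi>) = l g \<phi> (L \<phi>)" if *: "\<phi> \<in> Cell2 S" "g \<in> Mor S" "tgt0 S (src1 S \<phi>) = src0 S g" for \<phi> g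
  proof -
    obtain c where c: "c \<in> fcells K" "\<phi> = on2 H c" using *(1) by (rule cell_cases)
    obtain q where q: "q \<in> paths K" "g = on1 H q" using *(2) by (rule mor_cases)
    have "ptgt (fsrc c) = psrc q"
      using *(3) on2_cell[OF c(1)] on1_path[OF q(1)] fcell_ends[OF c(1)] on1_path path_ends on0_inj c q by metis
    then have i: "\<guillemotleft>c : fsrc c \<Rightarrow>\<^bsub>?S\<^esub> ftgt c\<guillemotright>" "\<guillemotleft>fsrc c : psrc (fsrc c) \<rightarrow>\<^bsub>?S\<^esub> psrc q\<guillemotright>" "\<guillemotleft>q : psrc q \<rightarrow>\<^bsub>?S\<^esub> ptgt q\<guillemotright>"
      using c q fcell_ends[OF c(1)] by (auto simp: in1_def in2_def free_sesqui_def)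
    then have "q \<rhd>\<^bsub>?S\<^esub> c \<in> fcells K"
      using sesquicategory.whl2_in[OF sesquicategory_free_sesqui i] by (simp add: in2_def free_sesqui_def)
    from L[OF this] L[OF c(1)] show ?thesis using L'.on2_whl2[OF i] on2_whl2[OF i] on1_L'[OF q(1)] c q by simp
  qed
  have 6: "L (\<phi> \<lhd>\<^bsub>S\<^esub> f) = r \<phi> (L \<phi>) f" if *: "\<phi> \<in> Cell2 S" "f \<in> Mor S" "tgt0 S f = src0 S (src1 S \<phi>)" for \<phi> f
  proof -
    obtain c where c: "c \<in> fcells K" "\<phi> = on2 H c" using *(1) by (rule cell_cases)
    obtain q where q: "q \<in> paths K" "f = on1 H q" using *(2) by (rule mor_cases)
    have "ptgt q = psrc (fsrc c)"
      using *(3) on2_cell[OF c(1)] on1_path[OF q(1)] fcell_ends[OF c(1)] on1_path path_ends on0_inj c q by metis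
    then have i: "\<guillemotleft>q : psrc q \<rightarrow>\<^bsub>?S\<^esub> psrc (fsrc c)\<guillemotright>" "\<guillemotleft>c : fsrc c \<Rightarrow>\<^bsub>?S\<^esub> ftgt c\<guillemotright>" "\<guillemotleft>fsrc c : psrc (fsrc c) \<rightarrow>\<^bsub>?S\<^esub> ptgt (fsrc c)\<guillemotright>"
      using c q fcell_ends[OF c(1)] by (auto simp: in1_def in2_def free_sesqui_def)
    then have "c \<lhd>\<^bsub>?S\<^esub> q \<in> fcells K"
      using sesquicategory.whr2_in[OF sesquicategory_free_sesqui i] by (simp add: in2_def free_sesqui_def)
    from L[OF this] L[OF c(1)] show ?thesis using L'.on2_whr2[OF i] on2_whr2[OF i] on1_L'[OF q(1)] c q by simp
  qed
  have ops: "f \<in> Mor S \<Longrightarrow> id2 S f \<in> Cell2 S"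
    "\<lbrakk>\<phi> \<in> Cell2 S; \<psi> \<in> Cell2 S; tgt1 S \<phi> = src1 S \<psi>\<rbrakk> \<Longrightarrow> \<psi> \<odot>\<^bsub>S\<^esub> \<phi> \<in> Cell2 S"
    "\<lbrakk>\<phi> \<in> Cell2 S; f \<in> Mor S; tgt0 S (src1 S \<phi>) = src0 S f\<rbrakk> \<Longrightarrow> f \<rhd>\<^bsub>S\<^esub> \<phi> \<in> Cell2 S"
    "\<lbrakk>\<phi> \<in> Cell2 S; f \<in> Mor S; tgt0 S f = src0 S (src1 S \<phi>)\<rbrakk> \<Longrightarrow> \<phi> \<lhd>\<^bsub>S\<^esub> f \<in> Cell2 S" for f \<phi> \<psi>
    using S.id2_in S.vcomp2_in S.whl2_in S.whr2_in S.cell2_ends unfolding in1_def in2_def by metis+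
  show ?thesis
  proof (rule ex1I[of _ "restrict L (Cell2 S)"])
    show "?P (restrict L (Cell2 S))" using 1 2 3 4 5 6 generating_cells_in ops by simp
    fix M assume M: "?P M"
    have "M \<phi> = L \<phi>" if "\<phi> \<in> Cell2 S" for \<phi>
      using that by (induction rule: cell_induct) (use 2 3 4 5 6 M in simp_all)
    then show "M = restrict L (Cell2 S)" using M by (auto simp: extensional_def restrict_def)
  qed
qed

end

section \<open>The 2-cell components of a semi-strict transformation\<close>

locale gray_functor_on = A: gray_category A + B: gray_category B + gray_functor A B F
  for A :: "('o, 'a, 'b, 'c) gray" and B :: "('o1, 'a1, 'b1, 'c1) gray"
    and F :: "('o, 'a, 'b, 'c, 'o1, 'a1, 'b1, 'c1) gmap"
begin

lemma hom_functor: "f \<in> Mor A \<Longrightarrow> two_functor (hom A (src0 A f) (tgt0 A f))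
    (hom B (on0 F (src0 A f)) (on0 F (tgt0 A f))) (on1 F) (on2 F) (on3 F)"
  by (rule on_homs) auto

lemma on0_in [simp]: "X \<in> Ob A \<Longrightarrow> on0 F X \<in> Ob B"
  by (rule on_objects)

lemma on1_ends [simp]: assumes "f \<in> Mor A"
  shows "on1 F f \<in> Mor B" "src0 B (on1 F f) = on0 F (src0 A f)" "tgt0 B (on1 F f) = on0 F (tgt0 A f)"
  using two_functor.obj[OF hom_functor[OF assms], of f] assms by auto

lemma on1_id1 [simp]: "X \<in> Ob A \<Longrightarrow> on1 F (id1 A X) = id1 B (on0 F X)"
  by (rule pres_id1)

lemma on1_comp1 [simp]: "\<lbrakk>f \<in> Mor A; g \<in> Mor A; tgt0 A f = src0 A g\<rbrakk> \<Longrightarrow> on1 F (g \<bullet>\<^bsub>A\<^esub> f) = on1 F g \<bullet>\<^bsub>B\<^esub> on1 F f"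
  using pres_comp1 by (auto simp: in1_def)

lemma on2_ends [simp]: assumes "\<alpha> \<in> Cell2 A"
  shows "on2 F \<alpha> \<in> Cell2 B" "src1 B (on2 F \<alpha>) = on1 F (src1 A \<alpha>)" "tgt1 B (on2 F \<alpha>) = on1 F (tgt1 A \<alpha>)"
  using two_functor.arr[OF hom_functor[of "src1 A \<alpha>"], of \<alpha> "src1 A \<alpha>" "tgt1 A \<alpha>"] assms by auto

lemma on2_id2 [simp]: "f \<in> Mor A \<Longrightarrow> on2 F (id2 A f) = id2 B (on1 F f)"
  using two_functor.tid[OF hom_functor[of f], of f] by auto

lemma on2_vcomp2 [simp]: "\<lbrakk>\<alpha> \<in> Cell2 A; \<beta> \<in> Cell2 A; tgt1 A \<alpha> = src1 A \<beta>\<rbrakk> \<Longrightarrow> on2 F (\<beta> \<odot>\<^bsub>A\<^esub> \<alpha>) = on2 F \<beta> \<odot>\<^bsub>B\<^esub> on2 F \<alpha>"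
  using two_functor.tcomp[OF hom_functor[of "src1 A \<alpha>"], of \<alpha> "src1 A \<alpha>" "tgt1 A \<alpha>" \<beta> "tgt1 A \<beta>"]
    A.mor_ends2[of \<alpha>] by (auto simp del: A.mor_ends2)

lemma on2_wh2 [simp]:
  "\<lbrakk>\<alpha> \<in> Cell2 A; g \<in> Mor A; tgt0 A (src1 A \<alpha>) = src0 A g\<rbrakk> \<Longrightarrow> on2 F (g \<rhd>\<^bsub>A\<^esub> \<alpha>) = on1 F g \<rhd>\<^bsub>B\<^esub> on2 F \<alpha>"
  "\<lbrakk>\<alpha> \<in> Cell2 A; g \<in> Mor A; tgt0 A g = src0 A (src1 A \<alpha>)\<rbrakk> \<Longrightarrow> on2 F (\<alpha> \<lhd>\<^bsub>A\<^esub> g) = on2 F \<alpha> \<lhd>\<^bsub>B\<^esub> on1 F g"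
  using pres_whl2 pres_whr2 by (auto simp: in1_def)

end

locale transformation_objects = A: gray_category A + B: gray_category B + F: gray_functor_on A B F + G: gray_functor_on A B G
  for A :: "('o, 'a, 'b, 'c) gray" and B :: "('o1, 'a1, 'b1, 'c1) gray" (structure)
    and F G :: "('o, 'a, 'b, 'c, 'o1, 'a1, 'b1, 'c1) gmap" +
  fixes p0 :: "'o \<Rightarrow> 'a1"
  assumes p0_in: "X \<in> Ob A \<Longrightarrow> \<guillemotleft>p0 X : on0 F X \<rightarrow> on0 G X\<guillemotright>"
begin

lemma p0_ends [simp]: "X \<in> Ob A \<Longrightarrow> p0 X \<in> Mor B" "X \<in> Ob A \<Longrightarrow> src0 B (p0 X) = on0 F X"
  "X \<in> Ob A \<Longrightarrow> tgt0 B (p0 X) = on0 G X"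
  using p0_in by (auto simp: in1_def)

end

text \<open>This layer keeps just the left adjoints, under the name \<open>P\<close>: they are the
  top and bottom edges of the quintets in which the laws for the 2-cell components are
  written.\<close>

locale transformation_data = transformation_objects A B F G p0
  for A :: "('o, 'a, 'b, 'c) gray" and B :: "('o1, 'a1, 'b1, 'c1) gray" (structure)
    and F G :: "('o, 'a, 'b, 'c, 'o1, 'a1, 'b1, 'c1) gmap" and p0 +
  fixes P :: "'a \<Rightarrow> 'b1"
  assumes P_in: "f \<in> Mor A \<Longrightarrow> \<guillemotleft>P f : p0 (tgt0 A f) \<bullet> on1 F f \<Rightarrow> on1 G f \<bullet> p0 (src0 A f)\<guillemotright>"
    and P_id1 [simp]: "X \<in> Ob A \<Longrightarrow> P (id1 A X) = id2 B (p0 X)"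
    and P_comp1 [simp]: "\<lbrakk>f \<in> Mor A; g \<in> Mor A; tgt0 A f = src0 A g\<rbrakk>
      \<Longrightarrow> P (g \<bullet>\<^bsub>A\<^esub> f) = (on1 G g \<rhd> P f) \<odot> (P g \<lhd> on1 F f)"
begin

lemma P_ends [simp]: "f \<in> Mor A \<Longrightarrow> P f \<in> Cell2 B"
  "f \<in> Mor A \<Longrightarrow> src1 B (P f) = p0 (tgt0 A f) \<bullet> on1 F f"
  "f \<in> Mor A \<Longrightarrow> tgt1 B (P f) = on1 G f \<bullet> p0 (src0 A f)"
  using P_in by (auto simp: in2_def)

text \<open>
  Composition of 2-cells acts on components by vertical pasting, whiskering by horizontal pasting
  with an interchanger quintet.
\<close>

definition quint :: "'b \<Rightarrow> 'c1 \<Rightarrow> ('b1, 'c1) quintet" where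
  "quint \<phi> \<Gamma> = Quintet (P (src1 A \<phi>)) (p0 (tgt0 A (src1 A \<phi>)) \<rhd> on2 F \<phi>)
     (P (tgt1 A \<phi>)) (on2 G \<phi> \<lhd> p0 (src0 A (src1 A \<phi>))) \<Gamma>"

lemma quint_sel [simp]: "qtop (quint \<phi> \<Gamma>) = P (src1 A \<phi>)" "qleft (quint \<phi> \<Gamma>) = p0 (tgt0 A (src1 A \<phi>)) \<rhd> on2 F \<phi>"
  "qbot (quint \<phi> \<Gamma>) = P (tgt1 A \<phi>)" "qright (quint \<phi> \<Gamma>) = on2 G \<phi> \<lhd> p0 (src0 A (src1 A \<phi>))" "qcell (quint \<phi> \<Gamma>) = \<Gamma>"
  by (simp_all add: quint_def)

definition fibre :: "'b \<Rightarrow> 'c1 set" where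
  "fibre \<phi> = {\<Gamma>. B.is_quintet (quint \<phi> \<Gamma>) \<and> invertible3 B \<Gamma>}"

definition cell_v :: "'b \<Rightarrow> 'c1 \<Rightarrow> 'b \<Rightarrow> 'c1 \<Rightarrow> 'c1" where
  "cell_v \<psi> \<Delta> \<phi> \<Gamma> = qcell (B.vpaste (quint \<psi> \<Delta>) (quint \<phi> \<Gamma>))"

definition cell_l :: "'a \<Rightarrow> 'b \<Rightarrow> 'c1 \<Rightarrow> 'c1" where
  "cell_l g \<phi> \<Gamma> = qcell (B.hpaste (B.wlq (on1 G g) (quint \<phi> \<Gamma>)) (B.transpose (B.iq (P g) (on2 F \<phi>))))"

definition cell_r :: "'b \<Rightarrow> 'c1 \<Rightarrow> 'a \<Rightarrow> 'c1" where
  "cell_r \<phi> \<Gamma> f = qcell (B.hpaste (B.iq (on2 G \<phi>) (P f)) (B.wrq (quint \<phi> \<Gamma>) (on1 F f)))"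

lemma fibreD: assumes "\<Gamma> \<in> fibre \<phi>" shows "B.is_quintet (quint \<phi> \<Gamma>)" "invertible3 B \<Gamma>"
  using assms by (auto simp: fibre_def)

lemma fibre_iff: "\<phi> \<in> Cell2 A \<Longrightarrow> \<Gamma> \<in> fibre \<phi> \<longleftrightarrow>
  \<guillemotleft>\<Gamma> : P (tgt1 A \<phi>) \<odot> (p0 (tgt0 A (src1 A \<phi>)) \<rhd> on2 F \<phi>) \<cong> (on2 G \<phi> \<lhd> p0 (src0 A (src1 A \<phi>))) \<odot> P (src1 A \<phi>)\<guillemotright>"
  by (auto simp: fibre_def B.is_quintet_def iso3_iff in3_def)

lemma fibreI: "\<lbrakk>B.is_quintet (quint \<phi> \<Gamma>); invertible3 B \<Gamma>\<rbrakk> \<Longrightarrow> \<Gamma> \<in> fibre \<phi>"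
  by (simp add: fibre_def)

lemma is_quintet_quint [simp]: "\<Gamma> \<in> fibre \<phi> \<Longrightarrow> B.is_quintet (quint \<phi> \<Gamma>)"
  by (rule fibreD)

lemma quint_id [simp]: "f \<in> Mor A \<Longrightarrow> quint (id2 A f) \<langle>P f\<rangle> = B.vid (P f)"
  by (rule quintet_eqI) simp_all

text \<open>The operations on 3-cells are read off pasted quintets. By functoriality of
  \<open>F\<close> and \<open>G\<close> and multiplicativity of \<open>P\<close> the edges agree as
  well, so equations between 3-cells lift to whole quintets, where the pasting laws apply. The next
  two lemmas do the same for whiskering.\<close>

lemma quint_v:
  assumes "\<phi> \<in> Cell2 A" "\<psi> \<in> Cell2 A" "tgt1 A \<phi> = src1 A \<psi>"
  shows "quint (\<psi> \<odot>\<^bsub>A\<^esub> \<phi>) (cell_v \<psi> \<Delta> \<phi> \<Gamma>) = B.vpaste (quint \<psi> \<Delta>) (quint \<phi> \<Gamma>)"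
  using assms A.composable_ends[OF assms] by (intro quintet_eqI) (simp_all add: cell_v_def)

lemma quint_l:
  assumes "\<phi> \<in> Cell2 A" "g \<in> Mor A" "tgt0 A (src1 A \<phi>) = src0 A g"
  shows "quint (g \<rhd>\<^bsub>A\<^esub> \<phi>) (cell_l g \<phi> \<Gamma>) = B.hpaste (B.wlq (on1 G g) (quint \<phi> \<Gamma>)) (B.transpose (B.iq (P g) (on2 F \<phi>)))"
  using assms by (intro quintet_eqI) (simp_all add: cell_l_def)

lemma quint_r:
  assumes "\<phi> \<in> Cell2 A" "f \<in> Mor A" "tgt0 A f = src0 A (src1 A \<phi>)"
  shows "quint (\<phi> \<lhd>\<^bsub>A\<^esub> f) (cell_r \<phi> \<Gamma> f) = B.hpaste (B.iq (on2 G \<phi>) (P f)) (B.wrq (quint \<phi> \<Gamma>) (on1 F f))"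
  using assms by (intro quintet_eqI) (simp_all add: cell_r_def)

lemma fibre_id: "f \<in> Mor A \<Longrightarrow> \<langle>P f\<rangle> \<in> fibre (id2 A f)"
  by (rule fibreI) simp_all

lemma fibre_v:
  assumes "\<phi> \<in> Cell2 A" "\<psi> \<in> Cell2 A" "tgt1 A \<phi> = src1 A \<psi>" "\<Gamma> \<in> fibre \<phi>" "\<Delta> \<in> fibre \<psi>"
  shows "cell_v \<psi> \<Delta> \<phi> \<Gamma> \<in> fibre (\<psi> \<odot>\<^bsub>A\<^esub> \<phi>)"
proof -
  note [simp] = fibreD(2)[OF assms(4)] fibreD(2)[OF assms(5)]
  have "invertible3 B (cell_v \<psi> \<Delta> \<phi> \<Gamma>)" using assms by (simp add: cell_v_def)
  moreover have "B.is_quintet (quint (\<psi> \<odot>\<^bsub>A\<^esub> \<phi>) (cell_v \<psi> \<Delta> \<phi> \<Gamma>))" using assms by (simp add: quint_v)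
  ultimately show ?thesis by (rule fibreI[rotated])
qed

lemma fibre_l:
  assumes "\<phi> \<in> Cell2 A" "g \<in> Mor A" "tgt0 A (src1 A \<phi>) = src0 A g" "\<Gamma> \<in> fibre \<phi>"
  shows "cell_l g \<phi> \<Gamma> \<in> fibre (g \<rhd>\<^bsub>A\<^esub> \<phi>)"
proof -
  note [simp] = fibreD(2)[OF assms(4)] B.is_quintetD(5,10,11)[OF fibreD(1)[OF assms(4)], simplified]
  have "invertible3 B (cell_l g \<phi> \<Gamma>)" using assms by (simp add: cell_l_def)
  moreover have "B.is_quintet (quint (g \<rhd>\<^bsub>A\<^esub> \<phi>) (cell_l g \<phi> \<Gamma>))" using assms by (simp add: quint_l)
  ultimately show ?thesis by (rule fibreI[rotated])
qed

lemma fibre_r: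
  assumes "\<phi> \<in> Cell2 A" "f \<in> Mor A" "tgt0 A f = src0 A (src1 A \<phi>)" "\<Gamma> \<in> fibre \<phi>"
  shows "cell_r \<phi> \<Gamma> f \<in> fibre (\<phi> \<lhd>\<^bsub>A\<^esub> f)"
proof -
  note [simp] = fibreD(2)[OF assms(4)] B.is_quintetD(5,10,11)[OF fibreD(1)[OF assms(4)], simplified]
  have "invertible3 B (cell_r \<phi> \<Gamma> f)" using assms by (simp add: cell_r_def)
  moreover have "B.is_quintet (quint (\<phi> \<lhd>\<^bsub>A\<^esub> f) (cell_r \<phi> \<Gamma> f))" using assms by (simp add: quint_r)
  ultimately show ?thesis by (rule fibreI[rotated])
qed

lemma v_assoc:
  assumes "\<phi> \<in> Cell2 A" "\<psi> \<in> Cell2 A" "\<chi> \<in> Cell2 A" "tgt1 A \<phi> = src1 A \<psi>" "tgt1 A \<psi> = src1 A \<chi>"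
    "\<Gamma> \<in> fibre \<phi>" "\<Delta> \<in> fibre \<psi>" "\<Theta> \<in> fibre \<chi>"
  shows "cell_v (\<chi> \<odot>\<^bsub>A\<^esub> \<psi>) (cell_v \<chi> \<Theta> \<psi> \<Delta>) \<phi> \<Gamma> = cell_v \<chi> \<Theta> (\<psi> \<odot>\<^bsub>A\<^esub> \<phi>) (cell_v \<psi> \<Delta> \<phi> \<Gamma>)"
  using assms B.vpaste_assoc[of "quint \<phi> \<Gamma>" "quint \<psi> \<Delta>" "quint \<chi> \<Theta>"]
  by (simp add: cell_v_def[of "\<chi> \<odot>\<^bsub>A\<^esub> \<psi>"] cell_v_def[of _ _ "\<psi> \<odot>\<^bsub>A\<^esub> \<phi>"] quint_v)

lemma v_unit:
  assumes "\<phi> \<in> Cell2 A" "\<Gamma> \<in> fibre \<phi>"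
  shows "cell_v (id2 A (tgt1 A \<phi>)) \<langle>P (tgt1 A \<phi>)\<rangle> \<phi> \<Gamma> = \<Gamma>" "cell_v \<phi> \<Gamma> (id2 A (src1 A \<phi>)) \<langle>P (src1 A \<phi>)\<rangle> = \<Gamma>"
  using assms by (simp_all add: cell_v_def)

text \<open>A two by two grid with inverse interchangers in the left column and whiskered components
  in the right one. The left column arises from \<open>iq_vcomp2_right\<close> by reflection, and
  the interchange law of the double category compares rows with columns.\<close>

lemma l_v:
  assumes "\<phi> \<in> Cell2 A" "\<psi> \<in> Cell2 A" "tgt1 A \<phi> = src1 A \<psi>" "g \<in> Mor A" "tgt0 A (src1 A \<phi>) = src0 A g"
    "\<Gamma> \<in> fibre \<phi>" "\<Delta> \<in> fibre \<psi>"
  shows "cell_l g (\<psi> \<odot>\<^bsub>A\<^esub> \<phi>) (cell_v \<psi> \<Delta> \<phi> \<Gamma>)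
     = cell_v (g \<rhd>\<^bsub>A\<^esub> \<psi>) (cell_l g \<psi> \<Delta>) (g \<rhd>\<^bsub>A\<^esub> \<phi>) (cell_l g \<phi> \<Gamma>)"
  using assms A.composable_ends[OF assms(1-3)]
  by (simp add: cell_l_def[of _ "\<psi> \<odot>\<^bsub>A\<^esub> \<phi>"] cell_v_def[of "g \<rhd>\<^bsub>A\<^esub> \<psi>"] quint_v quint_l
     B.iq_vcomp2_right B.transpose_hpaste B.wlq_vpaste B.hpaste_vpaste)

text \<open>The mirror image of the previous grid: components on the left, interchangers on the
  right. The latter compose vertically as they stand.\<close>

lemma r_v:
  assumes "\<phi> \<in> Cell2 A" "\<psi> \<in> Cell2 A" "tgt1 A \<phi> = src1 A \<psi>" "f \<in> Mor A" "tgt0 A f = src0 A (src1 A \<phi>)"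
    "\<Gamma> \<in> fibre \<phi>" "\<Delta> \<in> fibre \<psi>"
  shows "cell_r (\<psi> \<odot>\<^bsub>A\<^esub> \<phi>) (cell_v \<psi> \<Delta> \<phi> \<Gamma>) f
     = cell_v (\<psi> \<lhd>\<^bsub>A\<^esub> f) (cell_r \<psi> \<Delta> f) (\<phi> \<lhd>\<^bsub>A\<^esub> f) (cell_r \<phi> \<Gamma> f)"
  using assms A.composable_ends[OF assms(1-3)]
  by (simp add: cell_r_def[of "\<psi> \<odot>\<^bsub>A\<^esub> \<phi>"] cell_v_def[of "\<psi> \<lhd>\<^bsub>A\<^esub> f"] quint_v quint_r
     B.iq_vcomp2_left B.wrq_vpaste B.hpaste_vpaste)

lemma l_id2: "\<lbrakk>f \<in> Mor A; g \<in> Mor A; tgt0 A f = src0 A g\<rbrakk> \<Longrightarrow> cell_l g (id2 A f) \<langle>P f\<rangle> = \<langle>P (g \<bullet>\<^bsub>A\<^esub> f)\<rangle>"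
  by (simp add: cell_l_def B.hpaste_vid)

lemma r_id2: "\<lbrakk>f \<in> Mor A; g \<in> Mor A; tgt0 A f = src0 A g\<rbrakk> \<Longrightarrow> cell_r (id2 A g) \<langle>P g\<rangle> f = \<langle>P (g \<bullet>\<^bsub>A\<^esub> f)\<rangle>"
  by (simp add: cell_r_def B.hpaste_vid)

lemma l_id1: assumes "\<phi> \<in> Cell2 A" "\<Gamma> \<in> fibre \<phi>" "tgt0 A (src1 A \<phi>) = Y" shows "cell_l (id1 A Y) \<phi> \<Gamma> = \<Gamma>"
  using assms by (auto simp: cell_l_def)

lemma r_id1: assumes "\<phi> \<in> Cell2 A" "\<Gamma> \<in> fibre \<phi>" "src0 A (src1 A \<phi>) = X" shows "cell_r \<phi> \<Gamma> (id1 A X) = \<Gamma>"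
  using assms by (auto simp: cell_r_def)

lemma l_comp1:
  assumes "\<phi> \<in> Cell2 A" "g \<in> Mor A" "h \<in> Mor A" "tgt0 A (src1 A \<phi>) = src0 A g" "tgt0 A g = src0 A h" "\<Gamma> \<in> fibre \<phi>"
  shows "cell_l (h \<bullet>\<^bsub>A\<^esub> g) \<phi> \<Gamma> = cell_l h (g \<rhd>\<^bsub>A\<^esub> \<phi>) (cell_l g \<phi> \<Gamma>)"
proof -
  \<comment> \<open>Multiplicativity of \<open>P\<close> cuts the square of the composite into an
    upper and a lower part, which reflection turns into two columns. \<open>P_comp1\<close> is
    deleted in the final step so that this equation still matches.\<close>
  have "B.transpose (B.iq (P (h \<bullet>\<^bsub>A\<^esub> g)) (on2 F \<phi>))
     = B.hpaste (B.wlq (on1 G h) (B.transpose (B.iq (P g) (on2 F \<phi>)))) (B.transpose (B.iq (P h) (on1 F g \<rhd> on2 F \<phi>)))"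
    using assms by (simp add: B.iq_vcomp2_left B.transpose_vpaste B.iq_assoc B.transpose_wq)
  then show ?thesis using assms
    by (simp add: cell_l_def[of "h \<bullet>\<^bsub>A\<^esub> g"] cell_l_def[of h] quint_l B.wlq_hpaste B.wq_assoc B.hpaste_assoc del: P_comp1)
qed

lemma r_comp1:
  assumes "\<phi> \<in> Cell2 A" "g \<in> Mor A" "h \<in> Mor A" "tgt0 A g = src0 A h" "tgt0 A h = src0 A (src1 A \<phi>)" "\<Gamma> \<in> fibre \<phi>"
  shows "cell_r (\<phi> \<lhd>\<^bsub>A\<^esub> h) (cell_r \<phi> \<Gamma> h) g = cell_r \<phi> \<Gamma> (h \<bullet>\<^bsub>A\<^esub> g)"
proof -
  have "B.iq (on2 G \<phi>) (P (h \<bullet>\<^bsub>A\<^esub> g))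
     = B.hpaste (B.iq (on2 G \<phi> \<lhd> on1 G h) (P g)) (B.wrq (B.iq (on2 G \<phi>) (P h)) (on1 F g))"
    using assms by (simp add: B.iq_vcomp2_right B.iq_assoc)
  then show ?thesis using assms
    by (simp add: cell_r_def[of _ _ "h \<bullet>\<^bsub>A\<^esub> g"] cell_r_def[of "\<phi> \<lhd>\<^bsub>A\<^esub> h"] quint_r B.wrq_hpaste B.wq_assoc B.hpaste_assoc del: P_comp1)
qed

text \<open>Both sides are the same row of three quintets: an inverse interchanger for
  \<open>P h\<close> on the left, the component whiskered on both sides in the middle, and an
  interchanger for \<open>P f\<close> on the right.\<close>

lemma l_r:
  assumes "\<phi> \<in> Cell2 A" "f \<in> Mor A" "h \<in> Mor A" "tgt0 A f = src0 A (src1 A \<phi>)" "tgt0 A (src1 A \<phi>) = src0 A h" "\<Gamma> \<in> fibre \<phi>"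
  shows "cell_r (h \<rhd>\<^bsub>A\<^esub> \<phi>) (cell_l h \<phi> \<Gamma>) f = cell_l h (\<phi> \<lhd>\<^bsub>A\<^esub> f) (cell_r \<phi> \<Gamma> f)"
  using assms
  by (simp add: cell_l_def[of _ "\<phi> \<lhd>\<^bsub>A\<^esub> f"] cell_r_def[of "h \<rhd>\<^bsub>A\<^esub> \<phi>"] quint_r quint_l B.wrq_hpaste B.wlq_hpaste
    B.wq_assoc B.hpaste_assoc B.iq_assoc B.transpose_wq)

text \<open>The hypothesis of \<open>ex1_cell_lift\<close>: the preceding lemmas are the axioms of a
  sesquicategory, one by one, in the second component.\<close>

lemma sesquicategory_over: "sesquicategory (displayed_cells A fibre (\<lambda>f. \<langle>P f\<rangle>) cell_l cell_r cell_v)"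
proof (unfold_locales, goal_cases)
  case 1 then show ?case by simp
next
  case 2 then show ?case by auto
qed (auto simp: in1_def in2_def v_assoc v_unit l_v r_v l_id2 r_id2 l_id1 r_id1 l_comp1 r_comp1 l_r
   intro!: fibre_id fibre_v fibre_l fibre_r)

end

section \<open>Adjoint equivalences\<close>

context gray_category
begin

text \<open>\<open>adjoint_equivalence\<close> in a hom-2-category, rewritten in the cells of
  \<open>A\<close>, with boundaries as equations the simplifier can use.\<close>

definition is_adjeq :: "('b, 'c) adjeq \<Rightarrow> 'a \<Rightarrow> 'a \<Rightarrow> bool" where
  "is_adjeq e x y \<longleftrightarrow> ladj e \<in> Cell2 A \<and> src1 A (ladj e) = x \<and> tgt1 A (ladj e) = y
     \<and> radj e \<in> Cell2 A \<and> src1 A (radj e) = y \<and> tgt1 A (radj e) = x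
     \<and> adjunit e \<in> Cell3 A \<and> src2 A (adjunit e) = id2 A x \<and> tgt2 A (adjunit e) = radj e \<odot> ladj e
     \<and> invertible3 A (adjunit e)
     \<and> adjcounit e \<in> Cell3 A \<and> src2 A (adjcounit e) = ladj e \<odot> radj e \<and> tgt2 A (adjcounit e) = id2 A y
     \<and> invertible3 A (adjcounit e)
     \<and> (adjcounit e \<star> \<langle>ladj e\<rangle>) \<cdot> (\<langle>ladj e\<rangle> \<star> adjunit e) = \<langle>ladj e\<rangle>
     \<and> (\<langle>radj e\<rangle> \<star> adjcounit e) \<cdot> (adjunit e \<star> \<langle>radj e\<rangle>) = \<langle>radj e\<rangle>"

definition aid :: "'a \<Rightarrow> ('b, 'c) adjeq" where
  "aid x = \<lparr>ladj = id2 A x, radj = id2 A x, adjunit = \<langle>id2 A x\<rangle>, adjcounit = \<langle>id2 A x\<rangle>\<rparr>"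

definition acomp :: "('b, 'c) adjeq \<Rightarrow> ('b, 'c) adjeq \<Rightarrow> ('b, 'c) adjeq" where
  "acomp d e = \<lparr>ladj = ladj d \<odot> ladj e, radj = radj e \<odot> radj d,
     adjunit = (\<langle>radj e\<rangle> \<star> adjunit d \<star> \<langle>ladj e\<rangle>) \<cdot> adjunit e,
     adjcounit = adjcounit d \<cdot> (\<langle>ladj d\<rangle> \<star> adjcounit e \<star> \<langle>radj d\<rangle>)\<rparr>"

definition awl :: "'a \<Rightarrow> ('b, 'c) adjeq \<Rightarrow> ('b, 'c) adjeq" where
  "awl g e = adjeq_image (\<lambda>\<alpha>. g \<rhd> \<alpha>) (\<lambda>\<Gamma>. g \<rhd>\<rhd> \<Gamma>) e"

definition awr :: "('b, 'c) adjeq \<Rightarrow> 'a \<Rightarrow> ('b, 'c) adjeq" where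
  "awr e f = adjeq_image (\<lambda>\<alpha>. \<alpha> \<lhd> f) (\<lambda>\<Gamma>. \<Gamma> \<lhd>\<lhd> f) e"

lemma adjeq_id_hom: "adjeq_id (hom A X Y) x = aid x"
  and adjeq_comp_hom: "adjeq_comp (hom A X Y) d e = acomp d e"
  by (simp_all add: adjeq_id_def adjeq_comp_def aid_def acomp_def)

lemma tinverse_hom_iff: "\<lbrakk>\<Gamma> \<in> Cell3 A; src0 A (src1 A (src2 A \<Gamma>)) = X; tgt0 A (src1 A (src2 A \<Gamma>)) = Y\<rbrakk>
  \<Longrightarrow> tinverse (hom A X Y) \<Gamma> \<Delta> \<longleftrightarrow> inverse3 A \<Gamma> \<Delta>"
  by (auto simp: tinverse_def inverse3_def in3_def)

lemma tiso2_hom: "tiso2 (hom A X Y) \<Gamma> u v \<longleftrightarrow> \<Gamma> \<in> Cell3 A \<and>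
    src0 A (src1 A (src2 A \<Gamma>)) = X \<and> tgt0 A (src1 A (src2 A \<Gamma>)) = Y \<and> src2 A \<Gamma> = u \<and> tgt2 A \<Gamma> = v \<and> invertible3 A \<Gamma>"
  by (auto simp: tiso2_def invertible3_def tinverse_hom_iff)

lemma adjoint_equivalence_hom:
  "\<lbrakk>x \<in> Mor A; src0 A x = X; tgt0 A x = Y\<rbrakk> \<Longrightarrow> adjoint_equivalence (hom A X Y) x y e \<longleftrightarrow> is_adjeq e x y"
  by (auto simp: adjoint_equivalence_def is_adjeq_def tiso2_hom)

lemma is_adjeqD: assumes "is_adjeq e x y"
  shows "ladj e \<in> Cell2 A" "src1 A (ladj e) = x" "tgt1 A (ladj e) = y"
     "radj e \<in> Cell2 A" "src1 A (radj e) = y" "tgt1 A (radj e) = x"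
     "adjunit e \<in> Cell3 A" "src2 A (adjunit e) = id2 A x" "tgt2 A (adjunit e) = radj e \<odot> ladj e"
     "invertible3 A (adjunit e)"
     "adjcounit e \<in> Cell3 A" "src2 A (adjcounit e) = ladj e \<odot> radj e" "tgt2 A (adjcounit e) = id2 A y"
     "invertible3 A (adjcounit e)"
     "x \<in> Mor A" "y \<in> Mor A"
     "src0 A y = src0 A x" "tgt0 A y = tgt0 A x"
  using assms mor_ends2[of "ladj e"] by (auto simp: is_adjeq_def simp del: mor_ends2)

lemma triangles: assumes "is_adjeq e x y"
  shows "(adjcounit e \<star> \<langle>ladj e\<rangle>) \<cdot> (\<langle>ladj e\<rangle> \<star> adjunit e) = \<langle>ladj e\<rangle>"
     "(\<langle>radj e\<rangle> \<star> adjcounit e) \<cdot> (adjunit e \<star> \<langle>radj e\<rangle>) = \<langle>radj e\<rangle>"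
  using assms by (auto simp: is_adjeq_def)

lemma is_adjeq_aid: "x \<in> Mor A \<Longrightarrow> is_adjeq (aid x) x x"
  by (simp add: is_adjeq_def aid_def)

lemma is_adjeq_acomp: assumes "is_adjeq e x y" "is_adjeq d y z" shows "is_adjeq (acomp d e) x z"
proof -
  note e = is_adjeqD[OF assms(1)] and d = is_adjeqD[OF assms(2)]
  define l1 r1 n1 c1 where "l1 = ladj e" "r1 = radj e" "n1 = adjunit e" "c1 = adjcounit e"
  define l2 r2 n2 c2 where "l2 = ladj d" "r2 = radj d" "n2 = adjunit d" "c2 = adjcounit d"
  note [simp] = e[folded l1_r1_n1_c1_def] d(1-14,16)[folded l2_r2_n2_c2_def]
  note t1 = triangles[OF assms(1), folded l1_r1_n1_c1_def] and t2 = triangles[OF assms(2), folded l2_r2_n2_c2_def]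
  \<comment> \<open>The middle of the zigzag: \<open>c1\<close> ends and \<open>n2\<close> starts at
    the identity of \<open>y\<close>, so by interchange the whiskered composite collapses to
    \<open>n2 \<cdot> c1\<close>. After this the counit and unit of each factor are adjacent and its
    own triangle identity applies.\<close>
  have s: "n2 \<cdot> c1 = (c1 \<star> \<langle>r2 \<odot> l2\<rangle>) \<cdot> (\<langle>l1 \<odot> r1\<rangle> \<star> n2)"
    using interchange_swap[of n2 c1] by simp
  have s': "c1 \<cdot> (\<langle>l1\<rangle> \<star> (\<langle>r1\<rangle>)) = c1" by simp
  let ?n = "(\<langle>r1\<rangle> \<star> n2 \<star> \<langle>l1\<rangle>) \<cdot> n1" and ?c = "c2 \<cdot> (\<langle>l2\<rangle> \<star> c1 \<star> \<langle>r2\<rangle>)"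
  have "(?c \<star> \<langle>l2 \<odot> l1\<rangle>) \<cdot> (\<langle>l2 \<odot> l1\<rangle> \<star> ?n)
     = (c2 \<star> \<langle>l2 \<odot> l1\<rangle>) \<cdot> ((\<langle>l2\<rangle> \<star> (((c1 \<star> \<langle>r2 \<odot> l2\<rangle>) \<cdot> (\<langle>l1 \<odot> r1\<rangle> \<star> n2)) \<star> \<langle>l1\<rangle>)) \<cdot> (\<langle>l2 \<odot> l1\<rangle> \<star> n1))"
    by simp
  also have "\<dots> = (c2 \<star> \<langle>l2 \<odot> l1\<rangle>) \<cdot> ((\<langle>l2\<rangle> \<star> ((n2 \<cdot> c1) \<star> \<langle>l1\<rangle>)) \<cdot> (\<langle>l2 \<odot> l1\<rangle> \<star> n1))"
    by (simp only: s)
  also have "\<dots> = (((c2 \<star> \<langle>l2\<rangle>) \<cdot> (\<langle>l2\<rangle> \<star> n2)) \<star> \<langle>l1\<rangle>) \<cdot> (\<langle>l2\<rangle> \<star> ((c1 \<star> \<langle>l1\<rangle>) \<cdot> (\<langle>l1\<rangle> \<star> n1)))"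
    by simp
  also have "\<dots> = \<langle>l2 \<odot> l1\<rangle>" unfolding t1 t2 by simp
  finally have T1: "(?c \<star> \<langle>l2 \<odot> l1\<rangle>) \<cdot> (\<langle>l2 \<odot> l1\<rangle> \<star> ?n) = \<langle>l2 \<odot> l1\<rangle>" .
  have "(\<langle>r1 \<odot> r2\<rangle> \<star> ?c) \<cdot> (?n \<star> \<langle>r1 \<odot> r2\<rangle>)
     = (\<langle>r1 \<odot> r2\<rangle> \<star> c2) \<cdot> ((\<langle>r1\<rangle> \<star> (((\<langle>r2 \<odot> l2\<rangle> \<star> c1) \<cdot> (n2 \<star> \<langle>l1 \<odot> r1\<rangle>)) \<star> \<langle>r2\<rangle>)) \<cdot> (n1 \<star> \<langle>r1 \<odot> r2\<rangle>))"
    by simp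
  also have "(\<langle>r2 \<odot> l2\<rangle> \<star> c1) \<cdot> (n2 \<star> \<langle>l1 \<odot> r1\<rangle>) = n2 \<cdot> c1"
    using interchange_swap[of c1 n2] by simp
  also have "(\<langle>r1 \<odot> r2\<rangle> \<star> c2) \<cdot> ((\<langle>r1\<rangle> \<star> ((n2 \<cdot> c1) \<star> \<langle>r2\<rangle>)) \<cdot> (n1 \<star> \<langle>r1 \<odot> r2\<rangle>))
     = (\<langle>r1\<rangle> \<star> ((\<langle>r2\<rangle> \<star> c2) \<cdot> (n2 \<star> \<langle>r2\<rangle>))) \<cdot> (((\<langle>r1\<rangle> \<star> c1) \<cdot> (n1 \<star> \<langle>r1\<rangle>)) \<star> \<langle>r2\<rangle>)"
    by simp
  also have "\<dots> = \<langle>r1 \<odot> r2\<rangle>" unfolding t1 t2 by simp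
  finally have T2: "(\<langle>r1 \<odot> r2\<rangle> \<star> ?c) \<cdot> (?n \<star> \<langle>r1 \<odot> r2\<rangle>) = \<langle>r1 \<odot> r2\<rangle>" .
  have "acomp d e = \<lparr>ladj = l2 \<odot> l1, radj = r1 \<odot> r2, adjunit = ?n, adjcounit = ?c\<rparr>"
    by (simp add: acomp_def l1_r1_n1_c1_def l2_r2_n2_c2_def)
  then show ?thesis unfolding is_adjeq_def using T1 T2 by simp
qed

lemma acomp_unit: assumes "is_adjeq e x y" shows "acomp (aid y) e = e" "acomp e (aid x) = e"
  using is_adjeqD[OF assms] by (simp_all add: acomp_def aid_def)

lemma acomp_assoc: assumes "is_adjeq c w x" "is_adjeq d x y" "is_adjeq e y z"
  shows "acomp (acomp e d) c = acomp e (acomp d c)"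
proof -
  note [simp] = is_adjeqD[OF assms(1)] is_adjeqD(1-14,16)[OF assms(2)] is_adjeqD(1-14,16)[OF assms(3)]
  show ?thesis by (simp add: acomp_def)
qed

lemma is_adjeq_awl: assumes "is_adjeq e x y" "g \<in> Mor A" "tgt0 A x = src0 A g"
  shows "is_adjeq (awl g e) (g \<bullet> x) (g \<bullet> y)"
proof -
  note [simp] = is_adjeqD[OF assms(1)] assms(2,3)
  show ?thesis
    using triangles[OF assms(1), THEN arg_cong, of "whl3 A g"] by (simp add: is_adjeq_def awl_def adjeq_image_def)
qed

lemma is_adjeq_awr: assumes "is_adjeq e x y" "f \<in> Mor A" "tgt0 A f = src0 A x"
  shows "is_adjeq (awr e f) (x \<bullet> f) (y \<bullet> f)"
proof -
  note [simp] = is_adjeqD[OF assms(1)] assms(2,3)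
  show ?thesis
    using triangles[OF assms(1), THEN arg_cong, of "\<lambda>\<Gamma>. \<Gamma> \<lhd>\<lhd> f"] by (simp add: is_adjeq_def awr_def adjeq_image_def)
qed

lemma aw_aid [simp]:
  "\<lbrakk>g \<in> Mor A; x \<in> Mor A; tgt0 A x = src0 A g\<rbrakk> \<Longrightarrow> awl g (aid x) = aid (g \<bullet> x)"
  "\<lbrakk>f \<in> Mor A; x \<in> Mor A; tgt0 A f = src0 A x\<rbrakk> \<Longrightarrow> awr (aid x) f = aid (x \<bullet> f)"
  by (simp_all add: awl_def awr_def aid_def adjeq_image_def)

lemma aw_acomp: assumes "is_adjeq d x y" "is_adjeq e y z"
  shows "\<lbrakk>g \<in> Mor A; tgt0 A x = src0 A g\<rbrakk> \<Longrightarrow> awl g (acomp e d) = acomp (awl g e) (awl g d)"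
    "\<lbrakk>g \<in> Mor A; tgt0 A g = src0 A x\<rbrakk> \<Longrightarrow> awr (acomp e d) g = acomp (awr e g) (awr d g)"
  using is_adjeqD[OF assms(1)] is_adjeqD[OF assms(2)] by (simp_all add: awl_def awr_def acomp_def adjeq_image_def)

lemma aw_id1 [simp]: assumes "is_adjeq e x y"
  shows "awl (id1 A (tgt0 A x)) e = e" "awr e (id1 A (src0 A x)) = e"
  using is_adjeqD[OF assms] by (simp_all add: awl_def awr_def adjeq_image_def)

lemma aw_assoc: assumes "is_adjeq e x y"
  shows "\<lbrakk>g \<in> Mor A; h \<in> Mor A; tgt0 A x = src0 A g; tgt0 A g = src0 A h\<rbrakk> \<Longrightarrow> awl (h \<bullet> g) e = awl h (awl g e)"
    "\<lbrakk>f \<in> Mor A; h \<in> Mor A; tgt0 A f = src0 A x; tgt0 A x = src0 A h\<rbrakk> \<Longrightarrow> awr (awl h e) f = awl h (awr e f)"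
    "\<lbrakk>f \<in> Mor A; g \<in> Mor A; tgt0 A f = src0 A g; tgt0 A g = src0 A x\<rbrakk> \<Longrightarrow> awr (awr e g) f = awr e (g \<bullet> f)"
  using is_adjeqD[OF assms(1)] by (simp_all add: awl_def awr_def adjeq_image_def)

end

lemma (in gray_category) adj_components_alt:
  "adj_components A B F G M p0 p1 \<longleftrightarrow> (\<forall>f \<in> M. f \<in> Mor A \<longrightarrow>
      adjoint_equivalence (hom B (on0 F (src0 A f)) (on0 G (tgt0 A f)))
        (p0 (tgt0 A f) \<bullet>\<^bsub>B\<^esub> on1 F f) (on1 G f \<bullet>\<^bsub>B\<^esub> p0 (src0 A f)) (p1 f))"
  by (auto simp: adj_components_def in1_def)

lemma (in gray_category) cell_components_alt:
  "cell_components A B F G N p0 P1 p2 \<longleftrightarrow> (\<forall>\<phi> \<in> N. \<phi> \<in> Cell2 A \<longrightarrow>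
      \<guillemotleft>p2 \<phi> : ladj (P1 (tgt1 A \<phi>)) \<odot>\<^bsub>B\<^esub> (p0 (tgt0 A (src1 A \<phi>)) \<rhd>\<^bsub>B\<^esub> on2 F \<phi>)
        \<cong>\<^bsub>B\<^esub> (on2 G \<phi> \<lhd>\<^bsub>B\<^esub> p0 (src0 A (src1 A \<phi>))) \<odot>\<^bsub>B\<^esub> ladj (P1 (src1 A \<phi>))\<guillemotright>)"
  by (auto simp: cell_components_def in1_def in2_def)

section \<open>Adjoint equivalences over the morphisms of the domain\<close>

context transformation_objects
begin

definition adj_mult :: "'a \<Rightarrow> ('b1, 'c1) adjeq \<Rightarrow> 'a \<Rightarrow> ('b1, 'c1) adjeq \<Rightarrow> ('b1, 'c1) adjeq" where
  "adj_mult g d f e = B.acomp (B.awl (on1 G g) e) (B.awr d (on1 F f))"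

definition adj_fibre :: "'a \<Rightarrow> ('b1, 'c1) adjeq set" where
  "adj_fibre f = {e. B.is_adjeq e (p0 (tgt0 A f) \<bullet> on1 F f) (on1 G f \<bullet> p0 (src0 A f))}"

lemma adj_components_iff: "M \<subseteq> Mor A \<Longrightarrow> adj_components A B F G M p0 p1 \<longleftrightarrow> (\<forall>f \<in> M. p1 f \<in> adj_fibre f)"
  by (auto simp: A.adj_components_alt adj_fibre_def B.adjoint_equivalence_hom subset_iff)

lemma strict_adj_iff: "strict_adj A B F G p0 P1 \<longleftrightarrow> (\<forall>X \<in> Ob A. P1 (id1 A X) = B.aid (p0 X))
   \<and> (\<forall>f g. f \<in> Mor A \<and> g \<in> Mor A \<and> tgt0 A f = src0 A g \<longrightarrow> P1 (g \<bullet>\<^bsub>A\<^esub> f) = adj_mult g (P1 g) f (P1 f))"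
  by (auto simp: strict_adj_def B.adjeq_id_hom B.adjeq_comp_hom adj_mult_def B.awl_def B.awr_def in1_def)

lemma adj_mult_in:
  assumes "f \<in> Mor A" "g \<in> Mor A" "tgt0 A f = src0 A g" "e \<in> adj_fibre f" "d \<in> adj_fibre g"
  shows "B.is_adjeq (B.awr d (on1 F f)) (p0 (tgt0 A g) \<bullet> on1 F g \<bullet> on1 F f) (on1 G g \<bullet> p0 (src0 A g) \<bullet> on1 F f)"
    "B.is_adjeq (B.awl (on1 G g) e) (on1 G g \<bullet> p0 (src0 A g) \<bullet> on1 F f) (on1 G g \<bullet> on1 G f \<bullet> p0 (src0 A f))"
    "adj_mult g d f e \<in> adj_fibre (g \<bullet>\<^bsub>A\<^esub> f)"
proof -
  show 1: "B.is_adjeq (B.awr d (on1 F f)) (p0 (tgt0 A g) \<bullet> on1 F g \<bullet> on1 F f) (on1 G g \<bullet> p0 (src0 A g) \<bullet> on1 F f)"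
    using assms B.is_adjeq_awr[of d "p0 (tgt0 A g) \<bullet> on1 F g" "on1 G g \<bullet> p0 (src0 A g)" "on1 F f"] by (auto simp: adj_fibre_def)
  show 2: "B.is_adjeq (B.awl (on1 G g) e) (on1 G g \<bullet> p0 (src0 A g) \<bullet> on1 F f) (on1 G g \<bullet> on1 G f \<bullet> p0 (src0 A f))"
    using assms B.is_adjeq_awl[of e "p0 (tgt0 A f) \<bullet> on1 F f" "on1 G f \<bullet> p0 (src0 A f)" "on1 G g"] by (auto simp: adj_fibre_def)
  show "adj_mult g d f e \<in> adj_fibre (g \<bullet>\<^bsub>A\<^esub> f)"
    using B.is_adjeq_acomp[OF 1 2] assms by (simp add: adj_mult_def adj_fibre_def)
qed

lemma adj_mult_unit:
  assumes "f \<in> Mor A" "e \<in> adj_fibre f"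
  shows "adj_mult (id1 A (tgt0 A f)) (B.aid (p0 (tgt0 A f))) f e = e"
    "adj_mult f e (id1 A (src0 A f)) (B.aid (p0 (src0 A f))) = e"
  using assms B.acomp_unit[of e] B.aw_id1[of e "p0 (tgt0 A f) \<bullet> on1 F f" "on1 G f \<bullet> p0 (src0 A f)"] by (auto simp: adj_mult_def adj_fibre_def)

text \<open>Both sides compose the same three equivalences: \<open>e\<close> whiskered by two values
  of \<open>F\<close>, \<open>d\<close> whiskered on both sides, and \<open>c\<close> whiskered by
  two values of \<open>G\<close>.\<close>

lemma adj_mult_assoc:
  assumes "f \<in> Mor A" "g \<in> Mor A" "h \<in> Mor A" "tgt0 A f = src0 A g" "tgt0 A g = src0 A h"
     "c \<in> adj_fibre f" "d \<in> adj_fibre g" "e \<in> adj_fibre h"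
  shows "adj_mult (h \<bullet>\<^bsub>A\<^esub> g) (adj_mult h e g d) f c = adj_mult h e (g \<bullet>\<^bsub>A\<^esub> f) (adj_mult g d f c)"
proof -
  note a = adj_mult_in(1,2)[OF assms(1,2,4,6,7)] and b = adj_mult_in(1,2)[OF assms(2,3,5,7,8)]
  have c: "B.is_adjeq c (p0 (tgt0 A f) \<bullet> on1 F f) (on1 G f \<bullet> p0 (src0 A f))"
    and d: "B.is_adjeq d (p0 (tgt0 A g) \<bullet> on1 F g) (on1 G g \<bullet> p0 (src0 A g))"
    and e: "B.is_adjeq e (p0 (tgt0 A h) \<bullet> on1 F h) (on1 G h \<bullet> p0 (src0 A h))"
    using assms by (auto simp: adj_fibre_def)
  have "B.awr (B.acomp (B.awl (on1 G h) d) (B.awr e (on1 F g))) (on1 F f)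
     = B.acomp (B.awl (on1 G h) (B.awr d (on1 F f))) (B.awr e (on1 F g \<bullet> on1 F f))"
    using assms B.aw_acomp(2)[OF b, of "on1 F f"] B.aw_assoc(2)[OF d, of "on1 F f" "on1 G h"]
      B.aw_assoc(3)[OF e, of "on1 F f" "on1 F g"] by simp
  moreover have "B.awl (on1 G h) (B.acomp (B.awl (on1 G g) c) (B.awr d (on1 F f)))
     = B.acomp (B.awl (on1 G h \<bullet> on1 G g) c) (B.awl (on1 G h) (B.awr d (on1 F f)))"
    using assms B.aw_acomp(1)[OF a, of "on1 G h"] B.aw_assoc(1)[OF c, of "on1 G g" "on1 G h"] by simp
  moreover have "B.is_adjeq (B.awr e (on1 F g \<bullet> on1 F f)) (p0 (tgt0 A h) \<bullet> on1 F h \<bullet> on1 F g \<bullet> on1 F f)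
       (on1 G h \<bullet> p0 (src0 A h) \<bullet> on1 F g \<bullet> on1 F f)"
    using B.is_adjeq_awr[OF e, of "on1 F g \<bullet> on1 F f"] assms by simp
  moreover have "B.is_adjeq (B.awl (on1 G h) (B.awr d (on1 F f))) (on1 G h \<bullet> p0 (src0 A h) \<bullet> on1 F g \<bullet> on1 F f)
      (on1 G h \<bullet> on1 G g \<bullet> p0 (src0 A g) \<bullet> on1 F f)"
    using B.is_adjeq_awl[OF a(1), of "on1 G h"] assms by simp
  moreover have "B.is_adjeq (B.awl (on1 G h \<bullet> on1 G g) c) (on1 G h \<bullet> on1 G g \<bullet> p0 (src0 A g) \<bullet> on1 F f)
      (on1 G h \<bullet> on1 G g \<bullet> on1 G f \<bullet> p0 (src0 A f))"
    using B.is_adjeq_awl[OF c, of "on1 G h \<bullet> on1 G g"] assms by simp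
  ultimately show ?thesis using assms by (simp add: adj_mult_def B.acomp_assoc)
qed

end

locale cofibrant_transformation_objects = cofibrant_gray_category A K H + transformation_objects A B F G p0
  for A K H and B (structure) and F G p0
begin

text \<open>Semi-strictness also prescribes right adjoints, units and counits at composites. Hence
  entire \<open>adjeq\<close> records are lifted, with \<open>aid\<close> as unit and
  \<open>adj_mult\<close> as multiplication.\<close>

lemma ex1_adj_extension:
  assumes "adj_components A B F G (generating_mors K H) p0 p1"
  shows "\<exists>!P1. adj_extension A B F G (generating_mors K H) p0 p1 P1"
proof -
  have "generating_mors K H \<subseteq> Mor A" using generating_mors_in by blast
  then have gen: "\<And>f. f \<in> generating_mors K H \<Longrightarrow> p1 f \<in> adj_fibre f"
    using assms by (simp add: adj_components_iff)
  have id: "X \<in> Ob A \<Longrightarrow> B.aid (p0 X) \<in> adj_fibre (id1 A X)" for X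
    by (simp add: adj_fibre_def B.is_adjeq_aid)
  have "\<exists>!P1. P1 \<in> extensional (Mor A) \<and> (\<forall>f \<in> generating_mors K H. P1 f = p1 f) \<and> (\<forall>f \<in> Mor A. P1 f \<in> adj_fibre f)
    \<and> (\<forall>X \<in> Ob A. P1 (id1 A X) = B.aid (p0 X))
    \<and> (\<forall>f g. f \<in> Mor A \<and> g \<in> Mor A \<and> tgt0 A f = src0 A g \<longrightarrow> P1 (g \<bullet>\<^bsub>A\<^esub> f) = adj_mult g (P1 g) f (P1 f))"
    by (rule ex1_mor_lift)
      (erule id | erule (4) adj_mult_in(3) | erule (1) adj_mult_unit | erule (7) adj_mult_assoc | erule gen
        | erule id1_ends | erule (2) comp1_ends)+
  then show ?thesis
    unfolding adj_extension_def adj_components_iff[OF subset_refl] strict_adj_iff .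
qed

end

section \<open>Semi-strict transformations\<close>

lemma semistrict_data_sel [simp]:
  "tr0 (semistrict_data A B p0 P1 P2) = p0" "tradj (semistrict_data A B p0 P1 P2) = P1"
  "tr2 (semistrict_data A B p0 P1 P2) = P2"
  "X \<in> Ob A \<Longrightarrow> unitor (semistrict_data A B p0 P1 P2) X = \<langle>id2 B (p0 X)\<rangle>\<^bsub>B\<^esub>"
  "\<lbrakk>f \<in> Mor A; g \<in> Mor A; tgt0 A f = src0 A g\<rbrakk>
    \<Longrightarrow> compositor (semistrict_data A B p0 P1 P2) (g, f) = \<langle>ladj (P1 (g \<bullet>\<^bsub>A\<^esub> f))\<rangle>\<^bsub>B\<^esub>"
  by (simp_all add: semistrict_data_def composable_def)

locale adjoint_transformation_data = transformation_objects A B F G p0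
  for A :: "('o, 'a, 'b, 'c) gray" and B :: "('o1, 'a1, 'b1, 'c1) gray" (structure)
    and F G :: "('o, 'a, 'b, 'c, 'o1, 'a1, 'b1, 'c1) gmap" and p0 +
  fixes P1 :: "'a \<Rightarrow> ('b1, 'c1) adjeq"
  assumes adj: "adj_components A B F G (Mor A) p0 P1" and strict: "strict_adj A B F G p0 P1"
begin

lemma P1_in: "f \<in> Mor A \<Longrightarrow> B.is_adjeq (P1 f) (p0 (tgt0 A f) \<bullet> on1 F f) (on1 G f \<bullet> p0 (src0 A f))"
  using adj by (simp add: adj_components_iff adj_fibre_def)

end

sublocale adjoint_transformation_data \<subseteq> transformation_data A B F G p0 "\<lambda>f. ladj (P1 f)"
proof (unfold_locales, goal_cases)
  case (1 f)
  then show ?case using B.is_adjeqD[OF P1_in] by (simp add: in2_def)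
next
  case (2 X)
  then show ?case using strict by (simp add: strict_adj_iff B.aid_def)
next
  case (3 f g)
  then show ?case using strict by (simp add: strict_adj_iff adj_mult_def B.acomp_def B.awl_def B.awr_def adjeq_image_def)
qed

context adjoint_transformation_data
begin

lemma cell_components_iff:
  assumes "M \<subseteq> Cell2 A" shows "cell_components A B F G M p0 P1 P2 \<longleftrightarrow> (\<forall>\<phi> \<in> M. P2 \<phi> \<in> fibre \<phi>)"
  using assms by (auto simp: A.cell_components_alt fibre_iff)

lemma fibre_ends: assumes "\<phi> \<in> Cell2 A" "\<Gamma> \<in> fibre \<phi>"
  shows "\<Gamma> \<in> Cell3 B" "src2 B \<Gamma> = ladj (P1 (tgt1 A \<phi>)) \<odot> (p0 (tgt0 A (src1 A \<phi>)) \<rhd> on2 F \<phi>)"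
    "tgt2 B \<Gamma> = (on2 G \<phi> \<lhd> p0 (src0 A (src1 A \<phi>))) \<odot> ladj (P1 (src1 A \<phi>))" "invertible3 B \<Gamma>"
  using assms by (auto simp: fibre_iff iso3_iff in3_def)

section \<open>The semi-strict laws as statements about the operations on fibres\<close>

context
  fixes P2 assumes P2: "\<forall>\<phi> \<in> Cell2 A. P2 \<phi> \<in> fibre \<phi>"
begin

lemma identity_law_iff:
  "identity_law A B (semistrict_data A B p0 P1 P2) \<longleftrightarrow> (\<forall>f \<in> Mor A. P2 (id2 A f) = \<langle>ladj (P1 f)\<rangle>)"
  by (simp add: identity_law_def)

lemma composition_law_iff:
  "composition_law A B F G (semistrict_data A B p0 P1 P2) \<longleftrightarrow> (\<forall>\<phi> \<psi>. \<phi> \<in> Cell2 A \<and> \<psi> \<in> Cell2 A \<and> tgt1 A \<phi> = src1 A \<psi>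
    \<longrightarrow> P2 (\<psi> \<odot>\<^bsub>A\<^esub> \<phi>) = cell_v \<psi> (P2 \<psi>) \<phi> (P2 \<phi>))"
proof -
  have *: "cell_v \<psi> (P2 \<psi>) \<phi> (P2 \<phi>) = (\<langle>on2 G \<psi> \<lhd> p0 (src0 A (src1 A \<phi>))\<rangle> \<star> P2 \<phi>) \<cdot> (P2 \<psi> \<star> \<langle>p0 (tgt0 A (src1 A \<phi>)) \<rhd> on2 F \<phi>\<rangle>)"
    if "\<phi> \<in> Cell2 A" "\<psi> \<in> Cell2 A" "tgt1 A \<phi> = src1 A \<psi>" for \<phi> \<psi>
    using A.composable_ends[OF that] by (simp add: cell_v_def B.vpaste_def)
  show ?thesis unfolding composition_law_def in1_def in2_def
    by (auto simp: *)
qed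

lemma right_whiskering_law_iff:
  "right_whiskering_law A B F G (semistrict_data A B p0 P1 P2) \<longleftrightarrow> (\<forall>\<phi> g. \<phi> \<in> Cell2 A \<and> g \<in> Mor A \<and> tgt0 A (src1 A \<phi>) = src0 A g
    \<longrightarrow> P2 (g \<rhd>\<^bsub>A\<^esub> \<phi>) = cell_l g \<phi> (P2 \<phi>))"
    (is "_ \<longleftrightarrow> (\<forall>\<phi> g. ?C \<phi> g \<longrightarrow> _ \<phi> g)")
proof -
  let ?D = "semistrict_data A B p0 P1 P2"
  let ?L = "\<lambda>\<phi> g. P2 (g \<rhd>\<^bsub>A\<^esub> \<phi>) \<cdot> (compositor ?D (g, tgt1 A \<phi>) \<star> \<langle>p0 (tgt0 A g) \<rhd> (on1 F g \<rhd> on2 F \<phi>)\<rangle>)"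
  let ?R = "\<lambda>\<phi> g. (\<langle>(on1 G g \<rhd> on2 G \<phi>) \<lhd> p0 (src0 A (src1 A \<phi>))\<rangle> \<star> compositor ?D (g, src1 A \<phi>))
      \<cdot> ((on1 G g \<rhd>\<rhd> P2 \<phi>) \<star> \<langle>ladj (P1 g) \<lhd> on1 F (src1 A \<phi>)\<rangle>)
      \<cdot> (\<langle>on1 G g \<rhd> ladj (P1 (tgt1 A \<phi>))\<rangle> \<star> inv3 B (interch B (ladj (P1 g)) (on2 F \<phi>)))"
  \<comment> \<open>At semi-strict data the compositors are identities and drop out; what remains on
    the right is the 3-cell of the pasting that defines \<open>cell_l\<close>.\<close>
  have *: "?L \<phi> g = P2 (g \<rhd>\<^bsub>A\<^esub> \<phi>) \<and> ?R \<phi> g = cell_l g \<phi> (P2 \<phi>)" if "?C \<phi> g" for \<phi> g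
    using fibre_ends[OF _ P2[rule_format, of "g \<rhd>\<^bsub>A\<^esub> \<phi>"]] fibre_ends[OF _ P2[rule_format, of \<phi>]] that
    by (simp add: cell_l_def B.hpaste_def)
  \<comment> \<open>All quantified objects and morphisms of the law are boundaries of
    \<open>\<phi>\<close> and \<open>g\<close>, so the quantifiers over them can be
    eliminated.\<close>
  have "right_whiskering_law A B F G ?D \<longleftrightarrow> (\<forall>\<phi> g. ?C \<phi> g \<longrightarrow> ?L \<phi> g = ?R \<phi> g)"
    unfolding right_whiskering_law_def in1_def in2_def semistrict_data_sel(1-3)
  proof (intro iffI allI impI, goal_cases)
    case (1 \<phi> g)
    show ?case
      by (rule 1(1)[rule_format, of "src1 A \<phi>" "src0 A (src1 A \<phi>)" "src0 A g" \<phi> "tgt1 A \<phi>" g "tgt0 A g"]) (use 1(2) in simp)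
  next
    case (2 X Y Z f f' \<phi> g)
    then have e: "f = src1 A \<phi>" "f' = tgt1 A \<phi>" "X = src0 A (src1 A \<phi>)" "Z = tgt0 A g" by auto
    show ?case unfolding e by (rule 2(1)[rule_format]) (use 2(2) in auto)
  qed
  then show ?thesis using * by simp
qed

lemma left_whiskering_law_iff:
  "left_whiskering_law A B F G (semistrict_data A B p0 P1 P2) \<longleftrightarrow> (\<forall>\<phi> f. \<phi> \<in> Cell2 A \<and> f \<in> Mor A \<and> tgt0 A f = src0 A (src1 A \<phi>)
    \<longrightarrow> P2 (\<phi> \<lhd>\<^bsub>A\<^esub> f) = cell_r \<phi> (P2 \<phi>) f)"
    (is "_ \<longleftrightarrow> (\<forall>\<phi> f. ?C \<phi> f \<longrightarrow> _ \<phi> f)")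
proof -
  let ?D = "semistrict_data A B p0 P1 P2"
  let ?L = "\<lambda>\<phi> f. P2 (\<phi> \<lhd>\<^bsub>A\<^esub> f) \<cdot> (compositor ?D (tgt1 A \<phi>, f) \<star> \<langle>p0 (tgt0 A (src1 A \<phi>)) \<rhd> (on2 F \<phi> \<lhd> on1 F f)\<rangle>)"
  let ?R = "\<lambda>\<phi> f. (\<langle>(on2 G \<phi> \<lhd> on1 G f) \<lhd> p0 (src0 A f)\<rangle> \<star> compositor ?D (src1 A \<phi>, f))
      \<cdot> (interch B (on2 G \<phi>) (ladj (P1 f)) \<star> \<langle>ladj (P1 (src1 A \<phi>)) \<lhd> on1 F f\<rangle>)
      \<cdot> (\<langle>on1 G (tgt1 A \<phi>) \<rhd> ladj (P1 f)\<rangle> \<star> (P2 \<phi> \<lhd>\<lhd> on1 F f))"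
  have *: "?L \<phi> f = P2 (\<phi> \<lhd>\<^bsub>A\<^esub> f) \<and> ?R \<phi> f = cell_r \<phi> (P2 \<phi>) f" if "?C \<phi> f" for \<phi> f
    using fibre_ends[OF _ P2[rule_format, of "\<phi> \<lhd>\<^bsub>A\<^esub> f"]] fibre_ends[OF _ P2[rule_format, of \<phi>]] that
    by (simp add: cell_r_def B.hpaste_def)
  have "left_whiskering_law A B F G ?D \<longleftrightarrow> (\<forall>\<phi> f. ?C \<phi> f \<longrightarrow> ?L \<phi> f = ?R \<phi> f)"
    unfolding left_whiskering_law_def in1_def in2_def semistrict_data_sel(1-3)
  proof (intro iffI allI impI, goal_cases)
    case (1 \<phi> f)
    show ?case
      by (rule 1(1)[rule_format, of f "src0 A f" "tgt0 A f" "src1 A \<phi>" "tgt0 A (src1 A \<phi>)" \<phi> "tgt1 A \<phi>"]) (use 1(2) in simp)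
  next
    case (2 X Y Z f g g' \<psi>)
    then have e: "g = src1 A \<psi>" "g' = tgt1 A \<psi>" "X = src0 A f" "Z = tgt0 A (src1 A \<psi>)" by auto
    show ?case unfolding e by (rule 2(1)[rule_format]) (use 2(2) in auto)
  qed
  then show ?thesis using * by simp
qed

end

text \<open>With identity unitors and compositors these laws only compare identity 3-cells, whose
  boundaries match because the left adjoints are strictly multiplicative.\<close>

lemma semistrict_structure:
  "unitors A B (semistrict_data A B p0 P1 P2)" "compositors A B F G (semistrict_data A B p0 P1 P2)"
  "associativity_law A B F G (semistrict_data A B p0 P1 P2)" "unit_laws A B F G (semistrict_data A B p0 P1 P2)"
  by (auto simp: unitors_def compositors_def associativity_law_def unit_laws_def composable_def in1_def in3_def iso3_iff)

lemma semistrict_semistrict_data: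
  assumes "p0 \<in> extensional (Ob A)" "P1 \<in> extensional (Mor A)"
    and "cell_extension A B F G M p0 P1 p2 P2" "cell3_law A B F G (semistrict_data A B p0 P1 P2)"
  shows "semistrict A B F G (semistrict_data A B p0 P1 P2)"
  using assms semistrict_structure adj strict p0_in
  by (auto simp: semistrict_def trinatural_def trinat_extensional_def cell_extension_def obj_components_def composable_def
    semistrict_data_def)

end

text \<open>Extensionality fixes unitors and compositors also outside their domains, so a
  semi-strict transformation is determined by its remaining three fields.\<close>

lemma semistrict_eq_data:
  assumes "semistrict A B F G p"
  shows "p = semistrict_data A B (tr0 p) (tradj p) (tr2 p)"
proof -
  have "unitor p = (\<lambda>X \<in> Ob A. \<langle>id2 B (tr0 p X)\<rangle>\<^bsub>B\<^esub>)"
    using assms by (intro ext) (auto simp: semistrict_def trinatural_def trinat_extensional_def extensional_def)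
  moreover have "compositor p = (\<lambda>(g, f) \<in> composable A. \<langle>tr1 p (g \<bullet>\<^bsub>A\<^esub> f)\<rangle>\<^bsub>B\<^esub>)"
    using assms by (intro ext) (auto simp: semistrict_def trinatural_def trinat_extensional_def extensional_def restrict_def)
  ultimately show ?thesis by (simp add: semistrict_data_def)
qed

text \<open>For uniqueness: a transformation with prescribed components on generators extends them
  in the sense of \<open>adj_extension\<close> and \<open>cell_extension\<close>, so uniqueness of
  those extensions applies. The sets \<open>M\<close> and \<open>N\<close> are arbitrary since the
  components are compared with themselves.\<close>

lemma semistrict_extension:
  assumes "semistrict A B F G p"
  shows "obj_components A B F G (tr0 p)" "tr0 p \<in> extensional (Ob A)"
    "adj_extension A B F G M (tr0 p) (tradj p) (tradj p)"
    "cell_extension A B F G N (tr0 p) (tradj p) (tr2 p) (tr2 p)"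
proof -
  note * = semistrict_eq_data[OF assms, symmetric]
  show "obj_components A B F G (tr0 p)" "tr0 p \<in> extensional (Ob A)"
    "adj_extension A B F G M (tr0 p) (tradj p) (tradj p)"
    "cell_extension A B F G N (tr0 p) (tradj p) (tr2 p) (tr2 p)"
    using assms unfolding adj_extension_def cell_extension_def * semistrict_def trinatural_def trinat_extensional_def by auto
qed

context cofibrant_transformation_objects
begin

lemma ex1_cell_extension:
  assumes P1: "adj_extension A B F G (generating_mors K H) p0 p1 P1"
    and p2: "cell_components A B F G (generating_cells K H) p0 P1 p2"
  shows "\<exists>!P2. cell_extension A B F G (generating_cells K H) p0 P1 p2 P2"
proof -
  interpret adjoint_transformation_data A B F G p0 P1
    using P1 by unfold_locales (simp_all add: adj_extension_def)
  have M: "generating_cells K H \<subseteq> Cell2 A" using generating_cells_in by blast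
  have iff: "cell_extension A B F G (generating_cells K H) p0 P1 p2 P2 \<longleftrightarrow>
    P2 \<in> extensional (Cell2 A) \<and> (\<forall>\<phi> \<in> generating_cells K H. P2 \<phi> = p2 \<phi>) \<and> (\<forall>\<phi> \<in> Cell2 A. P2 \<phi> \<in> fibre \<phi>)
    \<and> (\<forall>f \<in> Mor A. P2 (id2 A f) = \<langle>ladj (P1 f)\<rangle>)
    \<and> (\<forall>\<phi> \<psi>. \<phi> \<in> Cell2 A \<and> \<psi> \<in> Cell2 A \<and> tgt1 A \<phi> = src1 A \<psi> \<longrightarrow> P2 (\<psi> \<odot>\<^bsub>A\<^esub> \<phi>) = cell_v \<psi> (P2 \<psi>) \<phi> (P2 \<phi>))
    \<and> (\<forall>\<phi> g. \<phi> \<in> Cell2 A \<and> g \<in> Mor A \<and> tgt0 A (src1 A \<phi>) = src0 A g \<longrightarrow> P2 (g \<rhd>\<^bsub>A\<^esub> \<phi>) = cell_l g \<phi> (P2 \<phi>))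
    \<and> (\<forall>\<phi> f. \<phi> \<in> Cell2 A \<and> f \<in> Mor A \<and> tgt0 A f = src0 A (src1 A \<phi>) \<longrightarrow> P2 (\<phi> \<lhd>\<^bsub>A\<^esub> f) = cell_r \<phi> (P2 \<phi>) f)" for P2
  \<comment> \<open>The laws can be translated into operations on fibres only when the values of
    \<open>P2\<close> lie in the fibres; otherwise both sides of the equivalence are false.\<close>
  proof (cases "\<forall>\<phi> \<in> Cell2 A. P2 \<phi> \<in> fibre \<phi>")
    case True
    show ?thesis
      unfolding cell_extension_def cell_components_iff[OF subset_refl] identity_law_iff[OF True] composition_law_iff[OF True]
        right_whiskering_law_iff[OF True] left_whiskering_law_iff[OF True] ..
  next
    case False
    then show ?thesis
      by (simp only: cell_extension_def cell_components_iff[OF subset_refl] simp_thms)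
  qed
  show ?thesis unfolding iff
    by (rule ex1_cell_lift[OF underlying_sesquicategory sesquicategory_over]) (use p2[unfolded cell_components_iff[OF M]] in blast)
qed

lemma ex1_semistrict:
  assumes p0: "p0 \<in> extensional (Ob A)"
    and p1: "adj_components A B F G (generating_mors K H) p0 p1"
    and P1: "adj_extension A B F G (generating_mors K H) p0 p1 P1"
    and p2: "cell_components A B F G (generating_cells K H) p0 P1 p2"
    and P2: "cell_extension A B F G (generating_cells K H) p0 P1 p2 P2"
    and c3: "cell3_law A B F G (semistrict_data A B p0 P1 P2)"
  shows "\<exists>!p. semistrict A B F G p \<and> (\<forall>X \<in> Ob A. tr0 p X = p0 X)
     \<and> (\<forall>f \<in> generating_mors K H. tradj p f = p1 f) \<and> (\<forall>\<phi> \<in> generating_cells K H. tr2 p \<phi> = p2 \<phi>)" (is "\<exists>!p. ?P p")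
proof (rule ex1I[of _ "semistrict_data A B p0 P1 P2"])
  interpret adjoint_transformation_data A B F G p0 P1
    using P1 by unfold_locales (simp_all add: adj_extension_def)
  show "?P (semistrict_data A B p0 P1 P2)"
    using semistrict_semistrict_data[OF p0 _ P2 c3] P1 P2 by (simp add: adj_extension_def cell_extension_def)
  fix p assume p: "?P p"
  then have s: "semistrict A B F G p" by simp
  note ext = semistrict_extension[OF s]
  have [simp]: "tr0 p = p0" using ext(2) p p0 by (auto simp: extensional_def fun_eq_iff)
  have "adj_extension A B F G (generating_mors K H) p0 p1 (tradj p)"
    using ext(3)[of "generating_mors K H"] p by (simp add: adj_extension_def)
  then have [simp]: "tradj p = P1" using ex1_adj_extension[OF p1] P1 by blast
  have "cell_extension A B F G (generating_cells K H) p0 P1 p2 (tr2 p)"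
    using ext(4)[of "generating_cells K H"] p by (simp add: cell_extension_def)
  then have [simp]: "tr2 p = P2" using ex1_cell_extension[OF P1 p2] P2 by blast
  show "p = semistrict_data A B p0 P1 P2" using semistrict_eq_data[OF s] by simp
qed

end

text \<open>The object components may be given with arbitrary values outside \<open>Ob A\<close>,
  while the components of a transformation are extensional. All conditions evaluate them at objects
  only, which allows passing to the restriction.\<close>

lemma (in gray_category) cong_objects:
  assumes "\<forall>X \<in> Ob A. p0 X = p0' X"
  shows "obj_components A B F G p0 = obj_components A B F G p0'"
    "adj_components A B F G M p0 p1 \<longleftrightarrow> adj_components A B F G M p0' p1"
    "adj_extension A B F G M p0 p1 P1 \<longleftrightarrow> adj_extension A B F G M p0' p1 P1"
    "cell_components A B F G N p0 P1 p2 \<longleftrightarrow> cell_components A B F G N p0' P1 p2"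
    "cell_extension A B F G N p0 P1 p2 P2 \<longleftrightarrow> cell_extension A B F G N p0' P1 p2 P2"
    "cell3_law A B F G (semistrict_data A B p0 P1 P2) \<longleftrightarrow> cell3_law A B F G (semistrict_data A B p0' P1 P2)"
proof -
  note [simp] = assms[rule_format]
  \<comment> \<open>With this congruence rule the premise of an implication is available while its
    conclusion is simplified; it supplies the membership in \<open>Ob A\<close> needed to replace
    \<open>p0\<close> by \<open>p0'\<close>.\<close>
  have [cong]: "\<And>P P' Q Q'. P = P' \<Longrightarrow> (P' \<Longrightarrow> Q = Q') \<Longrightarrow> (P \<longrightarrow> Q) = (P' \<longrightarrow> Q')" by blast
  show "obj_components A B F G p0 = obj_components A B F G p0'"
    by (simp add: obj_components_def)
  show a: "adj_components A B F G M p0 p1 \<longleftrightarrow> adj_components A B F G M p0' p1" for M p1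
    by (simp add: adj_components_alt)
  show "adj_extension A B F G M p0 p1 P1 \<longleftrightarrow> adj_extension A B F G M p0' p1 P1"
    unfolding adj_extension_def strict_adj_def a by (simp add: in1_def)
  show c: "cell_components A B F G N p0 P1 p2 \<longleftrightarrow> cell_components A B F G N p0' P1 p2" for N p2
    by (simp add: cell_components_alt)
  show "cell3_law A B F G (semistrict_data A B p0 P1 P2) \<longleftrightarrow> cell3_law A B F G (semistrict_data A B p0' P1 P2)"
    unfolding cell3_law_def in1_def by auto
  have comp: "compositor (semistrict_data A B p0 P1 P2) = compositor (semistrict_data A B p0' P1 P2)"
    by (simp add: semistrict_data_def)
  show "cell_extension A B F G N p0 P1 p2 P2 \<longleftrightarrow> cell_extension A B F G N p0' P1 p2 P2"
    unfolding cell_extension_def c composition_law_def identity_law_def right_whiskering_law_def left_whiskering_law_def comp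
    by (auto simp: in1_def)
qed

section \<open>Trimodifications and perturbations\<close>

locale semistrict_pair = A: gray_category A + B: gray_category B + F: gray_functor_on A B F + G: gray_functor_on A B G
  for A :: "('o, 'a, 'b, 'c) gray" and B :: "('o1, 'a1, 'b1, 'c1) gray" (structure)
    and F G :: "('o, 'a, 'b, 'c, 'o1, 'a1, 'b1, 'c1) gmap" +
  fixes p q :: "('o, 'a, 'b, 'a1, 'b1, 'c1) trinat"
  assumes p: "semistrict A B F G p" and q: "semistrict A B F G q"

sublocale semistrict_pair \<subseteq> p: adjoint_transformation_data A B F G "tr0 p" "tradj p"
  using p by unfold_locales (auto simp: semistrict_def trinatural_def obj_components_def)

sublocale semistrict_pair \<subseteq> q: adjoint_transformation_data A B F G "tr0 q" "tradj q"
  using q by unfold_locales (auto simp: semistrict_def trinatural_def obj_components_def)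

locale semistrict_transformation = adjoint_transformation_data A B F G "tr0 p" "tradj p"
  for A :: "('o, 'a, 'b, 'c) gray" and B :: "('o1, 'a1, 'b1, 'c1) gray" (structure)
    and F G :: "('o, 'a, 'b, 'c, 'o1, 'a1, 'b1, 'c1) gmap" and p :: "('o, 'a, 'b, 'a1, 'b1, 'c1) trinat" +
  assumes ss: "semistrict A B F G p"
begin

lemma unitor_compositor [simp]:
  "X \<in> Ob A \<Longrightarrow> unitor p X = \<langle>id2 B (tr0 p X)\<rangle>"
  "\<lbrakk>f \<in> Mor A; g \<in> Mor A; tgt0 A f = src0 A g\<rbrakk> \<Longrightarrow> compositor p (g, f) = \<langle>tr1 p (g \<bullet>\<^bsub>A\<^esub> f)\<rangle>"
  using ss by (auto simp: semistrict_def composable_def)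

lemma tr2_fibre [simp]: "\<phi> \<in> Cell2 A \<Longrightarrow> tr2 p \<phi> \<in> fibre \<phi>"
  using ss cell_components_iff[OF subset_refl, of "tr2 p"] by (simp add: semistrict_def trinatural_def)

lemma tr2_in_fibre: "\<forall>\<phi> \<in> Cell2 A. tr2 p \<phi> \<in> fibre \<phi>"
  by simp

lemmas tr2_law_iffs = identity_law_iff[OF tr2_in_fibre] composition_law_iff[OF tr2_in_fibre]
  right_whiskering_law_iff[OF tr2_in_fibre] left_whiskering_law_iff[OF tr2_in_fibre]

lemma tr2_laws:
  "f \<in> Mor A \<Longrightarrow> tr2 p (id2 A f) = \<langle>tr1 p f\<rangle>"
  "\<lbrakk>\<phi> \<in> Cell2 A; \<psi> \<in> Cell2 A; tgt1 A \<phi> = src1 A \<psi>\<rbrakk> \<Longrightarrow> tr2 p (\<psi> \<odot>\<^bsub>A\<^esub> \<phi>) = cell_v \<psi> (tr2 p \<psi>) \<phi> (tr2 p \<phi>)"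
  "\<lbrakk>\<phi> \<in> Cell2 A; g \<in> Mor A; tgt0 A (src1 A \<phi>) = src0 A g\<rbrakk> \<Longrightarrow> tr2 p (g \<rhd>\<^bsub>A\<^esub> \<phi>) = cell_l g \<phi> (tr2 p \<phi>)"
  "\<lbrakk>\<phi> \<in> Cell2 A; f \<in> Mor A; tgt0 A f = src0 A (src1 A \<phi>)\<rbrakk> \<Longrightarrow> tr2 p (\<phi> \<lhd>\<^bsub>A\<^esub> f) = cell_r \<phi> (tr2 p \<phi>) f"
  using ss unfolding semistrict_def trinatural_def tr2_law_iffs[unfolded semistrict_eq_data[OF ss, symmetric]] by blast+

definition component :: "'b \<Rightarrow> ('b1, 'c1) quintet" where
  "component \<phi> = quint \<phi> (tr2 p \<phi>)"

lemma component_sel [simp]: "qtop (component \<phi>) = tr1 p (src1 A \<phi>)" "qleft (component \<phi>) = tr0 p (tgt0 A (src1 A \<phi>)) \<rhd> on2 F \<phi>"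
  "qbot (component \<phi>) = tr1 p (tgt1 A \<phi>)" "qright (component \<phi>) = on2 G \<phi> \<lhd> tr0 p (src0 A (src1 A \<phi>))" "qcell (component \<phi>) = tr2 p \<phi>"
  by (simp_all add: component_def)

lemma is_quintet_component [simp]: "\<phi> \<in> Cell2 A \<Longrightarrow> B.is_quintet (component \<phi>)"
  by (simp add: component_def)

text \<open>The laws for a semi-strict transformation as equations of quintets, which is the form in
  which cylinders can be pasted along them.\<close>

lemma component_laws:
  "f \<in> Mor A \<Longrightarrow> component (id2 A f) = B.vid (tr1 p f)"
  "\<lbrakk>\<phi> \<in> Cell2 A; \<psi> \<in> Cell2 A; tgt1 A \<phi> = src1 A \<psi>\<rbrakk> \<Longrightarrow> component (\<psi> \<odot>\<^bsub>A\<^esub> \<phi>) = B.vpaste (component \<psi>) (component \<phi>)"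
  "\<lbrakk>\<phi> \<in> Cell2 A; g \<in> Mor A; tgt0 A (src1 A \<phi>) = src0 A g\<rbrakk>
    \<Longrightarrow> component (g \<rhd>\<^bsub>A\<^esub> \<phi>) = B.hpaste (B.wlq (on1 G g) (component \<phi>)) (B.transpose (B.iq (tr1 p g) (on2 F \<phi>)))"
  "\<lbrakk>\<phi> \<in> Cell2 A; f \<in> Mor A; tgt0 A f = src0 A (src1 A \<phi>)\<rbrakk>
    \<Longrightarrow> component (\<phi> \<lhd>\<^bsub>A\<^esub> f) = B.hpaste (B.iq (on2 G \<phi>) (tr1 p f)) (B.wrq (component \<phi>) (on1 F f))"
  unfolding component_def by (simp_all add: tr2_laws quint_v quint_l quint_r)

end

sublocale semistrict_pair \<subseteq> p: semistrict_transformation A B F G p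
  using p by unfold_locales

sublocale semistrict_pair \<subseteq> q: semistrict_transformation A B F G q
  using q by unfold_locales

lemma (in gray_category) mod_mor_components_alt:
  "mod_mor_components A B F G p q M s0 s1 \<longleftrightarrow> (\<forall>f \<in> M. f \<in> Mor A \<longrightarrow>
     \<guillemotleft>s1 f : (on1 G f \<rhd>\<^bsub>B\<^esub> s0 (src0 A f)) \<odot>\<^bsub>B\<^esub> tr1 p f \<cong>\<^bsub>B\<^esub> tr1 q f \<odot>\<^bsub>B\<^esub> (s0 (tgt0 A f) \<lhd>\<^bsub>B\<^esub> on1 F f)\<guillemotright>)"
  by (auto simp: mod_mor_components_def in1_def)

lemma (in gray_category) local_modification_alt:
  "local_modification A B F G p q N s0 s1 \<longleftrightarrow> (\<forall>\<phi> \<in> N. \<phi> \<in> Cell2 A \<longrightarrow>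
     (tr2 q \<phi> \<star>\<^bsub>B\<^esub> \<langle>s0 (tgt0 A (src1 A \<phi>)) \<lhd>\<^bsub>B\<^esub> on1 F (src1 A \<phi>)\<rangle>\<^bsub>B\<^esub>)
       \<cdot>\<^bsub>B\<^esub> (\<langle>tr1 q (tgt1 A \<phi>)\<rangle>\<^bsub>B\<^esub> \<star>\<^bsub>B\<^esub> inv3 B (interch B (s0 (tgt0 A (src1 A \<phi>))) (on2 F \<phi>)))
       \<cdot>\<^bsub>B\<^esub> (s1 (tgt1 A \<phi>) \<star>\<^bsub>B\<^esub> \<langle>tr0 p (tgt0 A (src1 A \<phi>)) \<rhd>\<^bsub>B\<^esub> on2 F \<phi>\<rangle>\<^bsub>B\<^esub>)
     = (\<langle>on2 G \<phi> \<lhd>\<^bsub>B\<^esub> tr0 q (src0 A (src1 A \<phi>))\<rangle>\<^bsub>B\<^esub> \<star>\<^bsub>B\<^esub> s1 (src1 A \<phi>))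
       \<cdot>\<^bsub>B\<^esub> (interch B (on2 G \<phi>) (s0 (src0 A (src1 A \<phi>))) \<star>\<^bsub>B\<^esub> \<langle>tr1 p (src1 A \<phi>)\<rangle>\<^bsub>B\<^esub>)
       \<cdot>\<^bsub>B\<^esub> (\<langle>on1 G (tgt1 A \<phi>) \<rhd>\<^bsub>B\<^esub> s0 (src0 A (src1 A \<phi>))\<rangle>\<^bsub>B\<^esub> \<star>\<^bsub>B\<^esub> tr2 p \<phi>))"
    by (auto simp: local_modification_def in1_def in2_def)

section \<open>Modification cells over morphisms and their cylinders\<close>

locale modification_objects = semistrict_pair A B F G p q
  for A :: "('o, 'a, 'b, 'c) gray" and B :: "('o1, 'a1, 'b1, 'c1) gray" (structure)
    and F G :: "('o, 'a, 'b, 'c, 'o1, 'a1, 'b1, 'c1) gmap" and p q :: "('o, 'a, 'b, 'a1, 'b1, 'c1) trinat" +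
  fixes s0 :: "'o \<Rightarrow> 'b1"
  assumes s0: "mod_obj_components A B p q s0"
begin

lemma s0_ends [simp]: assumes "X \<in> Ob A" shows "s0 X \<in> Cell2 B" "src1 B (s0 X) = tr0 p X" "tgt1 B (s0 X) = tr0 q X"
  using assms s0 by (auto simp: mod_obj_components_def in2_def)

definition mod_fibre :: "'a \<Rightarrow> 'c1 set" where
  "mod_fibre f = {\<Sigma>. \<Sigma> \<in> Cell3 B \<and> invertible3 B \<Sigma> \<and> src2 B \<Sigma> = (on1 G f \<rhd> s0 (src0 A f)) \<odot> tr1 p f
     \<and> tgt2 B \<Sigma> = tr1 q f \<odot> (s0 (tgt0 A f) \<lhd> on1 F f)}"

text \<open>The composition law with identity compositors, solved for the component at
  \<open>g\<close> after \<open>f\<close>.\<close>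

definition mod_mult :: "'a \<Rightarrow> 'c1 \<Rightarrow> 'a \<Rightarrow> 'c1 \<Rightarrow> 'c1" where
  "mod_mult g T f \<Sigma> = (\<langle>on1 G g \<rhd> tr1 q f\<rangle> \<star> (T \<lhd>\<lhd> on1 F f)) \<cdot> ((on1 G g \<rhd>\<rhd> \<Sigma>) \<star> \<langle>tr1 p g \<lhd> on1 F f\<rangle>)"

lemma mod_fibreD: assumes "\<Sigma> \<in> mod_fibre f"
  shows "\<Sigma> \<in> Cell3 B" "invertible3 B \<Sigma>" "src2 B \<Sigma> = (on1 G f \<rhd> s0 (src0 A f)) \<odot> tr1 p f"
     "tgt2 B \<Sigma> = tr1 q f \<odot> (s0 (tgt0 A f) \<lhd> on1 F f)"
  using assms by (auto simp: mod_fibre_def)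

lemma mod_mult_in:
  assumes "f \<in> Mor A" "g \<in> Mor A" "tgt0 A f = src0 A g" "\<Sigma> \<in> mod_fibre f" "T \<in> mod_fibre g"
  shows "mod_mult g T f \<Sigma> \<in> mod_fibre (g \<bullet>\<^bsub>A\<^esub> f)"
proof -
  note [simp] = mod_fibreD[OF assms(4)] mod_fibreD[OF assms(5)] assms(1-3)
  show ?thesis by (simp add: mod_fibre_def mod_mult_def)
qed

lemma mod_mult_unit:
  assumes "f \<in> Mor A" "\<Sigma> \<in> mod_fibre f"
  shows "mod_mult (id1 A (tgt0 A f)) \<langle>s0 (tgt0 A f)\<rangle> f \<Sigma> = \<Sigma>" "mod_mult f \<Sigma> (id1 A (src0 A f)) \<langle>s0 (src0 A f)\<rangle> = \<Sigma>"
  using mod_fibreD[OF assms(2)] assms(1) by (simp_all add: mod_mult_def)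

lemma mod_mult_assoc:
  assumes "f \<in> Mor A" "g \<in> Mor A" "h \<in> Mor A" "tgt0 A f = src0 A g" "tgt0 A g = src0 A h"
     "\<Sigma> \<in> mod_fibre f" "T \<in> mod_fibre g" "U \<in> mod_fibre h"
  shows "mod_mult (h \<bullet>\<^bsub>A\<^esub> g) (mod_mult h U g T) f \<Sigma> = mod_mult h U (g \<bullet>\<^bsub>A\<^esub> f) (mod_mult g T f \<Sigma>)"
proof -
  note [simp] = mod_fibreD[OF assms(6)] mod_fibreD[OF assms(7)] mod_fibreD[OF assms(8)] assms(1-5)
  show ?thesis by (simp add: mod_mult_def)
qed

lemma mod_mor_components_iff:
  assumes "M \<subseteq> Mor A" shows "mod_mor_components A B F G p q M s0 s1 \<longleftrightarrow> (\<forall>f \<in> M. s1 f \<in> mod_fibre f)"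
  using assms by (auto simp: A.mod_mor_components_alt mod_fibre_def iso3_iff in3_def)

context
  fixes s1 assumes s1: "\<forall>f \<in> Mor A. s1 f \<in> mod_fibre f"
begin

lemma s1_ends [simp]: assumes "f \<in> Mor A"
  shows "s1 f \<in> Cell3 B" "src2 B (s1 f) = (on1 G f \<rhd> s0 (src0 A f)) \<odot> tr1 p f"
     "tgt2 B (s1 f) = tr1 q f \<odot> (s0 (tgt0 A f) \<lhd> on1 F f)" "invertible3 B (s1 f)"
  using mod_fibreD s1 assms by auto

lemma mod_unit_law_iff: "mod_unit_law A B p q s0 s1 \<longleftrightarrow> (\<forall>X \<in> Ob A. s1 (id1 A X) = \<langle>s0 X\<rangle>)"
  by (simp add: mod_unit_law_def)

lemma mod_composition_law_iff: "mod_composition_law A B F G p q s0 s1 \<longleftrightarrow>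
   (\<forall>f g. f \<in> Mor A \<and> g \<in> Mor A \<and> tgt0 A f = src0 A g \<longrightarrow> s1 (g \<bullet>\<^bsub>A\<^esub> f) = mod_mult g (s1 g) f (s1 f))"
proof -
  have *: "s1 (g \<bullet>\<^bsub>A\<^esub> f) \<cdot> (\<langle>on1 G g \<rhd> (on1 G f \<rhd> s0 (src0 A f))\<rangle> \<star> compositor p (g, f)) = s1 (g \<bullet>\<^bsub>A\<^esub> f)"
     "(compositor q (g, f) \<star> \<langle>(s0 (tgt0 A g) \<lhd> on1 F g) \<lhd> on1 F f\<rangle>)
       \<cdot> (\<langle>on1 G g \<rhd> tr1 q f\<rangle> \<star> (s1 g \<lhd>\<lhd> on1 F f))
       \<cdot> ((on1 G g \<rhd>\<rhd> s1 f) \<star> \<langle>tr1 p g \<lhd> on1 F f\<rangle>) = mod_mult g (s1 g) f (s1 f)"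
    if "f \<in> Mor A" "g \<in> Mor A" "tgt0 A f = src0 A g" for f g
    using that by (simp_all add: mod_mult_def)
  have "mod_composition_law A B F G p q s0 s1 \<longleftrightarrow> (\<forall>f g. f \<in> Mor A \<and> g \<in> Mor A \<and> tgt0 A f = src0 A g \<longrightarrow>
    s1 (g \<bullet>\<^bsub>A\<^esub> f) \<cdot> (\<langle>on1 G g \<rhd> (on1 G f \<rhd> s0 (src0 A f))\<rangle> \<star> compositor p (g, f))
     = (compositor q (g, f) \<star> \<langle>(s0 (tgt0 A g) \<lhd> on1 F g) \<lhd> on1 F f\<rangle>)
       \<cdot> (\<langle>on1 G g \<rhd> tr1 q f\<rangle> \<star> (s1 g \<lhd>\<lhd> on1 F f))
       \<cdot> ((on1 G g \<rhd>\<rhd> s1 f) \<star> \<langle>tr1 p g \<lhd> on1 F f\<rangle>))"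
    unfolding mod_composition_law_def in1_def by metis
  then show ?thesis by (simp only: * cong: imp_cong conj_cong)
qed

text \<open>The local modification condition regrouped: one side contains \<open>p_\<phi>\<close>
  next to an interchanger, which is \<open>msrc\<close>, the other \<open>q_\<phi>\<close> next to
  an inverse interchanger, which is \<open>mtgt\<close>. The remaining factors, the
  \<open>s1\<close> at source and target of \<open>\<phi>\<close>, lie on their top and bottom
  edges.\<close>

definition msrc :: "'b \<Rightarrow> ('b1, 'c1) quintet" where
  "msrc \<phi> = B.hpaste (B.iq (on2 G \<phi>) (s0 (src0 A (src1 A \<phi>)))) (p.component \<phi>)"

definition mtgt :: "'b \<Rightarrow> ('b1, 'c1) quintet" where
  "mtgt \<phi> = B.hpaste (q.component \<phi>) (B.transpose (B.iq (s0 (tgt0 A (src1 A \<phi>))) (on2 F \<phi>)))"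

definition modif_at :: "'b \<Rightarrow> bool" where
  "modif_at \<phi> \<longleftrightarrow> B.cyl (msrc \<phi>) (mtgt \<phi>) (s1 (src1 A \<phi>)) (s1 (tgt1 A \<phi>))"

lemma is_quintet_m [simp]: "\<phi> \<in> Cell2 A \<Longrightarrow> B.is_quintet (msrc \<phi>)" "\<phi> \<in> Cell2 A \<Longrightarrow> B.is_quintet (mtgt \<phi>)"
  by (simp_all add: msrc_def mtgt_def)

lemma msrc_sel [simp]: assumes "\<phi> \<in> Cell2 A"
  shows "qtop (msrc \<phi>) = (on1 G (src1 A \<phi>) \<rhd> s0 (src0 A (src1 A \<phi>))) \<odot> tr1 p (src1 A \<phi>)"
    "qleft (msrc \<phi>) = tr0 p (tgt0 A (src1 A \<phi>)) \<rhd> on2 F \<phi>"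
    "qbot (msrc \<phi>) = (on1 G (tgt1 A \<phi>) \<rhd> s0 (src0 A (src1 A \<phi>))) \<odot> tr1 p (tgt1 A \<phi>)"
    "qright (msrc \<phi>) = on2 G \<phi> \<lhd> tr0 q (src0 A (src1 A \<phi>))"
  using assms by (simp_all add: msrc_def)

lemma mtgt_sel [simp]: assumes "\<phi> \<in> Cell2 A"
  shows "qtop (mtgt \<phi>) = tr1 q (src1 A \<phi>) \<odot> (s0 (tgt0 A (src1 A \<phi>)) \<lhd> on1 F (src1 A \<phi>))"
    "qleft (mtgt \<phi>) = tr0 p (tgt0 A (src1 A \<phi>)) \<rhd> on2 F \<phi>"
    "qbot (mtgt \<phi>) = tr1 q (tgt1 A \<phi>) \<odot> (s0 (tgt0 A (src1 A \<phi>)) \<lhd> on1 F (tgt1 A \<phi>))"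
    "qright (mtgt \<phi>) = on2 G \<phi> \<lhd> tr0 q (src0 A (src1 A \<phi>))"
  using assms by (simp_all add: mtgt_def)

lemma local_modification_iff:
  assumes "M \<subseteq> Cell2 A" shows "local_modification A B F G p q M s0 s1 \<longleftrightarrow> (\<forall>\<phi> \<in> M. modif_at \<phi>)"
proof -
  have "modif_at \<phi> \<longleftrightarrow> local_modification A B F G p q {\<phi>} s0 s1" if \<phi> [simp]: "\<phi> \<in> Cell2 A" for \<phi>
  proof -
    note [simp] = p.fibre_ends[OF \<phi> p.tr2_fibre[OF \<phi>]] q.fibre_ends[OF \<phi> q.tr2_fibre[OF \<phi>]]
    show ?thesis
      by (simp add: A.local_modification_alt modif_at_def B.cyl_def) (simp add: msrc_def mtgt_def B.hpaste_def)
  qed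
  moreover have "local_modification A B F G p q M s0 s1 \<longleftrightarrow> (\<forall>\<phi> \<in> M. local_modification A B F G p q {\<phi>} s0 s1)"
    by (simp add: A.local_modification_alt)
  ultimately show ?thesis using assms by blast
qed

context
  assumes s1_id: "\<And>X. X \<in> Ob A \<Longrightarrow> s1 (id1 A X) = \<langle>s0 X\<rangle>"
    and s1_comp: "\<And>f g. \<lbrakk>f \<in> Mor A; g \<in> Mor A; tgt0 A f = src0 A g\<rbrakk> \<Longrightarrow> s1 (g \<bullet>\<^bsub>A\<^esub> f) = mod_mult g (s1 g) f (s1 f)"
begin

lemma modif_id: "f \<in> Mor A \<Longrightarrow> modif_at (id2 A f)"
  using B.cyl_vid[of "s1 f"] by (simp add: modif_at_def msrc_def mtgt_def p.component_laws q.component_laws B.hpaste_vid)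

lemma modif_comp:
  assumes "\<phi> \<in> Cell2 A" "\<psi> \<in> Cell2 A" "tgt1 A \<phi> = src1 A \<psi>" "modif_at \<phi>" "modif_at \<psi>"
  shows "modif_at (\<psi> \<odot>\<^bsub>A\<^esub> \<phi>)"
proof -
  note [simp] = A.composable_ends[OF assms(1-3)] assms(1-3)
  have "msrc (\<psi> \<odot>\<^bsub>A\<^esub> \<phi>) = B.vpaste (msrc \<psi>) (msrc \<phi>)"
    by (simp add: msrc_def p.component_laws B.iq_vcomp2_left B.hpaste_vpaste)
  moreover have "mtgt (\<psi> \<odot>\<^bsub>A\<^esub> \<phi>) = B.vpaste (mtgt \<psi>) (mtgt \<phi>)"
    by (simp add: mtgt_def q.component_laws B.iq_vcomp2_right B.transpose_hpaste B.hpaste_vpaste)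
  ultimately show ?thesis using assms B.cyl_vpaste[of "msrc \<phi>" "mtgt \<phi>" "s1 (src1 A \<phi>)" "s1 (tgt1 A \<phi>)"]
    by (simp add: modif_at_def)
qed

text \<open>\<open>mod_mult\<close> is a composite of two 3-cells, and correspondingly the cylinder
  is passed in two stages. First the cylinder at \<open>\<phi>\<close>, whiskered by
  \<open>on1 G g\<close>, stands beside a fixed inverse interchanger; then naturality of the inverse
  interchanger along \<open>s1 g\<close> acts beside the fixed component of
  \<open>q\<close>.\<close>

lemma modif_whl:
  assumes "\<phi> \<in> Cell2 A" "g \<in> Mor A" "tgt0 A (src1 A \<phi>) = src0 A g" "modif_at \<phi>"
  shows "modif_at (g \<rhd>\<^bsub>A\<^esub> \<phi>)"
proof -
  note [simp] = assms(1-3)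
  let ?Y = "src0 A g" and ?Z = "tgt0 A g" and ?X = "src0 A (src1 A \<phi>)"
  let ?J = "\<lambda>\<beta>. B.transpose (B.iq \<beta> (on2 F \<phi>))" and ?w = "B.wlq (on1 G g)"
  let ?q = "?w (q.component \<phi>)"
  have S: "msrc (g \<rhd>\<^bsub>A\<^esub> \<phi>) = B.hpaste (?w (msrc \<phi>)) (?J (tr1 p g))"
    by (simp add: msrc_def p.component_laws B.iq_assoc B.wlq_hpaste B.hpaste_assoc)
  \<comment> \<open>The halfway quintet in its two readings: the inverse interchangers for
    \<open>tr1 p g\<close> and for the whiskered \<open>s0\<close> merge into the one for their
    composite, which is the source of \<open>s1 g\<close>.\<close>
  have M1: "B.hpaste (?w (mtgt \<phi>)) (?J (tr1 p g)) = B.hpaste ?q (?J (src2 B (s1 g)))"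
    by (simp add: mtgt_def B.wlq_hpaste B.hpaste_assoc B.iq_vcomp2_left B.transpose_vpaste B.iq_assoc B.transpose_wq)
  have T: "B.hpaste ?q (?J (tgt2 B (s1 g))) = mtgt (g \<rhd>\<^bsub>A\<^esub> \<phi>)"
    by (simp add: mtgt_def q.component_laws B.iq_vcomp2_left B.transpose_vpaste B.iq_assoc B.hpaste_assoc)
  have c1: "B.cyl (B.hpaste (?w (msrc \<phi>)) (?J (tr1 p g))) (B.hpaste (?w (mtgt \<phi>)) (?J (tr1 p g)))
    ((on1 G g \<rhd>\<rhd> s1 (src1 A \<phi>)) \<star> \<langle>tr1 p g \<lhd> on1 F (src1 A \<phi>)\<rangle>)
    ((on1 G g \<rhd>\<rhd> s1 (tgt1 A \<phi>)) \<star> \<langle>tr1 p g \<lhd> on1 F (tgt1 A \<phi>)\<rangle>)"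
    using B.cyl_hpaste[OF B.cyl_refl B.cyl_wlq[OF assms(4)[unfolded modif_at_def]], of "?J (tr1 p g)" "on1 G g"] by simp
  have c2: "B.cyl (B.hpaste ?q (?J (src2 B (s1 g)))) (B.hpaste ?q (?J (tgt2 B (s1 g))))
    (\<langle>on1 G g \<rhd> tr1 q (src1 A \<phi>)\<rangle> \<star> (s1 g \<lhd>\<lhd> on1 F (src1 A \<phi>)))
    (\<langle>on1 G g \<rhd> tr1 q (tgt1 A \<phi>)\<rangle> \<star> (s1 g \<lhd>\<lhd> on1 F (tgt1 A \<phi>)))"
    using B.cyl_hpaste[OF B.cyl_transpose_iq[of "on2 F \<phi>" "s1 g"] B.cyl_refl[of ?q]] by simp
  show ?thesis using B.cyl_trans[OF c1[unfolded M1] c2[unfolded T]]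
    unfolding modif_at_def S by (simp add: s1_comp mod_mult_def)
qed

text \<open>The same two stages in the opposite order: naturality of the interchanger along
  \<open>s1 f\<close> comes first, beside the component of \<open>p\<close>, and then the whiskered
  cylinder at \<open>\<phi>\<close>.\<close>

lemma modif_whr:
  assumes "\<phi> \<in> Cell2 A" "f \<in> Mor A" "tgt0 A f = src0 A (src1 A \<phi>)" "modif_at \<phi>"
  shows "modif_at (\<phi> \<lhd>\<^bsub>A\<^esub> f)"
proof -
  note [simp] = assms(1-3)
  let ?I = "\<lambda>\<alpha>. B.iq (on2 G \<phi>) \<alpha>" and ?w = "\<lambda>Q. B.wrq Q (on1 F f)"
  have S: "msrc (\<phi> \<lhd>\<^bsub>A\<^esub> f) = B.hpaste (?I (src2 B (s1 f))) (?w (p.component \<phi>))"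
    by (simp add: msrc_def p.component_laws B.iq_assoc B.iq_vcomp2_right B.hpaste_assoc)
  have M: "B.hpaste (?I (tgt2 B (s1 f))) (?w (p.component \<phi>)) = B.hpaste (?I (tr1 q f)) (?w (msrc \<phi>))"
    by (simp add: msrc_def B.wrq_hpaste B.hpaste_assoc B.iq_vcomp2_right B.iq_assoc)
  have T: "B.hpaste (?I (tr1 q f)) (?w (mtgt \<phi>)) = mtgt (\<phi> \<lhd>\<^bsub>A\<^esub> f)"
    by (simp add: mtgt_def q.component_laws B.wrq_hpaste B.transpose_wq B.iq_assoc B.hpaste_assoc)
  have c1: "B.cyl (B.hpaste (?I (src2 B (s1 f))) (?w (p.component \<phi>))) (B.hpaste (?I (tgt2 B (s1 f))) (?w (p.component \<phi>)))
    ((on1 G (src1 A \<phi>) \<rhd>\<rhd> s1 f) \<star> \<langle>tr1 p (src1 A \<phi>) \<lhd> on1 F f\<rangle>)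
    ((on1 G (tgt1 A \<phi>) \<rhd>\<rhd> s1 f) \<star> \<langle>tr1 p (tgt1 A \<phi>) \<lhd> on1 F f\<rangle>)"
    using B.cyl_hpaste[OF B.cyl_refl[of "?w (p.component \<phi>)"] B.cyl_iq[of "on2 G \<phi>" "s1 f"]] by simp
  have c2: "B.cyl (B.hpaste (?I (tr1 q f)) (?w (msrc \<phi>))) (B.hpaste (?I (tr1 q f)) (?w (mtgt \<phi>)))
    (\<langle>on1 G (src1 A \<phi>) \<rhd> tr1 q f\<rangle> \<star> (s1 (src1 A \<phi>) \<lhd>\<lhd> on1 F f))
    (\<langle>on1 G (tgt1 A \<phi>) \<rhd> tr1 q f\<rangle> \<star> (s1 (tgt1 A \<phi>) \<lhd>\<lhd> on1 F f))"
    using B.cyl_hpaste[OF B.cyl_wrq[OF assms(4)[unfolded modif_at_def]] B.cyl_refl[of "?I (tr1 q f)"], of "on1 F f"] by simp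
  show ?thesis using B.cyl_trans[OF c1[unfolded M] c2[unfolded T]]
    unfolding modif_at_def S by (simp add: s1_comp mod_mult_def)
qed

end

end

end

text \<open>As in \<open>cong_objects\<close>, this permits replacing given object components by
  their restriction to \<open>Ob A\<close>.\<close>

lemma (in gray_category) cong_modification_objects:
  assumes "\<forall>X \<in> Ob A. s0 X = s0' X"
  shows "mod_obj_components A B p q s0 \<longleftrightarrow> mod_obj_components A B p q s0'"
    "mod_mor_components A B F G p q M s0 s1 \<longleftrightarrow> mod_mor_components A B F G p q M s0' s1"
    "mod_extension A B F G p q M s0 s1 S1 \<longleftrightarrow> mod_extension A B F G p q M s0' s1 S1"
    "local_modification A B F G p q N s0 s1 \<longleftrightarrow> local_modification A B F G p q N s0' s1"
proof -
  note [simp] = assms[rule_format]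
  show "mod_obj_components A B p q s0 \<longleftrightarrow> mod_obj_components A B p q s0'"
    by (simp add: mod_obj_components_def)
  show c: "mod_mor_components A B F G p q M s0 s1 \<longleftrightarrow> mod_mor_components A B F G p q M s0' s1" for M s1
    by (simp add: mod_mor_components_alt)
  have l: "mod_unit_law A B p q s0 S1 \<longleftrightarrow> mod_unit_law A B p q s0' S1"
     "mod_composition_law A B F G p q s0 S1 \<longleftrightarrow> mod_composition_law A B F G p q s0' S1"
    by (simp add: mod_unit_law_def) (auto simp: mod_composition_law_def in1_def)
  show "mod_extension A B F G p q M s0 s1 S1 \<longleftrightarrow> mod_extension A B F G p q M s0' s1 S1"
    unfolding mod_extension_def c l ..
  show "local_modification A B F G p q N s0 s1 \<longleftrightarrow> local_modification A B F G p q N s0' s1"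
    by (simp add: local_modification_alt)
qed

context modification_objects
begin

lemma mod_extension_iff:
  "mod_extension A B F G p q M s0 s1 S1 \<longleftrightarrow> S1 \<in> extensional (Mor A) \<and> (\<forall>f \<in> M. S1 f = s1 f) \<and> (\<forall>f \<in> Mor A. S1 f \<in> mod_fibre f)
    \<and> (\<forall>X \<in> Ob A. S1 (id1 A X) = \<langle>s0 X\<rangle>)
    \<and> (\<forall>f g. f \<in> Mor A \<and> g \<in> Mor A \<and> tgt0 A f = src0 A g \<longrightarrow> S1 (g \<bullet>\<^bsub>A\<^esub> f) = mod_mult g (S1 g) f (S1 f))"
proof (cases "\<forall>f \<in> Mor A. S1 f \<in> mod_fibre f")
  case True
  show ?thesis
    unfolding mod_extension_def mod_mor_components_iff[OF subset_refl] mod_unit_law_iff[OF True] mod_composition_law_iff[OF True] ..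
next
  case False
  then show ?thesis by (simp only: mod_extension_def mod_mor_components_iff[OF subset_refl] simp_thms)
qed

end

locale cofibrant_modification_objects = cofibrant_gray_category A K H + modification_objects A B F G p q s0
  for A K H and B (structure) and F G p q s0
begin

lemma ex1_mod_extension:
  assumes "mod_mor_components A B F G p q (generating_mors K H) s0 s1"
  shows "\<exists>!S1. mod_extension A B F G p q (generating_mors K H) s0 s1 S1"
proof -
  have "generating_mors K H \<subseteq> Mor A" using generating_mors_in by blast
  then have gen: "\<And>f. f \<in> generating_mors K H \<Longrightarrow> s1 f \<in> mod_fibre f"
    using assms by (simp add: mod_mor_components_iff)
  have id: "X \<in> Ob A \<Longrightarrow> \<langle>s0 X\<rangle> \<in> mod_fibre (id1 A X)" for X
    by (simp add: mod_fibre_def)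
  show ?thesis unfolding mod_extension_iff
    by (rule ex1_mor_lift)
      (erule id | erule (4) mod_mult_in | erule (1) mod_mult_unit | erule (7) mod_mult_assoc | erule gen
        | erule id1_ends | erule (2) comp1_ends)+
qed

lemma ex1_trimodification:
  assumes s0: "s0 \<in> extensional (Ob A)"
    and s1: "mod_mor_components A B F G p q (generating_mors K H) s0 s1"
    and S1: "mod_extension A B F G p q (generating_mors K H) s0 s1 S1"
    and gen: "local_modification A B F G p q (generating_cells K H) s0 S1"
  shows "\<exists>!s. trimodification A B F G p q s \<and> (\<forall>X \<in> Ob A. md0 s X = s0 X) \<and> (\<forall>f \<in> generating_mors K H. md1 s f = s1 f)"
    (is "\<exists>!s. ?P s")
proof (rule ex1I[of _ "\<lparr>md0 = s0, md1 = S1\<rparr>"])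
  have M: "generating_cells K H \<subseteq> Cell2 A" using generating_cells_in by blast
  note S = S1[unfolded mod_extension_iff]
  have fib: "\<forall>f \<in> Mor A. S1 f \<in> mod_fibre f" using S by blast
  \<comment> \<open>The hypothesis at generating 2-cells spreads to all 2-cells; the unit and
    composition laws of \<open>S1\<close> are what the identity and whiskering cases
    consume.\<close>
  have "modif_at S1 \<phi>" if "\<phi> \<in> Cell2 A" for \<phi>
    using that
  proof (induction rule: cell_induct)
    case (id f) then show ?case using modif_id[OF fib] S by simp
  next
    case (gen \<phi>) then show ?case using gen local_modification_iff[OF fib M] assms(4) by simp
  next
    case (comp \<phi> \<psi>) then show ?case using modif_comp[OF fib] S by simp
  next
    case (whl \<phi> g) then show ?case using modif_whl[OF fib] S by simp
  next
    case (whr \<phi> f) then show ?case using modif_whr[OF fib] S by simp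
  qed
  then show "?P \<lparr>md0 = s0, md1 = S1\<rparr>"
    using S1 s0 local_modification_iff[OF fib subset_refl] modification_objects.s0[OF modification_objects_axioms]
    by (simp add: trimodification_def mod_extension_def)
  fix s assume s: "?P s"
  then have 0: "md0 s = s0" using s0 by (auto simp: trimodification_def extensional_def fun_eq_iff)
  have "mod_extension A B F G p q (generating_mors K H) s0 s1 (md1 s)"
    using s 0 by (simp add: trimodification_def mod_extension_def)
  then have "md1 s = S1" using ex1_mod_extension[OF s1] S1 by blast
  with 0 show "s = \<lparr>md0 = s0, md1 = S1\<rparr>" by simp
qed

end

section \<open>Perturbations\<close>

context semistrict_pair
begin

context
  fixes s t :: "('o, 'a, 'b1, 'c1) trimod" and \<Omega> :: "'o \<Rightarrow> 'c1"
  assumes s: "trimodification A B F G p q s" and t: "trimodification A B F G p q t"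
    and \<Omega>: "perturbation_components A B s t \<Omega>"
begin

interpretation s: modification_objects A B F G p q "md0 s"
  using s by unfold_locales (simp add: trimodification_def)

interpretation t: modification_objects A B F G p q "md0 t"
  using t by unfold_locales (simp add: trimodification_def)

text \<open>With no prescribed morphisms this merely packages the laws of a trimodification, so that
  \<open>mod_extension_iff\<close> delivers them in terms of \<open>mod_mult\<close>.\<close>

lemma trimodification_extension:
  "mod_extension A B F G p q {} (md0 s) (md1 s) (md1 s)" "mod_extension A B F G p q {} (md0 t) (md1 t) (md1 t)"
  using s t by (simp_all add: trimodification_def mod_extension_def)

lemma \<Omega>_ends [simp]: assumes "X \<in> Ob A" shows "\<Omega> X \<in> Cell3 B" "src2 B (\<Omega> X) = md0 s X" "tgt2 B (\<Omega> X) = md0 t X"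
  using assms \<Omega> by (auto simp: perturbation_components_def in3_def)

definition perturbs :: "'a \<Rightarrow> bool" where
  "perturbs f \<longleftrightarrow> md1 t f \<cdot> ((on1 G f \<rhd>\<rhd> \<Omega> (src0 A f)) \<star> \<langle>tr1 p f\<rangle>)
       = (\<langle>tr1 q f\<rangle> \<star> (\<Omega> (tgt0 A f) \<lhd>\<lhd> on1 F f)) \<cdot> md1 s f"

lemma perturbation_axiom_iff:
  assumes "M \<subseteq> Mor A" shows "perturbation_axiom A B F G p q M s t \<Omega> \<longleftrightarrow> (\<forall>f \<in> M. perturbs f)"
  using assms by (auto simp: perturbation_axiom_def perturbs_def in1_def)

lemma perturbs_id: "X \<in> Ob A \<Longrightarrow> perturbs (id1 A X)"
  using trimodification_extension by (simp add: perturbs_def s.mod_extension_iff t.mod_extension_iff)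

text \<open>The axiom at \<open>f\<close> carries \<open>\<Omega>\<close> from the source of
  \<open>f\<close> to the middle object; regrouped as a cell at the source of \<open>g\<close>, it
  is carried on by the axiom at \<open>g\<close>.\<close>

lemma perturbs_comp:
  assumes "f \<in> Mor A" "g \<in> Mor A" "tgt0 A f = src0 A g" "perturbs f" "perturbs g"
  shows "perturbs (g \<bullet>\<^bsub>A\<^esub> f)"
proof -
  note S = trimodification_extension(1)[unfolded s.mod_extension_iff] and T = trimodification_extension(2)[unfolded t.mod_extension_iff]
  note [simp] = s.mod_fibreD[of "md1 s f" f] s.mod_fibreD[of "md1 s g" g] t.mod_fibreD[of "md1 t f" f] t.mod_fibreD[of "md1 t g" g]
    assms(1-3)
  have [simp]: "md1 s f \<in> s.mod_fibre f" "md1 s g \<in> s.mod_fibre g" "md1 t f \<in> t.mod_fibre f" "md1 t g \<in> t.mod_fibre g"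
    using S T by auto
  have "md1 t (g \<bullet>\<^bsub>A\<^esub> f) \<cdot> ((on1 G (g \<bullet>\<^bsub>A\<^esub> f) \<rhd>\<rhd> \<Omega> (src0 A f)) \<star> \<langle>tr1 p (g \<bullet>\<^bsub>A\<^esub> f)\<rangle>)
    = (\<langle>on1 G g \<rhd> tr1 q f\<rangle> \<star> (md1 t g \<lhd>\<lhd> on1 F f))
      \<cdot> ((on1 G g \<rhd>\<rhd> (md1 t f \<cdot> ((on1 G f \<rhd>\<rhd> \<Omega> (src0 A f)) \<star> \<langle>tr1 p f\<rangle>))) \<star> \<langle>tr1 p g \<lhd> on1 F f\<rangle>)"
    using T by (simp add: t.mod_mult_def)
  also have "\<dots> = (\<langle>on1 G g \<rhd> tr1 q f\<rangle> \<star> (md1 t g \<lhd>\<lhd> on1 F f))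
      \<cdot> ((on1 G g \<rhd>\<rhd> ((\<langle>tr1 q f\<rangle> \<star> (\<Omega> (tgt0 A f) \<lhd>\<lhd> on1 F f)) \<cdot> md1 s f)) \<star> \<langle>tr1 p g \<lhd> on1 F f\<rangle>)"
    by (simp only: assms(4)[unfolded perturbs_def])
  \<comment> \<open>Here \<open>\<Omega>\<close> at the middle object changes hands: whiskered by
    \<open>on1 G g\<close> and by \<open>on1 F f\<close>, it leaves the factor at \<open>f\<close>
    and joins the factor at \<open>g\<close>.\<close>
  also have "\<dots> = (\<langle>on1 G g \<rhd> tr1 q f\<rangle> \<star> ((md1 t g \<cdot> ((on1 G g \<rhd>\<rhd> \<Omega> (src0 A g)) \<star> \<langle>tr1 p g\<rangle>)) \<lhd>\<lhd> on1 F f))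
      \<cdot> ((on1 G g \<rhd>\<rhd> md1 s f) \<star> \<langle>tr1 p g \<lhd> on1 F f\<rangle>)"
    by simp
  also have "\<dots> = (\<langle>on1 G g \<rhd> tr1 q f\<rangle> \<star> (((\<langle>tr1 q g\<rangle> \<star> (\<Omega> (tgt0 A g) \<lhd>\<lhd> on1 F g)) \<cdot> md1 s g) \<lhd>\<lhd> on1 F f))
      \<cdot> ((on1 G g \<rhd>\<rhd> md1 s f) \<star> \<langle>tr1 p g \<lhd> on1 F f\<rangle>)"
    by (simp only: assms(5)[unfolded perturbs_def])
  also have "\<dots> = (\<langle>tr1 q (g \<bullet>\<^bsub>A\<^esub> f)\<rangle> \<star> (\<Omega> (tgt0 A g) \<lhd>\<lhd> on1 F (g \<bullet>\<^bsub>A\<^esub> f))) \<cdot> md1 s (g \<bullet>\<^bsub>A\<^esub> f)"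
    using S by (simp add: s.mod_mult_def)
  finally show ?thesis by (simp add: perturbs_def)
qed

end

end

locale cofibrant_semistrict_pair = cofibrant_gray_category A K H + semistrict_pair A B F G p q
  for A K H and B (structure) and F G p q
begin

lemma ex1_perturbation:
  assumes s: "trimodification A B F G p q s" and t: "trimodification A B F G p q t"
    and \<Omega>: "perturbation_components A B s t \<Omega>"
    and gen: "perturbation_axiom A B F G p q (generating_mors K H) s t \<Omega>"
  shows "\<exists>!\<Omega>'. perturbation A B F G p q s t \<Omega>' \<and> (\<forall>X \<in> Ob A. \<Omega>' X = \<Omega> X)"
proof -
  have M: "generating_mors K H \<subseteq> Mor A" using generating_mors_in by blast
  \<comment> \<open>A perturbation is extensional, so the given components are first cut down to
    \<open>Ob A\<close>. The axiom at generators is assumed for \<open>\<Omega>\<close> and has to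
    be transferred to \<open>\<Psi>\<close>.\<close>
  define \<Psi> where "\<Psi> = restrict \<Omega> (Ob A)"
  have [simp]: "X \<in> Ob A \<Longrightarrow> \<Psi> X = \<Omega> X" for X by (simp add: \<Psi>_def)
  have \<Psi>: "perturbation_components A B s t \<Psi>" using \<Omega> by (simp add: perturbation_components_def)
  note [simp] = perturbs_def[OF s t \<Omega>] perturbs_def[OF s t \<Psi>]
  have "perturbs s t \<Psi> f" if "f \<in> Mor A" for f
    using that
  proof (induction rule: mor_induct)
    case (id X) then show ?case by (rule perturbs_id[OF s t \<Psi>])
  next
    case (gen f)
    then show ?case using assms(4) perturbation_axiom_iff[OF s t \<Omega> M] generating_mors_in by simp
  next
    case (comp f g) then show ?case by (intro perturbs_comp[OF s t \<Psi>])
  qed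
  then have "perturbation A B F G p q s t \<Psi>"
    using \<Psi> perturbation_axiom_iff[OF s t \<Psi> subset_refl] by (simp add: perturbation_def \<Psi>_def)
  then show ?thesis
  proof (intro ex1I[of _ \<Psi>] conjI)
    fix \<Omega>' assume "perturbation A B F G p q s t \<Omega>' \<and> (\<forall>X \<in> Ob A. \<Omega>' X = \<Omega> X)"
    then show "\<Omega>' = \<Psi>" by (auto simp: perturbation_def \<Psi>_def extensional_def restrict_def)
  qed simp_all
qed

end

theorem lemma4p3p1:
  fixes A :: "('o, 'a, 'b, 'c) gray" and B :: "('o1, 'a1, 'b1, 'c1) gray"
    and K :: "('v, 'e, 'g) computad"
    and H :: "('v, ('v, 'e) path, ('v, 'e, 'g) fcell, 'o, 'a, 'b) smap"
    and F G :: "('o, 'a, 'b, 'c, 'o1, 'a1, 'b1, 'c1) gmap"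
  assumes "cofibrant_gray_category A K H" and "gray_category B"
    and "gray_functor A B F" and "gray_functor A B G"
  shows
    "(\<forall>p0 p1 p2.
        obj_components A B F G p0 \<and> adj_components A B F G (generating_mors K H) p0 p1 \<longrightarrow>
        (\<exists>!P1. adj_extension A B F G (generating_mors K H) p0 p1 P1) \<and>
        (\<forall>P1. adj_extension A B F G (generating_mors K H) p0 p1 P1 \<and>
              cell_components A B F G (generating_cells K H) p0 P1 p2 \<longrightarrow>
           (\<exists>!P2. cell_extension A B F G (generating_cells K H) p0 P1 p2 P2) \<and>
           (\<forall>P2. cell_extension A B F G (generating_cells K H) p0 P1 p2 P2 \<and>
                 cell3_law A B F G (semistrict_data A B p0 P1 P2) \<longrightarrow>
              (\<exists>!p. semistrict A B F G p \<and>
                 (\<forall>X \<in> Ob A. tr0 p X = p0 X) \<and>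
                 (\<forall>f \<in> generating_mors K H. tradj p f = p1 f) \<and>
                 (\<forall>\<phi> \<in> generating_cells K H. tr2 p \<phi> = p2 \<phi>)))))
   \<and> (\<forall>p q s0 s1.
        semistrict A B F G p \<and> semistrict A B F G q \<and>
        mod_obj_components A B p q s0 \<and>
        mod_mor_components A B F G p q (generating_mors K H) s0 s1 \<longrightarrow>
        (\<exists>!S1. mod_extension A B F G p q (generating_mors K H) s0 s1 S1) \<and>
        (\<forall>S1. mod_extension A B F G p q (generating_mors K H) s0 s1 S1 \<and>
              local_modification A B F G p q (generating_cells K H) s0 S1 \<longrightarrow>
           (\<exists>!s. trimodification A B F G p q s \<and>
              (\<forall>X \<in> Ob A. md0 s X = s0 X) \<and>
              (\<forall>f \<in> generating_mors K H. md1 s f = s1 f))))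
   \<and> (\<forall>p q s t \<Omega>.
        semistrict A B F G p \<and> semistrict A B F G q \<and>
        trimodification A B F G p q s \<and> trimodification A B F G p q t \<and>
        perturbation_components A B s t \<Omega> \<and>
        perturbation_axiom A B F G p q (generating_mors K H) s t \<Omega> \<longrightarrow>
        (\<exists>!\<Omega>'. perturbation A B F G p q s t \<Omega>' \<and> (\<forall>X \<in> Ob A. \<Omega>' X = \<Omega> X)))"
proof (intro conjI allI impI; (elim conjE)?)
  interpret A: cofibrant_gray_category A K H by fact
  interpret F: gray_functor_on A B F
    using assms by (simp add: gray_functor_on_def A.gray_category_axioms)
  interpret G: gray_functor_on A B G
    using assms by (simp add: gray_functor_on_def A.gray_category_axioms)
  { fix p0 p1 p2
    assume p0: "obj_components A B F G p0" and p1: "adj_components A B F G (generating_mors K H) p0 p1"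
    \<comment> \<open>The locales and existence results below are instantiated at the extensional
      \<open>r0\<close>; \<open>restr\<close> rewrites every hypothesis and goal about
      \<open>p0\<close> into one about \<open>r0\<close>.\<close>
    define r0 where "r0 = restrict p0 (Ob A)"
    have r: "\<forall>X \<in> Ob A. p0 X = r0 X" by (simp add: r0_def)
    note restr = A.cong_objects[of p0 r0, OF r]
    interpret cofibrant_transformation_objects A K H B F G r0
      using p0 by unfold_locales (simp add: obj_components_def r0_def)
    show "\<exists>!P1. adj_extension A B F G (generating_mors K H) p0 p1 P1"
      using p1 unfolding restr by (rule ex1_adj_extension)
    fix P1
    assume P1: "adj_extension A B F G (generating_mors K H) p0 p1 P1"
      and p2: "cell_components A B F G (generating_cells K H) p0 P1 p2"
    show "\<exists>!P2. cell_extension A B F G (generating_cells K H) p0 P1 p2 P2"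
      using P1 p2 unfolding restr by (rule ex1_cell_extension)
    fix P2
    assume P2: "cell_extension A B F G (generating_cells K H) p0 P1 p2 P2"
      and c3: "cell3_law A B F G (semistrict_data A B p0 P1 P2)"
    show "\<exists>!p. semistrict A B F G p \<and> (\<forall>X \<in> Ob A. tr0 p X = p0 X) \<and>
       (\<forall>f \<in> generating_mors K H. tradj p f = p1 f) \<and> (\<forall>\<phi> \<in> generating_cells K H. tr2 p \<phi> = p2 \<phi>)"
      using ex1_semistrict[OF _ p1[unfolded restr] P1[unfolded restr] p2[unfolded restr] P2[unfolded restr] c3[unfolded restr]] by (simp add: r0_def)
  next
    fix p q s0 s1
    assume pq: "semistrict A B F G p" "semistrict A B F G q"
      and s0: "mod_obj_components A B p q s0" and s1: "mod_mor_components A B F G p q (generating_mors K H) s0 s1"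
    define r0 where "r0 = restrict s0 (Ob A)"
    have r: "\<forall>X \<in> Ob A. s0 X = r0 X" by (simp add: r0_def)
    note restr = A.cong_modification_objects[of s0 r0, OF r]
    interpret cofibrant_modification_objects A K H B F G p q r0
      using pq s0[unfolded restr] by unfold_locales
    show "\<exists>!S1. mod_extension A B F G p q (generating_mors K H) s0 s1 S1"
      using s1 unfolding restr by (rule ex1_mod_extension)
    fix S1
    assume S1: "mod_extension A B F G p q (generating_mors K H) s0 s1 S1"
      and l: "local_modification A B F G p q (generating_cells K H) s0 S1"
    show "\<exists>!s. trimodification A B F G p q s \<and> (\<forall>X \<in> Ob A. md0 s X = s0 X) \<and> (\<forall>f \<in> generating_mors K H. md1 s f = s1 f)"
      using ex1_trimodification[OF _ s1[unfolded restr] S1[unfolded restr] l[unfolded restr]] by (simp add: r0_def)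
  next
    fix p q s t \<Omega>
    assume pq: "semistrict A B F G p" "semistrict A B F G q"
      and st: "trimodification A B F G p q s" "trimodification A B F G p q t"
      and o: "perturbation_components A B s t \<Omega>" "perturbation_axiom A B F G p q (generating_mors K H) s t \<Omega>"
    interpret cofibrant_semistrict_pair A K H B F G p q
      using pq by unfold_locales
    show "\<exists>!\<Omega>'. perturbation A B F G p q s t \<Omega>' \<and> (\<forall>X \<in> Ob A. \<Omega>' X = \<Omega> X)"
      using st o by (rule ex1_perturbation)
  }
qed

end
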